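(* Let $n \geq 5$ and let $l \geq 1$ be a real number. There exist constants $C>0$ and $t_0>1$, independent of $t,u_0,u_1$, such that if $(u_0,u_1)\in (L^{1,1}(\mathbf{R}^n)\cap Y^{l+1})\times (L^{1,1}(\mathbf{R}^n)\cap Y^{l})$ and $u$ is the solution of $u_{tt}+Lu+(I+L)^{-1}u_t=0$, $u(0,\cdot)=u_0$, $u_t(0,\cdot)=u_1$, then with $$\varphi_2(t,\xi):=e^{-\frac{t}{2\log(1+|\xi|^2)}}\,\frac{\sin\big(\sqrt{\log(1+|\xi|^2)}\,t\big)}{\sqrt{\log(1+|\xi|^2)}}\,\hat u_1(\xi)+e^{-\frac{t}{2\log(1+|\xi|^2)}}\cos\big(\sqrt{\log(1+|\xi|^2)}\,t\big)\,\hat u_0(\xi)$$ the following holds for all $t\ge t_0$: (a) if ($5\le n\le 8$ and $1\le l<n/2-1$) or ($n>8$ and $n/2-3<l<n/2-1$), then $$\|u(t,\cdot)-\mathcal{F}^{-1}_{\xi\to x}(\varphi_2(t,\xi))(\cdot)\|_{L^2(\mathbf{R}^n)}\le C I_{0,l}\, t^{-\frac{n}{4}};$$ (b) if $n>8$ and $1\le l\le n/2-3$, then $$\|u(t,\cdot)-\mathcal{F}^{-1}_{\xi\to x}(\varphi_2(t,\xi))(\cdot)\|_{L^2(\mathbf{R}^n)}\le C I_{0,l}\, t^{-\frac{l+3}{2}}.$$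
   Context: The Fourier transform is $\mathcal F(f)(\xi)=\hat f(\xi)=\int_{\mathbf{R}^n}e^{-ix\cdot\xi}f(x)\,dx$ (extended to $L^2(\mathbf{R}^n)$), with inverse $\mathcal{F}^{-1}_{\xi\to x}$. The operator $L$ on $L^2(\mathbf{R}^n)$ is the Fourier multiplier $\widehat{Lf}(\xi)=\log(1+|\xi|^2)\hat f(\xi)$ with its maximal domain. For $\delta\ge 0$, $Y^\delta=\{f\in L^2(\mathbf{R}^n):\int_{\mathbf{R}^n}(1+\log(1+|\xi|^2))^\delta|\hat f(\xi)|^2d\xi<\infty\}$, with norm $\|f\|_{Y^\delta}=\big(\int_{\mathbf{R}^n}(1+\log(1+|\xi|^2))^\delta|\hat f(\xi)|^2d\xi\big)^{1/2}$. $L^{1,1}(\mathbf{R}^n)=\{f\in L^1(\mathbf{R}^n):\|f\|_{1,1}:=\int_{\mathbf{R}^n}(1+|x|)|f(x)|dx<\infty\}$. Cauchy problem: $u_{tt}+Lu+(I+L)^{-1}u_t=0$ on $(0,\infty)\times\mathbf{R}^n$, $u(0,\cdot)=u_0$, $u_t(0,\cdot)=u_1$. For $(u_0,u_1)\in Y^2\times Y^1$ the solution is the unique weak solution $u\in C([0,\infty),Y^2)\cap C^1([0,\infty),Y^1)\cap C^2([0,\infty),L^2(\mathbf{R}^n))$; for a.e. $\xi$, $\hat u(t,\xi)$ solves $\hat u_{tt}+\log(1+|\xi|^2)\hat u+(1+\log(1+|\xi|^2))^{-1}\hat u_t=0$ with $\hat u(0,\xi)=\hat u_0(\xi)$, $\hat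 u_t(0,\xi)=\hat u_1(\xi)$. Notation: $I_{0,l}:=\sqrt{\|u_0\|_{1,1}^2+\|u_1\|_{1,1}^2+\|u_0\|_{Y^{l+1}}^2+\|u_1\|_{Y^l}^2}$. *)

theory Defs
  imports "HOL-Analysis.Analysis"
begin

text \<open>Elements of $L^2$, $L^{1,1}$ and $Y^\delta$ are represented by Borel functions, and equality of
  elements is equality almost everywhere. The norms below are only meaningful on the corresponding
  spaces (the integral of a non-integrable function is 0), so they are always used together with
  membership.\<close>

definition L2_space :: "('a::euclidean_space \<Rightarrow> complex) set" where
  "L2_space = {f \<in> borel_measurable lborel. integrable lborel (\<lambda>x. (cmod (f x))\<^sup>2)}"

definition L2_norm :: "('a::euclidean_space \<Rightarrow> complex) \<Rightarrow> real" where
  "L2_norm f = sqrt (LINT x|lborel. (cmod (f x))\<^sup>2)"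

definition L11_space :: "('a::euclidean_space \<Rightarrow> complex) set" where
  "L11_space = {f. integrable lborel f \<and> integrable lborel (\<lambda>x. (1 + norm x) * cmod (f x))}"

definition L11_norm :: "('a::euclidean_space \<Rightarrow> complex) \<Rightarrow> real" where
  "L11_norm f = (LINT x|lborel. (1 + norm x) * cmod (f x))"

definition fourier_integral :: "('a::euclidean_space \<Rightarrow> complex) \<Rightarrow> 'a \<Rightarrow> complex" where
  "fourier_integral f \<xi> = (LINT x|lborel. exp (- \<i> * complex_of_real (x \<bullet> \<xi>)) * f x)"

definition L2_tendsto ::
    "(nat \<Rightarrow> 'a::euclidean_space \<Rightarrow> complex) \<Rightarrow> ('a \<Rightarrow> complex) \<Rightarrow> bool" where
  "L2_tendsto F f \<longleftrightarrow> (\<forall>k. F k \<in> L2_space) \<and> f \<in> L2_space \<and>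
     (\<lambda>k. L2_norm (\<lambda>x. F k x - f x)) \<longlonglongrightarrow> 0"

text \<open>The extension of the Fourier integral from $L^1 \cap L^2$ to $L^2$ by density; the function
  chosen is unique up to a null set.\<close>

definition is_fourier :: "('a::euclidean_space \<Rightarrow> complex) \<Rightarrow> ('a \<Rightarrow> complex) \<Rightarrow> bool" where
  "is_fourier f g \<longleftrightarrow> (\<exists>F. (\<forall>k. integrable lborel (F k)) \<and> L2_tendsto F f \<and>
     L2_tendsto (\<lambda>k. fourier_integral (F k)) g)"

definition fourier :: "('a::euclidean_space \<Rightarrow> complex) \<Rightarrow> 'a \<Rightarrow> complex" where
  "fourier f = (SOME g. is_fourier f g)"

definition inv_fourier :: "('a::euclidean_space \<Rightarrow> complex) \<Rightarrow> 'a \<Rightarrow> complex" where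
  "inv_fourier g = (SOME f. f \<in> L2_space \<and> (AE \<xi> in lborel. fourier f \<xi> = g \<xi>))"

definition Lsym :: "'a::euclidean_space \<Rightarrow> real" where
  "Lsym \<xi> = ln (1 + (norm \<xi>)\<^sup>2)"

definition Y_space :: "real \<Rightarrow> ('a::euclidean_space \<Rightarrow> complex) set" where
  "Y_space \<delta> = {f \<in> L2_space.
     integrable lborel (\<lambda>\<xi>. (1 + Lsym \<xi>) powr \<delta> * (cmod (fourier f \<xi>))\<^sup>2)}"

definition Y_norm :: "real \<Rightarrow> ('a::euclidean_space \<Rightarrow> complex) \<Rightarrow> real" where
  "Y_norm \<delta> f = sqrt (LINT \<xi>|lborel. (1 + Lsym \<xi>) powr \<delta> * (cmod (fourier f \<xi>))\<^sup>2)"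

definition L_dom :: "('a::euclidean_space \<Rightarrow> complex) set" where
  "L_dom = {f \<in> L2_space. (\<lambda>\<xi>. complex_of_real (Lsym \<xi>) * fourier f \<xi>) \<in> L2_space}"

definition L_op :: "('a::euclidean_space \<Rightarrow> complex) \<Rightarrow> 'a \<Rightarrow> complex" where
  "L_op f = inv_fourier (\<lambda>\<xi>. complex_of_real (Lsym \<xi>) * fourier f \<xi>)"

definition I_plus_L_inv :: "('a::euclidean_space \<Rightarrow> complex) \<Rightarrow> 'a \<Rightarrow> complex" where
  "I_plus_L_inv g = (SOME f. f \<in> L_dom \<and> (AE x in lborel. f x + L_op f x = g x))"

text \<open>Continuity and differentiability on $[0,\infty)$ (one-sided at 0) of curves with values in a
  function space \<open>X\<close> with norm \<open>N\<close>. Values at negative times are irrelevant.\<close>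

definition curve_continuous ::
    "('a \<Rightarrow> complex) set \<Rightarrow> (('a \<Rightarrow> complex) \<Rightarrow> real) \<Rightarrow> (real \<Rightarrow> 'a \<Rightarrow> complex) \<Rightarrow> bool" where
  "curve_continuous X N U \<longleftrightarrow> (\<forall>t\<ge>0. U t \<in> X) \<and>
     (\<forall>t\<ge>0. ((\<lambda>s. N (\<lambda>x. U s x - U t x)) \<longlongrightarrow> 0) (at t within {0..}))"

definition curve_has_derivative ::
    "('a \<Rightarrow> complex) set \<Rightarrow> (('a \<Rightarrow> complex) \<Rightarrow> real) \<Rightarrow>
     (real \<Rightarrow> 'a \<Rightarrow> complex) \<Rightarrow> (real \<Rightarrow> 'a \<Rightarrow> complex) \<Rightarrow> bool" where
  "curve_has_derivative X N U V \<longleftrightarrow> (\<forall>t\<ge>0. U t \<in> X \<and> V t \<in> X) \<and>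
     (\<forall>t\<ge>0. ((\<lambda>s. N (\<lambda>x. (U s x - U t x) / complex_of_real (s - t) - V t x)) \<longlongrightarrow> 0)
        (at t within {0..}))"

text \<open>The solution class $C([0,\infty),Y^2) \cap C^1([0,\infty),Y^1) \cap C^2([0,\infty),L^2)$, with
  \<open>v\<close> and \<open>w\<close> the derivatives $u_t$ and $u_{tt}$. As $Y^1$ embeds continuously into $L^2$, the
  $Y^1$-derivative \<open>v\<close> is also the $L^2$-derivative. In this class every term of the equation is a
  curve in $L^2$, so the equation is an identity in $L^2$ for each time.\<close>

definition is_solution ::
    "('a::euclidean_space \<Rightarrow> complex) \<Rightarrow> ('a \<Rightarrow> complex) \<Rightarrow> (real \<Rightarrow> 'a \<Rightarrow> complex) \<Rightarrow> bool" where
  "is_solution u0 u1 u \<longleftrightarrow> (\<exists>v w.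
     curve_continuous (Y_space 2) (Y_norm 2) u \<and>
     curve_has_derivative (Y_space 1) (Y_norm 1) u v \<and>
     curve_continuous (Y_space 1) (Y_norm 1) v \<and>
     curve_has_derivative L2_space L2_norm v w \<and>
     curve_continuous L2_space L2_norm w \<and>
     (\<forall>t>0. AE x in lborel. w t x + L_op (u t) x + I_plus_L_inv (v t) x = 0) \<and>
     (AE x in lborel. u 0 x = u0 x) \<and>
     (AE x in lborel. v 0 x = u1 x))"

text \<open>At $\xi = 0$ the formula divides by zero; this is a null set.\<close>

definition phi2 ::
    "('a::euclidean_space \<Rightarrow> complex) \<Rightarrow> ('a \<Rightarrow> complex) \<Rightarrow> real \<Rightarrow> 'a \<Rightarrow> complex" where
  "phi2 u0 u1 t \<xi> =
     complex_of_real (exp (- t / (2 * Lsym \<xi>)) * (sin (sqrt (Lsym \<xi>) * t) / sqrt (Lsym \<xi>)))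
       * fourier u1 \<xi> +
     complex_of_real (exp (- t / (2 * Lsym \<xi>)) * cos (sqrt (Lsym \<xi>) * t)) * fourier u0 \<xi>"

definition I0 :: "real \<Rightarrow> ('a::euclidean_space \<Rightarrow> complex) \<Rightarrow> ('a \<Rightarrow> complex) \<Rightarrow> real" where
  "I0 l u0 u1 = sqrt ((L11_norm u0)\<^sup>2 + (L11_norm u1)\<^sup>2 + (Y_norm (l + 1) u0)\<^sup>2 + (Y_norm l u1)\<^sup>2)"

end

theory Submission
  imports Defs "HOL-Probability.Characteristic_Functions"
begin

text \<open>On the Fourier side, with \<open>m = log (1 + |\<xi>|\<^sup>2)\<close>, the equation is the damped oscillator
  \<open>y'' + y' / (1 + m) + m y = 0\<close>, which is solved explicitly; by Plancherel's theorem the error is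
  $(2\pi)^{-n/2}$ times the $L^2$ norm of the difference between this solution and \<open>phi2\<close>.
  For \<open>m \<le> 1\<close> both are $O(e^{-mt/16}(|\hat u_0| + |\hat u_1|))$; as $\hat u_0$, $\hat u_1$ are
  bounded by the $L^{1,1}$ norms and \<open>m \<ge> |\<xi>|\<^sup>2 / 3\<close> there, a Gaussian integral gives \<open>t powr (- n / 4)\<close>.
  For \<open>m \<ge> 1\<close> and \<open>p = 1 + m\<close> the multipliers differ by \<open>O(exp (- t / (2 p)) (t / p\<^sup>2 + 1 / p))\<close>,
  and the weights $p^{l+1}$, $p^l$ of the $Y$ norms turn the supremum over \<open>p\<close> of this factor into
  \<open>t powr (- (l + 3) / 2)\<close>. The position of \<open>l\<close> relative to \<open>n / 2 - 3\<close> decides which rate is the slower one.\<close>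

section \<open>The space $L^2$\<close>

text \<open>The solution class provides derivatives only as limits in the norms of
  \<open>Y_space 1\<close> and \<open>L2_space\<close>, and identities only almost everywhere, with
  a null set that depends on the time. There is thus no differential equation in \<open>t\<close> at
  a fixed frequency to be solved, and the formula for the transform of \<open>u\<close> has to be
  derived for curves in L2. Moreover \<open>fourier\<close>, \<open>inv_fourier\<close> and
  \<open>I_plus_L_inv\<close> are choices, meaningful only once existence is known; hence the need
  for completeness, Plancherel and surjectivity on L2. The damping coefficient
  \<open>1 / (1 + m)\<close> fades as \<open>m\<close> grows, so high frequencies decay at no
  uniform rate, and decay in time is paid for with the weights of the Y norms. Only there is the
  profile close to the solution, since \<open>1 / (2 * m)\<close> and
  \<open>1 / (2 * (1 + m))\<close> differ by \<open>O(1 / m^2)\<close>. At low frequencies nothing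
  has to cancel: the solution is overdamped near \<open>m = 0\<close> and diffuses like a heat flow,
  while the multipliers of the profile are bounded by
  \<open>(1 + t) * exp (- t / 2)\<close>.\<close>

lemma null_sequence_bound:
  fixes x :: "nat \<Rightarrow> 'a::real_normed_vector" and y :: "nat \<Rightarrow> real"
  assumes "\<And>k. norm (x k) \<le> y k" "y \<longlonglongrightarrow> 0" shows "x \<longlonglongrightarrow> 0"
  by (rule Lim_null_comparison[of x y]) (use assms in auto)

lemma L2_space_measurable [measurable_dest]: "f \<in> L2_space \<Longrightarrow> f \<in> borel_measurable lborel"
  by (simp add: L2_space_def)

lemma L2_space_borel [intro]: "f \<in> L2_space \<Longrightarrow> f \<in> borel_measurable borel"
  by (simp add: L2_space_def)

lemma L2_space_integrable: "f \<in> L2_space \<Longrightarrow> integrable lborel (\<lambda>x. (cmod (f x))\<^sup>2)"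
  by (simp add: L2_space_def)

lemma L2_norm_nonneg [simp]: "0 \<le> L2_norm f"
  by (simp add: L2_norm_def)

lemma L2_norm_power2: "(L2_norm f)\<^sup>2 = (LINT x|lborel. (cmod (f x))\<^sup>2)"
  by (simp add: L2_norm_def)

lemma L2_norm_cong_AE:
  assumes "f \<in> borel_measurable lborel" "g \<in> borel_measurable lborel" "AE x in lborel. f x = g x"
  shows "L2_norm f = L2_norm g"
  unfolding L2_norm_def using assms
  by (intro arg_cong[where f=sqrt] integral_cong_AE) auto

lemma L2_dominated:
  assumes f [measurable]: "f \<in> borel_measurable lborel" and g: "g \<in> L2_space"
    and C: "0 \<le> C" and le: "AE x in lborel. cmod (f x) \<le> C * cmod (g x)"
  shows "f \<in> L2_space" "L2_norm f \<le> C * L2_norm g"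
proof -
  have [measurable]: "g \<in> borel_measurable lborel" using g by measurable
  have gi: "integrable lborel (\<lambda>x. C\<^sup>2 * (cmod (g x))\<^sup>2)" using L2_space_integrable[OF g] by simp
  have le2: "AE x in lborel. (cmod (f x))\<^sup>2 \<le> C\<^sup>2 * (cmod (g x))\<^sup>2"
    using le by eventually_elim (simp flip: power_mult_distrib, intro power_mono, auto)
  have fi: "integrable lborel (\<lambda>x. (cmod (f x))\<^sup>2)"
    by (rule Bochner_Integration.integrable_bound[OF gi]) (use le2 in auto)
  then show "f \<in> L2_space" by (simp add: L2_space_def)
  have "(L2_norm f)\<^sup>2 \<le> (LINT x|lborel. C\<^sup>2 * (cmod (g x))\<^sup>2)"
    unfolding L2_norm_power2 by (rule integral_mono_AE[OF fi gi le2])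
  also have "\<dots> = (C * L2_norm g)\<^sup>2" by (simp add: power_mult_distrib L2_norm_power2)
  finally show "L2_norm f \<le> C * L2_norm g" by (rule power2_le_imp_le) (simp add: C)
qed

lemma L2_space_cmult:
  assumes "f \<in> L2_space" shows "(\<lambda>x. c * f x) \<in> L2_space"
proof -
  have [measurable]: "f \<in> borel_measurable lborel" using assms by auto
  show ?thesis by (rule L2_dominated(1)[OF _ assms, of _ "cmod c"]) (auto simp: norm_mult)
qed

lemma L2_norm_cmult: "L2_norm (\<lambda>x. c * f x) = cmod c * L2_norm f"
  by (simp add: L2_norm_def norm_mult power_mult_distrib real_sqrt_mult)

lemma L2_space_uminus: "f \<in> L2_space \<Longrightarrow> (\<lambda>x. - f x) \<in> L2_space"
  using L2_space_cmult[of f "-1"] by simp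

lemma borel_measurable_cnj [measurable (raw)]:
  "f \<in> borel_measurable M \<Longrightarrow> (\<lambda>x. cnj (f x)) \<in> borel_measurable M"
  by (rule borel_measurable_continuous_on[of cnj]) (intro continuous_intros, simp)

lemma L2_space_cnj: "f \<in> L2_space \<Longrightarrow> (\<lambda>x. cnj (f x)) \<in> L2_space"
  by (auto simp: L2_space_def)

lemma L2_norm_cnj [simp]: "L2_norm (\<lambda>x. cnj (f x)) = L2_norm f"
  by (simp add: L2_norm_def)

lemma L2_space_zero [simp]: "(\<lambda>x. 0) \<in> L2_space"
  by (simp add: L2_space_def)

lemma cmod_add_power2_le: "(cmod (a + b))\<^sup>2 \<le> 2 * (cmod a)\<^sup>2 + 2 * (cmod b)\<^sup>2"
proof -
  have "(cmod (a + b))\<^sup>2 \<le> (cmod a + cmod b)\<^sup>2" by (intro power_mono norm_triangle_ineq) auto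
  also have "\<dots> \<le> 2 * (cmod a)\<^sup>2 + 2 * (cmod b)\<^sup>2"
    using zero_le_power2[of "cmod a - cmod b"] by (simp add: power2_eq_square algebra_simps)
  finally show ?thesis .
qed

lemma L2_space_add:
  assumes f: "f \<in> L2_space" and g: "g \<in> L2_space" shows "(\<lambda>x. f x + g x) \<in> L2_space"
proof -
  have [measurable]: "f \<in> borel_measurable lborel" "g \<in> borel_measurable lborel" using f g by auto
  have "integrable lborel (\<lambda>x. 2 * (cmod (f x))\<^sup>2 + 2 * (cmod (g x))\<^sup>2)"
    using f g by (intro Bochner_Integration.integrable_add integrable_mult_right L2_space_integrable)
  then have "integrable lborel (\<lambda>x. (cmod (f x + g x))\<^sup>2)"
    by (rule Bochner_Integration.integrable_bound) (use cmod_add_power2_le in auto)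
  then show ?thesis by (simp add: L2_space_def)
qed

lemma L2_space_diff: "f \<in> L2_space \<Longrightarrow> g \<in> L2_space \<Longrightarrow> (\<lambda>x. f x - g x) \<in> L2_space"
  using L2_space_add[OF _ L2_space_uminus, of f g] by simp

text \<open>The pairing carries no conjugate because the multiplication formula for the Fourier
  integral is bilinear; Hermitian products arise by inserting \<open>cnj\<close>.\<close>

lemma L2_mult:
  assumes f: "f \<in> L2_space" and g: "g \<in> L2_space"
  shows "integrable lborel (\<lambda>x. f x * g x)"
    and "(LINT x|lborel. cmod (f x) * cmod (g x)) \<le> L2_norm f * L2_norm g"
    and "cmod (LINT x|lborel. f x * g x) \<le> L2_norm f * L2_norm g"
proof -
  have [measurable]: "f \<in> borel_measurable lborel" "g \<in> borel_measurable lborel" using f g by auto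
  have i: "integrable lborel (\<lambda>x. (cmod (f x))\<^sup>2 + (cmod (g x))\<^sup>2)"
    using f g by (intro Bochner_Integration.integrable_add L2_space_integrable)
  have "cmod a * cmod b \<le> (cmod a)\<^sup>2 + (cmod b)\<^sup>2" for a b
    using zero_le_power2[of "cmod a - cmod b"] mult_nonneg_nonneg[OF norm_ge_zero[of a] norm_ge_zero[of b]]
    unfolding power2_diff mult.assoc by linarith
  then show fg: "integrable lborel (\<lambda>x. f x * g x)"
    by (intro Bochner_Integration.integrable_bound[OF i]) (auto simp: norm_mult)
  then have fg': "integrable lborel (\<lambda>x. cmod (f x) * cmod (g x))"
    using integrable_norm[OF fg] by (simp add: norm_mult)
  let ?I = "LINT x|lborel. cmod (f x) * cmod (g x)"
  have I0: "0 \<le> ?I" by (intro integral_nonneg_AE) auto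
  have "(\<integral>\<^sup>+x. ennreal (cmod (f x)) * ennreal (cmod (g x)) \<partial>lborel)\<^sup>2
      \<le> (\<integral>\<^sup>+x. (ennreal (cmod (f x)))\<^sup>2 \<partial>lborel) * (\<integral>\<^sup>+x. (ennreal (cmod (g x)))\<^sup>2 \<partial>lborel)"
    by (intro Cauchy_Schwarz_nn_integral) auto
  also have "(\<integral>\<^sup>+x. (ennreal (cmod (f x)))\<^sup>2 \<partial>lborel) = ennreal ((L2_norm f)\<^sup>2)"
    unfolding L2_norm_power2 using L2_space_integrable[OF f]
    by (subst nn_integral_eq_integral[symmetric]) (auto simp: ennreal_power)
  also have "(\<integral>\<^sup>+x. (ennreal (cmod (g x)))\<^sup>2 \<partial>lborel) = ennreal ((L2_norm g)\<^sup>2)"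
    unfolding L2_norm_power2 using L2_space_integrable[OF g]
    by (subst nn_integral_eq_integral[symmetric]) (auto simp: ennreal_power)
  also have "(\<integral>\<^sup>+x. ennreal (cmod (f x)) * ennreal (cmod (g x)) \<partial>lborel) = ennreal ?I"
    using fg' by (subst nn_integral_eq_integral[symmetric]) (auto simp: ennreal_mult)
  finally have "?I\<^sup>2 \<le> (L2_norm f)\<^sup>2 * (L2_norm g)\<^sup>2"
    using I0 by (simp add: ennreal_power flip: ennreal_mult)
  then show le: "?I \<le> L2_norm f * L2_norm g"
    unfolding power_mult_distrib[symmetric] by (rule power2_le_imp_le) simp
  have "cmod (LINT x|lborel. f x * g x) \<le> ?I"
    using integral_norm_bound[of lborel "\<lambda>x. f x * g x"] by (simp add: norm_mult)
  with le show "cmod (LINT x|lborel. f x * g x) \<le> L2_norm f * L2_norm g" by simp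
qed

lemma L2_norm_triangle:
  assumes f: "f \<in> L2_space" and g: "g \<in> L2_space"
  shows "L2_norm (\<lambda>x. f x + g x) \<le> L2_norm f + L2_norm g"
proof (rule power2_le_imp_le)
  have [measurable]: "f \<in> borel_measurable lborel" "g \<in> borel_measurable lborel" using f g by auto
  have fg: "integrable lborel (\<lambda>x. cmod (f x) * cmod (g x))"
    using integrable_norm[OF L2_mult(1)[OF f g]] by (simp add: norm_mult)
  have "(cmod (a + b))\<^sup>2 \<le> (cmod a)\<^sup>2 + 2 * (cmod a * cmod b) + (cmod b)\<^sup>2" for a b
    using power_mono[OF norm_triangle_ineq[of a b], of 2]
    by (simp add: power2_sum algebra_simps)
  then have "(L2_norm (\<lambda>x. f x + g x))\<^sup>2
      \<le> (LINT x|lborel. (cmod (f x))\<^sup>2 + 2 * (cmod (f x) * cmod (g x)) + (cmod (g x))\<^sup>2)"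
    unfolding L2_norm_power2 using f g fg L2_space_integrable[OF L2_space_add[OF f g]]
    by (intro integral_mono Bochner_Integration.integrable_add integrable_mult_right L2_space_integrable L2_space_add)
  also have "\<dots> = (L2_norm f)\<^sup>2 + 2 * (LINT x|lborel. cmod (f x) * cmod (g x)) + (L2_norm g)\<^sup>2"
    using f g fg L2_space_integrable[OF f] L2_space_integrable[OF g] by (simp add: L2_norm_power2)
  also have "\<dots> \<le> (L2_norm f + L2_norm g)\<^sup>2"
    using L2_mult(2)[OF f g] by (simp add: power2_sum)
  finally show "(L2_norm (\<lambda>x. f x + g x))\<^sup>2 \<le> (L2_norm f + L2_norm g)\<^sup>2" .
qed auto

lemma L2_norm_minus_commute: "L2_norm (\<lambda>x. f x - g x) = L2_norm (\<lambda>x. g x - f x)"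
  by (simp add: L2_norm_def norm_minus_commute)

lemma L2_norm_triangle_diff:
  assumes f: "f \<in> L2_space" and g: "g \<in> L2_space"
  shows "L2_norm (\<lambda>x. f x - g x) \<le> L2_norm f + L2_norm g"
  using L2_norm_triangle[OF f L2_space_uminus[OF g]] by (simp add: L2_norm_def)

lemma L2_norm_triangle3:
  assumes "f \<in> L2_space" "g \<in> L2_space" "h \<in> L2_space"
  shows "L2_norm (\<lambda>x. f x - h x) \<le> L2_norm (\<lambda>x. f x - g x) + L2_norm (\<lambda>x. g x - h x)"
  using L2_norm_triangle[OF L2_space_diff[OF assms(1,2)] L2_space_diff[OF assms(2,3)]] by simp

lemma L2_norm_eq_0D:
  assumes f: "f \<in> L2_space" and "L2_norm f = 0"
  shows "AE x in lborel. f x = 0"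
proof -
  have "(LINT x|lborel. (cmod (f x))\<^sup>2) = 0" using assms(2) by (simp flip: L2_norm_power2)
  then have "AE x in lborel. (cmod (f x))\<^sup>2 = 0"
    using integral_nonneg_eq_0_iff_AE[OF L2_space_integrable[OF f]] by simp
  then show ?thesis by simp
qed

lemma L2_tendsto_norm:
  assumes "L2_tendsto F f"
  shows "(\<lambda>k. L2_norm (F k)) \<longlonglongrightarrow> L2_norm f"
proof -
  have sp: "F k \<in> L2_space" "f \<in> L2_space" for k using assms by (auto simp: L2_tendsto_def)
  have "norm (L2_norm (F k) - L2_norm f) \<le> L2_norm (\<lambda>x. F k x - f x)" for k
    using L2_norm_triangle[OF L2_space_diff[OF sp] sp(2), of k]
      L2_norm_triangle_diff[OF sp(1) L2_space_diff[OF sp], of k k] by simp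
  moreover have "(\<lambda>k. L2_norm (\<lambda>x. F k x - f x)) \<longlonglongrightarrow> 0" using assms by (simp add: L2_tendsto_def)
  ultimately have "(\<lambda>k. L2_norm (F k) - L2_norm f) \<longlonglongrightarrow> 0"
    by (rule null_sequence_bound)
  then show ?thesis by (simp add: LIM_zero_iff)
qed

lemma L2_tendsto_add:
  assumes "L2_tendsto F f" "L2_tendsto G g"
  shows "L2_tendsto (\<lambda>k x. F k x + G k x) (\<lambda>x. f x + g x)"
proof -
  have sp: "F k \<in> L2_space" "f \<in> L2_space" "G k \<in> L2_space" "g \<in> L2_space" for k
    using assms by (auto simp: L2_tendsto_def)
  have "norm (L2_norm (\<lambda>x. F k x + G k x - (f x + g x))) \<le> L2_norm (\<lambda>x. F k x - f x) + L2_norm (\<lambda>x. G k x - g x)" for k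
    using L2_norm_triangle[OF L2_space_diff[OF sp(1,2)] L2_space_diff[OF sp(3,4)], of k k]
    by (simp add: algebra_simps)
  moreover have "(\<lambda>k. L2_norm (\<lambda>x. F k x - f x) + L2_norm (\<lambda>x. G k x - g x)) \<longlonglongrightarrow> 0"
    using assms by (intro tendsto_add_zero) (auto simp: L2_tendsto_def)
  ultimately have "(\<lambda>k. L2_norm (\<lambda>x. F k x + G k x - (f x + g x))) \<longlonglongrightarrow> 0"
    by (rule null_sequence_bound)
  then show ?thesis using sp by (simp add: L2_tendsto_def L2_space_add)
qed

lemma L2_tendsto_cmult:
  assumes "L2_tendsto F f"
  shows "L2_tendsto (\<lambda>k x. c * F k x) (\<lambda>x. c * f x)"
proof -
  have "(\<lambda>k. cmod c * L2_norm (\<lambda>x. F k x - f x)) \<longlonglongrightarrow> 0"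
    using assms by (intro tendsto_mult_right_zero) (simp add: L2_tendsto_def)
  moreover have "L2_norm (\<lambda>x. c * F k x - c * f x) = cmod c * L2_norm (\<lambda>x. F k x - f x)" for k
    unfolding L2_norm_cmult[symmetric] right_diff_distrib ..
  ultimately show ?thesis using assms by (auto simp: L2_tendsto_def intro: L2_space_cmult)
qed

lemma L2_tendsto_bilinear:
  assumes F: "L2_tendsto F f" and G: "L2_tendsto G g"
  shows "(\<lambda>k. LINT x|lborel. F k x * G k x) \<longlonglongrightarrow> (LINT x|lborel. f x * g x)"
proof -
  have sp: "F k \<in> L2_space" "f \<in> L2_space" "G k \<in> L2_space" "g \<in> L2_space" for k
    using assms by (auto simp: L2_tendsto_def)
  have l: "(\<lambda>k. L2_norm (\<lambda>x. F k x - f x)) \<longlonglongrightarrow> 0" "(\<lambda>k. L2_norm (\<lambda>x. G k x - g x)) \<longlonglongrightarrow> 0"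
    using assms by (auto simp: L2_tendsto_def)
  have eq: "(LINT x|lborel. F k x * G k x) - (LINT x|lborel. f x * g x)
      = (LINT x|lborel. (F k x - f x) * G k x) + (LINT x|lborel. f x * (G k x - g x))" for k
  proof -
    have "(LINT x|lborel. (F k x - f x) * G k x) + (LINT x|lborel. f x * (G k x - g x))
      = (LINT x|lborel. (F k x - f x) * G k x + f x * (G k x - g x))"
      by (rule Bochner_Integration.integral_add[symmetric]; intro L2_mult(1) L2_space_diff sp)
    also have "\<dots> = (LINT x|lborel. F k x * G k x - f x * g x)"
      by (simp add: algebra_simps)
    also have "\<dots> = (LINT x|lborel. F k x * G k x) - (LINT x|lborel. f x * g x)"
      by (rule Bochner_Integration.integral_diff; intro L2_mult(1) sp)
    finally show ?thesis by simp
  qed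
  have "norm ((LINT x|lborel. F k x * G k x) - (LINT x|lborel. f x * g x))
      \<le> L2_norm (\<lambda>x. F k x - f x) * L2_norm (G k) + L2_norm f * L2_norm (\<lambda>x. G k x - g x)" for k
    unfolding eq using L2_mult(3)[OF L2_space_diff[OF sp(1,2)] sp(3), of k k]
      L2_mult(3)[OF sp(2) L2_space_diff[OF sp(3,4)], of k]
    by (intro order.trans[OF norm_triangle_ineq] add_mono)
  moreover have "(\<lambda>k. L2_norm (\<lambda>x. F k x - f x) * L2_norm (G k) + L2_norm f * L2_norm (\<lambda>x. G k x - g x)) \<longlonglongrightarrow> 0"
    using tendsto_add[OF tendsto_mult[OF l(1) L2_tendsto_norm[OF G]] tendsto_mult[OF tendsto_const[of "L2_norm f"] l(2)]]
    by simp
  ultimately have "(\<lambda>k. (LINT x|lborel. F k x * G k x) - (LINT x|lborel. f x * g x)) \<longlonglongrightarrow> 0"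
    by (rule null_sequence_bound)
  then show ?thesis by (simp add: LIM_zero_iff)
qed

section \<open>Gaussians and the Fourier integral\<close>

text \<open>This normalisation makes the Gaussian an eigenfunction of the Fourier integral, with
  eigenvalue \<open>sqrt (2 * pi) ^ DIM('a)\<close>.\<close>

definition gauss :: "'a::euclidean_space \<Rightarrow> real" where
  "gauss x = exp (- (norm x)\<^sup>2 / 2)"

lemma gauss_borel [measurable]: "gauss \<in> borel_measurable borel"
  unfolding gauss_def by measurable

lemma gauss_bounds: "0 < gauss x" "gauss x \<le> 1"
  by (auto simp: gauss_def)

text \<open>Up to the factor \<open>sqrt (2 * pi)\<close> the integral is the characteristic
  function of the standard normal distribution at \<open>- t\<close>.\<close>

lemma gauss_real_fourier:
  fixes t :: real
  shows "integrable lborel (\<lambda>x. exp (- \<i> * complex_of_real (x * t)) * complex_of_real (exp (- x\<^sup>2 / 2)))"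
    and "(LINT x|lborel. exp (- \<i> * complex_of_real (x * t)) * complex_of_real (exp (- x\<^sup>2 / 2)))
      = complex_of_real (sqrt (2 * pi) * exp (- t\<^sup>2 / 2))"
proof -
  let ?e = "\<lambda>x. exp (\<i> * complex_of_real (x * - t))"
  have d: "std_normal_density x = exp (- x\<^sup>2 / 2) / sqrt (2 * pi)" for x
    by (simp add: normal_density_def)
  have i: "integrable lborel (\<lambda>x. std_normal_density x)"
    using integrable_normal_density[of 1 0] by simp
  have i1: "integrable lborel (\<lambda>x. std_normal_density x *\<^sub>R ?e x)"
    by (rule Bochner_Integration.integrable_bound[OF i]) (auto simp: norm_exp_i_times)
  have eq: "exp (- \<i> * complex_of_real (x * t)) * complex_of_real (exp (- x\<^sup>2 / 2))
     = complex_of_real (sqrt (2 * pi)) * (std_normal_density x *\<^sub>R ?e x)" for x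
    by (simp add: d scaleR_conv_of_real)
  show "integrable lborel (\<lambda>x. exp (- \<i> * complex_of_real (x * t)) * complex_of_real (exp (- x\<^sup>2 / 2)))"
    unfolding eq by (intro integrable_mult_right i1)
  have "char std_normal_distribution (- t) = (LINT x|lborel. std_normal_density x *\<^sub>R ?e x)"
    unfolding char_def by (subst integral_density) (auto simp: mult.commute)
  then show "(LINT x|lborel. exp (- \<i> * complex_of_real (x * t)) * complex_of_real (exp (- x\<^sup>2 / 2)))
      = complex_of_real (sqrt (2 * pi) * exp (- t\<^sup>2 / 2))"
    unfolding eq integral_mult_right_zero by (simp only: char_std_normal_distribution) simp
qed

text \<open>Kernel and Gaussian both factor over the coordinates, and \<open>lborel\<close> is the
  image of a product measure, so the integral is a product of one-dimensional ones.\<close>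

lemma gauss_fourier_aux:
  fixes \<xi> :: "'a::euclidean_space"
  shows "integrable lborel (\<lambda>x::'a. exp (- \<i> * complex_of_real (x \<bullet> \<xi>)) * complex_of_real (gauss x))"
    and "(LINT x|lborel. exp (- \<i> * complex_of_real (x \<bullet> \<xi>)) * complex_of_real (gauss x))
      = complex_of_real (sqrt (2 * pi) ^ DIM('a) * gauss \<xi>)"
proof -
  interpret product_sigma_finite "\<lambda>b::'a. lborel :: real measure" ..
  let ?f = "\<lambda>b x. exp (- \<i> * complex_of_real (x * (\<xi> \<bullet> b))) * complex_of_real (exp (- x\<^sup>2 / 2))"
  let ?F = "\<lambda>x::'a. exp (- \<i> * complex_of_real (x \<bullet> \<xi>)) * complex_of_real (gauss x)"
  let ?T = "\<lambda>f. \<Sum>b\<in>Basis. f b *\<^sub>R (b::'a)"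
  have n: "(norm x)\<^sup>2 = (\<Sum>b\<in>Basis. (x \<bullet> b)\<^sup>2)" for x :: 'a
    by (subst power2_norm_eq_inner) (subst euclidean_inner, simp add: power2_eq_square)
  have comp: "?F (?T f) = (\<Prod>b\<in>Basis. ?f b (f b))" for f
  proof -
    have "?T f \<bullet> b = f b" if "b \<in> Basis" for b
      using that by (simp add: inner_sum_left inner_Basis if_distrib cong: if_cong)
    then have "gauss (?T f) = (\<Prod>b\<in>Basis. exp (- (f b)\<^sup>2 / 2))"
      unfolding gauss_def n by (simp add: exp_sum[symmetric] sum_negf sum_divide_distrib)
    moreover have "exp (- \<i> * complex_of_real (?T f \<bullet> \<xi>))
        = (\<Prod>b\<in>Basis. exp (- \<i> * complex_of_real (f b * (\<xi> \<bullet> b))))"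
      by (simp add: exp_sum[symmetric] inner_sum_left sum_distrib_left sum_negf inner_commute[of \<xi>])
    ultimately show ?thesis by (simp add: prod.distrib)
  qed
  have [measurable]: "?T \<in> (\<Pi>\<^sub>M b\<in>Basis. lborel) \<rightarrow>\<^sub>M borel"
    by measurable
  have "integrable (\<Pi>\<^sub>M b\<in>Basis. lborel) (\<lambda>f. ?F (?T f))"
    unfolding comp by (intro product_integrable_prod gauss_real_fourier) auto
  then show "integrable lborel ?F"
    by (subst lborel_eq) (subst integrable_distr_eq, auto)
  have "integral\<^sup>L lborel ?F = (LINT f|(\<Pi>\<^sub>M b\<in>Basis. lborel). ?F (?T f))"
    by (subst lborel_eq) (subst integral_distr, auto)
  also have "\<dots> = (\<Prod>b\<in>Basis. integral\<^sup>L lborel (?f b))"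
    unfolding comp by (intro product_integral_prod gauss_real_fourier) auto
  also have "\<dots> = (\<Prod>b\<in>Basis. complex_of_real (sqrt (2 * pi) * exp (- (\<xi> \<bullet> b)\<^sup>2 / 2)))"
    unfolding gauss_real_fourier ..
  also have "\<dots> = complex_of_real (sqrt (2 * pi) ^ DIM('a) * (\<Prod>b\<in>Basis. exp (- (\<xi> \<bullet> b)\<^sup>2 / 2)))"
    by (simp add: prod.distrib)
  also have "(\<Prod>b\<in>Basis. exp (- (\<xi> \<bullet> b)\<^sup>2 / 2)) = gauss \<xi>"
    unfolding gauss_def n by (simp add: exp_sum[symmetric] sum_negf sum_divide_distrib)
  finally show "integral\<^sup>L lborel ?F = complex_of_real (sqrt (2 * pi) ^ DIM('a) * gauss \<xi>)" .
qed

lemma lborel_integral_affine: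
  fixes f :: "'a::euclidean_space \<Rightarrow> 'b::{banach, second_countable_topology}" and c :: real
  assumes c: "c \<noteq> 0" and f [measurable]: "f \<in> borel_measurable borel"
  shows "(LINT x|lborel. f x) = \<bar>c\<bar> ^ DIM('a) *\<^sub>R (LINT x|lborel. f (t + c *\<^sub>R x))"
    and "integrable lborel f \<longleftrightarrow> integrable lborel (\<lambda>x. f (t + c *\<^sub>R x))"
proof -
  have "(LINT x|lborel. f x) = (LINT x|density (distr lborel borel (\<lambda>x. t + c *\<^sub>R x)) (\<lambda>_. \<bar>c\<bar>^DIM('a)). f x)"
    using lborel_affine[OF c, of t] by simp
  also have "\<dots> = \<bar>c\<bar> ^ DIM('a) *\<^sub>R (LINT x|lborel. f (t + c *\<^sub>R x))"
    by (subst integral_density; simp; subst integral_distr; simp)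
  finally show "(LINT x|lborel. f x) = \<bar>c\<bar> ^ DIM('a) *\<^sub>R (LINT x|lborel. f (t + c *\<^sub>R x))" .
  have "integrable lborel f \<longleftrightarrow> integrable (density (distr lborel borel (\<lambda>x. t + c *\<^sub>R x)) (\<lambda>_. \<bar>c\<bar>^DIM('a))) f"
    using lborel_affine[OF c, of t] by simp
  also have "\<dots> \<longleftrightarrow> integrable lborel (\<lambda>x. \<bar>c\<bar> ^ DIM('a) *\<^sub>R f (t + c *\<^sub>R x))"
    using c by (subst integrable_density; simp; subst integrable_distr_eq; simp)
  also have "\<dots> \<longleftrightarrow> integrable lborel (\<lambda>x. f (t + c *\<^sub>R x))"
    using c integrable_scaleR_right[of "inverse (\<bar>c\<bar> ^ DIM('a))" lborel "\<lambda>x. \<bar>c\<bar> ^ DIM('a) *\<^sub>R f (t + c *\<^sub>R x)"]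
    by auto
  finally show "integrable lborel f \<longleftrightarrow> integrable lborel (\<lambda>x. f (t + c *\<^sub>R x))" .
qed

lemma gauss_scaled_fourier:
  fixes \<xi> :: "'a::euclidean_space"
  assumes c: "c > 0"
  shows "integrable lborel (\<lambda>x::'a. exp (- \<i> * complex_of_real (x \<bullet> \<xi>)) * complex_of_real (gauss (c *\<^sub>R x)))"
    and "(LINT x|lborel. exp (- \<i> * complex_of_real (x \<bullet> \<xi>)) * complex_of_real (gauss (c *\<^sub>R x)))
      = complex_of_real ((sqrt (2 * pi) / c) ^ DIM('a) * gauss (\<xi> /\<^sub>R c))"
proof -
  let ?F = "\<lambda>x::'a. exp (- \<i> * complex_of_real (x \<bullet> (\<xi> /\<^sub>R c))) * complex_of_real (gauss x)"
  have e: "?F (0 + c *\<^sub>R x) = exp (- \<i> * complex_of_real (x \<bullet> \<xi>)) * complex_of_real (gauss (c *\<^sub>R x))" for x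
    using c by (simp add: field_simps)
  have [measurable]: "?F \<in> borel_measurable borel" by measurable
  have c': "c \<noteq> 0" using c by simp
  show "integrable lborel (\<lambda>x::'a. exp (- \<i> * complex_of_real (x \<bullet> \<xi>)) * complex_of_real (gauss (c *\<^sub>R x)))"
    using lborel_integral_affine(2)[OF c', of ?F 0] gauss_fourier_aux(1)[of "\<xi> /\<^sub>R c"] unfolding e by simp
  have "c ^ DIM('a) *\<^sub>R (LINT x|lborel. exp (- \<i> * complex_of_real (x \<bullet> \<xi>)) * complex_of_real (gauss (c *\<^sub>R x)))
     = complex_of_real (sqrt (2 * pi) ^ DIM('a) * gauss (\<xi> /\<^sub>R c))"
    using lborel_integral_affine(1)[OF c', of ?F 0] c unfolding e gauss_fourier_aux(2)[of "\<xi> /\<^sub>R c"] by simp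
  then show "(LINT x|lborel. exp (- \<i> * complex_of_real (x \<bullet> \<xi>)) * complex_of_real (gauss (c *\<^sub>R x)))
      = complex_of_real ((sqrt (2 * pi) / c) ^ DIM('a) * gauss (\<xi> /\<^sub>R c))"
    using c by (simp add: power_divide field_simps scaleR_conv_of_real)
qed

lemma gauss_integral:
  assumes c: "c > 0"
  shows "integrable lborel (\<lambda>x::'a::euclidean_space. gauss (c *\<^sub>R x))"
    and "(LINT x|lborel. gauss (c *\<^sub>R (x::'a))) = (sqrt (2 * pi) / c) ^ DIM('a)"
proof -
  have i: "integrable lborel (\<lambda>x::'a. complex_of_real (gauss (c *\<^sub>R x)))"
    using gauss_scaled_fourier(1)[OF c, of 0] by simp
  then show "integrable lborel (\<lambda>x::'a::euclidean_space. gauss (c *\<^sub>R x))"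
    by (simp only: complex_of_real_integrable_eq)
  have "complex_of_real (LINT x|lborel. gauss (c *\<^sub>R (x::'a))) = complex_of_real ((sqrt (2 * pi) / c) ^ DIM('a))"
    using gauss_scaled_fourier(2)[OF c, of "0::'a"] by (simp add: gauss_def)
  then show "(LINT x|lborel. gauss (c *\<^sub>R (x::'a))) = (sqrt (2 * pi) / c) ^ DIM('a)"
    by (simp only: of_real_eq_iff)
qed

section \<open>The Fourier integral of integrable functions\<close>

lemma fourier_integral_borel [measurable]:
  assumes [measurable]: "f \<in> borel_measurable borel"
  shows "fourier_integral f \<in> borel_measurable borel"
proof -
  have "(\<lambda>\<xi>. LINT x|lborel. exp (- \<i> * complex_of_real (x \<bullet> \<xi>)) * f x) \<in> borel_measurable borel"
    by measurable
  then show ?thesis unfolding fourier_integral_def by simp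
qed

lemma integrable_fourier_kernel:
  assumes f: "integrable lborel f"
  shows "integrable lborel (\<lambda>x. exp (- \<i> * complex_of_real (x \<bullet> \<xi>)) * f x)"
proof -
  have [measurable]: "f \<in> borel_measurable borel" using f by auto
  show ?thesis by (rule Bochner_Integration.integrable_bound[OF f]) (auto simp: norm_mult)
qed

lemma fourier_integral_bound:
  assumes f: "integrable lborel f"
  shows "cmod (fourier_integral f \<xi>) \<le> (LINT x|lborel. cmod (f x))"
  unfolding fourier_integral_def
  using integral_norm_bound[of lborel "\<lambda>x. exp (- \<i> * complex_of_real (x \<bullet> \<xi>)) * f x"]
  by (simp add: norm_mult)

lemma fourier_integral_add:
  assumes "integrable lborel f" "integrable lborel g"
  shows "fourier_integral (\<lambda>x. f x + g x) \<xi> = fourier_integral f \<xi> + fourier_integral g \<xi>"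
  unfolding fourier_integral_def distrib_left
  by (intro Bochner_Integration.integral_add integrable_fourier_kernel assms)

lemma fourier_integral_cmult:
  shows "fourier_integral (\<lambda>x. c * f x) \<xi> = c * fourier_integral f \<xi>"
  unfolding fourier_integral_def by (simp add: mult.left_commute[of _ c])

lemma fourier_integral_diff:
  assumes "integrable lborel f" "integrable lborel g"
  shows "fourier_integral (\<lambda>x. f x - g x) \<xi> = fourier_integral f \<xi> - fourier_integral g \<xi>"
  unfolding fourier_integral_def right_diff_distrib
  by (intro Bochner_Integration.integral_diff integrable_fourier_kernel assms)

text \<open>The kernel is symmetric in \<open>x\<close> and \<open>\<xi>\<close> and has modulus 1,
  so \<open>cmod (f x) * cmod (k \<xi>)\<close> is a majorant and Fubini applies.\<close>

lemma fourier_integral_mult: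
  fixes f k :: "'a::euclidean_space \<Rightarrow> complex"
  assumes f: "integrable lborel f" and k: "integrable lborel k"
  shows "(LINT \<xi>|lborel. fourier_integral f \<xi> * k \<xi>) = (LINT x|lborel. f x * fourier_integral k x)"
proof -
  have [measurable]: "f \<in> borel_measurable borel" "k \<in> borel_measurable borel" using f k by auto
  let ?G = "\<lambda>x \<xi>. exp (- \<i> * complex_of_real (x \<bullet> \<xi>)) * f x * k \<xi>"
  have n: "cmod (?G x \<xi>) = cmod (f x) * cmod (k \<xi>)" for x \<xi> by (simp add: norm_mult)
  have "integrable (lborel \<Otimes>\<^sub>M lborel) (case_prod ?G)"
  proof (rule lborel_pair.Fubini_integrable)
    show "case_prod ?G \<in> borel_measurable (lborel \<Otimes>\<^sub>M lborel)" by measurable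
    show "integrable lborel (\<lambda>x. LINT y|lborel. cmod (case (x, y) of (x, y) \<Rightarrow> ?G x y))"
      unfolding prod.case n using f by simp
    show "AE x in lborel. integrable lborel (\<lambda>y. case (x, y) of (x, y) \<Rightarrow> ?G x y)"
    proof (rule AE_I2)
      fix x
      show "integrable lborel (\<lambda>y. case (x, y) of (x, y) \<Rightarrow> ?G x y)"
        unfolding case_prod_conv
        by (rule Bochner_Integration.integrable_bound[of _ "\<lambda>y. cmod (f x) * cmod (k y)"])
          (use k n in auto)
    qed
  qed
  then have eq: "(LINT \<xi>|lborel. LINT x|lborel. ?G x \<xi>) = (LINT x|lborel. LINT \<xi>|lborel. ?G x \<xi>)"
    by (rule lborel_pair.Fubini_integral)
  have 1: "(LINT x|lborel. ?G x \<xi>) = fourier_integral f \<xi> * k \<xi>" for \<xi>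
    unfolding fourier_integral_def by simp
  have 2: "(LINT \<xi>|lborel. ?G x \<xi>) = f x * fourier_integral k x" for x
    unfolding fourier_integral_def
    by (subst integral_mult_right_zero[symmetric]) (simp add: mult_ac inner_commute)
  show ?thesis using eq unfolding 1 2 .
qed

text \<open>The transform of an integrable function need not be square integrable, so its square is
  damped by a Gaussian first. The multiplication formula then moves the transform onto the Gaussian,
  which becomes an averaging kernel of width \<open>c\<close>; Plancherel's identity is the limit as
  \<open>c\<close> tends to 0.\<close>

lemma fourier_integral_gauss_regularized:
  fixes g :: "'a::euclidean_space \<Rightarrow> complex"
  assumes g: "integrable lborel g" and c: "c > 0"
  shows "(LINT \<xi>|lborel. (cmod (fourier_integral g \<xi>))\<^sup>2 * gauss (c *\<^sub>R \<xi>))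
    = Re (LINT x|lborel. g x * cnj (LINT z|lborel. g (x + c *\<^sub>R z) * complex_of_real (sqrt (2 * pi) ^ DIM('a) * gauss z)))"
    and "integrable lborel (\<lambda>\<xi>. (cmod (fourier_integral g \<xi>))\<^sup>2 * gauss (c *\<^sub>R \<xi>))"
proof -
  have [measurable]: "g \<in> borel_measurable borel" using g by auto
  define M where "M = (LINT x|lborel. cmod (g x))"
  have M: "cmod (fourier_integral g \<xi>) \<le> M" for \<xi> unfolding M_def by (rule fourier_integral_bound[OF g])
  have M0: "0 \<le> M" unfolding M_def by simp
  have gi: "integrable lborel (\<lambda>\<xi>. M * gauss (c *\<^sub>R \<xi>))" for M
    by (intro integrable_mult_right gauss_integral c)
  have gp: "0 \<le> gauss x" for x :: 'a using gauss_bounds(1)[of x] by simp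
  define h where "h \<xi> = cnj (fourier_integral g \<xi>) * complex_of_real (gauss (c *\<^sub>R \<xi>))" for \<xi>
  have [measurable]: "h \<in> borel_measurable borel" unfolding h_def by measurable
  have hi: "integrable lborel h"
    by (rule Bochner_Integration.integrable_bound[OF gi[of M]])
      (use M M0 gp in \<open>auto simp: h_def norm_mult intro!: mult_right_mono\<close>)
  have hh: "fourier_integral h x
     = cnj (LINT z|lborel. g (x + c *\<^sub>R z) * complex_of_real (sqrt (2 * pi) ^ DIM('a) * gauss z))" for x
  proof -
    \<comment> \<open>The transform of a modulated Gaussian is a Gaussian centred at
      \<open>x\<close>. A second use of the multiplication formula therefore turns
      \<open>fourier_integral h x\<close> into an average of \<open>g\<close> around
      \<open>x\<close>.\<close>
    let ?k = "\<lambda>\<xi>. exp (\<i> * complex_of_real (\<xi> \<bullet> x)) * complex_of_real (gauss (c *\<^sub>R \<xi>))"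
    have ki: "integrable lborel ?k"
      using gauss_scaled_fourier(1)[OF c, of "-x"] by simp
    have kk: "fourier_integral ?k y = complex_of_real ((sqrt (2 * pi) / c) ^ DIM('a) * gauss ((y - x) /\<^sub>R c))" for y
    proof -
      have "exp (- \<i> * complex_of_real (\<xi> \<bullet> y)) * exp (\<i> * complex_of_real (\<xi> \<bullet> x))
          = exp (- \<i> * complex_of_real (\<xi> \<bullet> (y - x)))" for \<xi>
        unfolding exp_add[symmetric] by (simp add: inner_diff_right right_diff_distrib)
      then have "fourier_integral ?k y = (LINT \<xi>|lborel. exp (- \<i> * complex_of_real (\<xi> \<bullet> (y - x))) * complex_of_real (gauss (c *\<^sub>R \<xi>)))"
        unfolding fourier_integral_def mult.assoc[symmetric] by (simp only:)
      then show ?thesis using gauss_scaled_fourier(2)[OF c, of "y - x"] by simp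
    qed
    have "fourier_integral h x = cnj (LINT \<xi>|lborel. fourier_integral g \<xi> * ?k \<xi>)"
    proof -
      have "cnj (exp (\<i> * complex_of_real (\<xi> \<bullet> x))) = exp (- \<i> * complex_of_real (\<xi> \<bullet> x))" for \<xi>
        by (simp add: exp_cnj)
      then have "exp (- \<i> * complex_of_real (\<xi> \<bullet> x)) * h \<xi> = cnj (fourier_integral g \<xi> * ?k \<xi>)" for \<xi>
        unfolding h_def complex_cnj_mult complex_cnj_complex_of_real by (simp only: mult_ac)
      then show ?thesis unfolding fourier_integral_def[of h] by (simp only: Bochner_Integration.integral_cnj)
    qed
    also have "(LINT \<xi>|lborel. fourier_integral g \<xi> * ?k \<xi>)
      = (LINT y|lborel. g y * complex_of_real ((sqrt (2 * pi) / c) ^ DIM('a) * gauss ((y - x) /\<^sub>R c)))"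
      unfolding fourier_integral_mult[OF g ki] kk ..
    \<comment> \<open>Rescaling around \<open>x\<close> absorbs the powers of \<open>c\<close>;
      afterwards \<open>c\<close> occurs only in the argument of \<open>g\<close>, where it can be
      sent to 0.\<close>
    also have "\<dots> = c ^ DIM('a) *\<^sub>R (LINT z|lborel. g (x + c *\<^sub>R z) * complex_of_real ((sqrt (2 * pi) / c) ^ DIM('a) * gauss z))"
      using c by (subst lborel_integral_affine(1)[of c _ x]) auto
    also have "\<dots> = (LINT z|lborel. g (x + c *\<^sub>R z) * complex_of_real (sqrt (2 * pi) ^ DIM('a) * gauss z))"
      using c by (subst integral_scaleR_right[symmetric])
        (simp add: scaleR_conv_of_real power_divide mult_ac)
    finally show ?thesis .
  qed
  have e: "fourier_integral g \<xi> * h \<xi> = complex_of_real ((cmod (fourier_integral g \<xi>))\<^sup>2 * gauss (c *\<^sub>R \<xi>))" for \<xi>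
    unfolding h_def of_real_mult complex_norm_square by (simp only: mult.assoc)
  have "complex_of_real (LINT \<xi>|lborel. (cmod (fourier_integral g \<xi>))\<^sup>2 * gauss (c *\<^sub>R \<xi>))
    = (LINT \<xi>|lborel. fourier_integral g \<xi> * h \<xi>)"
    unfolding e by (rule integral_complex_of_real[symmetric])
  also have "\<dots> = (LINT x|lborel. g x * fourier_integral h x)" by (rule fourier_integral_mult[OF g hi])
  finally show "(LINT \<xi>|lborel. (cmod (fourier_integral g \<xi>))\<^sup>2 * gauss (c *\<^sub>R \<xi>))
    = Re (LINT x|lborel. g x * cnj (LINT z|lborel. g (x + c *\<^sub>R z) * complex_of_real (sqrt (2 * pi) ^ DIM('a) * gauss z)))"
    unfolding hh by (metis Re_complex_of_real)
  show "integrable lborel (\<lambda>\<xi>. (cmod (fourier_integral g \<xi>))\<^sup>2 * gauss (c *\<^sub>R \<xi>))"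
    by (rule Bochner_Integration.integrable_bound[OF gi[of "M\<^sup>2"]])
      (use M M0 gp in \<open>auto simp: norm_mult intro!: mult_right_mono power_mono\<close>)
qed

section \<open>Completeness of $L^2$ and Plancherel's theorem\<close>

text \<open>Fatou's lemma for the squares. The bounds \<open>c j\<close> are only asked to converge:
  in the completeness proof they are constant, and for Plancherel they are norms of regularised or
  approximating functions.\<close>

lemma L2_fatou:
  fixes F :: "nat \<Rightarrow> 'a::euclidean_space \<Rightarrow> complex"
  assumes F: "\<And>j. F j \<in> L2_space" and f [measurable]: "f \<in> borel_measurable lborel"
    and lim: "AE x in lborel. (\<lambda>j. F j x) \<longlonglongrightarrow> f x"
    and le: "\<And>j. L2_norm (F j) \<le> c j" and c: "c \<longlonglongrightarrow> C"
  shows "f \<in> L2_space" "L2_norm f \<le> C"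
proof -
  have [measurable]: "F j \<in> borel_measurable lborel" for j using F by auto
  have c0: "0 \<le> c j" for j using order.trans[OF L2_norm_nonneg le] .
  have C0: "0 \<le> C" by (rule LIMSEQ_le_const[OF c]) (use c0 in auto)
  have "(\<integral>\<^sup>+x. ennreal ((cmod (f x))\<^sup>2) \<partial>lborel) = (\<integral>\<^sup>+x. liminf (\<lambda>j. ennreal ((cmod (F j x))\<^sup>2)) \<partial>lborel)"
  proof (rule nn_integral_cong_AE, use lim in eventually_elim)
    fix x assume "(\<lambda>j. F j x) \<longlonglongrightarrow> f x"
    then have "(\<lambda>j. ennreal ((cmod (F j x))\<^sup>2)) \<longlonglongrightarrow> ennreal ((cmod (f x))\<^sup>2)"
      by (intro tendsto_ennrealI tendsto_intros)
    then show "ennreal ((cmod (f x))\<^sup>2) = liminf (\<lambda>j. ennreal ((cmod (F j x))\<^sup>2))"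
      using lim_imp_Liminf[OF sequentially_bot] by metis
  qed
  also have "\<dots> \<le> liminf (\<lambda>j. \<integral>\<^sup>+x. ennreal ((cmod (F j x))\<^sup>2) \<partial>lborel)"
    by (rule nn_integral_liminf) measurable
  also have "\<dots> \<le> liminf (\<lambda>j. ennreal ((c j)\<^sup>2))"
  proof (rule Liminf_mono, rule always_eventually, rule allI)
    fix j
    have "(\<integral>\<^sup>+x. ennreal ((cmod (F j x))\<^sup>2) \<partial>lborel) = ennreal ((L2_norm (F j))\<^sup>2)"
      unfolding L2_norm_power2 using L2_space_integrable[OF F] by (rule nn_integral_eq_integral) simp
    also have "\<dots> \<le> ennreal ((c j)\<^sup>2)" using le[of j] by (intro ennreal_leI power_mono) auto
    finally show "(\<integral>\<^sup>+x. ennreal ((cmod (F j x))\<^sup>2) \<partial>lborel) \<le> ennreal ((c j)\<^sup>2)" .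
  qed
  also have "\<dots> = ennreal (C\<^sup>2)"
    by (intro lim_imp_Liminf sequentially_bot tendsto_ennrealI tendsto_power c)
  finally have le': "(\<integral>\<^sup>+x. ennreal ((cmod (f x))\<^sup>2) \<partial>lborel) \<le> ennreal (C\<^sup>2)" .
  have i: "integrable lborel (\<lambda>x. (cmod (f x))\<^sup>2)"
    by (rule integrableI_bounded) (use le' in \<open>auto simp: le_less_trans[OF _ ennreal_less_top]\<close>)
  then show "f \<in> L2_space" by (simp add: L2_space_def)
  have "ennreal ((L2_norm f)\<^sup>2) \<le> ennreal (C\<^sup>2)"
    using le' nn_integral_eq_integral[OF i] by (simp add: L2_norm_power2)
  then have "(L2_norm f)\<^sup>2 \<le> C\<^sup>2" by simp
  then show "L2_norm f \<le> C" using C0 by (rule power2_le_imp_le)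
qed

text \<open>Riesz--Fischer: along a subsequence with \<open>\<parallel>F (r (Suc j)) - F (r j)\<parallel> \<le> 4\<^sup>-\<^sup>j\<close> the series of
  increments, weighted by \<open>4\<^sup>j\<close>, is summable in $L^1$, so the subsequence converges almost everywhere.\<close>

lemma L2_complete:
  fixes F :: "nat \<Rightarrow> 'a::euclidean_space \<Rightarrow> complex"
  assumes F: "\<And>k. F k \<in> L2_space"
    and cauchy: "\<And>e. 0 < e \<Longrightarrow> \<exists>N. \<forall>m\<ge>N. \<forall>n\<ge>N. L2_norm (\<lambda>x. F m x - F n x) < e"
  shows "\<exists>f. L2_tendsto F f"
proof -
  have [measurable]: "F j \<in> borel_measurable lborel" for j using F by auto
  have "\<exists>N. \<forall>j. \<forall>m\<ge>N j. \<forall>n\<ge>N j. L2_norm (\<lambda>x. F m x - F n x) < (1/4)^j"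
    using cauchy by (intro choice) auto
  then obtain N where N: "\<And>j m n. m \<ge> N j \<Longrightarrow> n \<ge> N j \<Longrightarrow> L2_norm (\<lambda>x. F m x - F n x) < (1/4)^j"
    by blast
  \<comment> \<open>Summing the thresholds makes \<open>r\<close> monotone and at least
    \<open>N j\<close>, so both indices of the increment \<open>?h j\<close> lie beyond
    \<open>N j\<close>.\<close>
  define r where "r j = (\<Sum>i\<le>j. N i) + j" for j
  have rN: "N j \<le> r j" for j
    unfolding r_def using member_le_sum[of j "{..j}" N] by (simp add: le_add1 trans_le_add1)
  have r_Suc: "r j \<le> r (Suc j)" for j by (simp add: r_def)
  have rj: "j \<le> r j" for j by (simp add: r_def)
  let ?h = "\<lambda>j x. F (r (Suc j)) x - F (r j) x"
  have h: "L2_norm (?h j) \<le> (1/4)^j" for j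
    using N[of j "r (Suc j)" "r j"] rN[of j] r_Suc[of j] by simp
  have hs: "?h j \<in> L2_space" for j by (intro L2_space_diff F)
  have "(\<integral>\<^sup>+x. (\<Sum>j. ennreal (4^j * (cmod (?h j x))\<^sup>2)) \<partial>lborel)
      = (\<Sum>j. \<integral>\<^sup>+x. ennreal (4^j * (cmod (?h j x))\<^sup>2) \<partial>lborel)"
    by (rule nn_integral_suminf) measurable
  also have "\<dots> \<le> (\<Sum>j. ennreal ((1/4)^j))"
  proof (intro suminf_le summableI)
    fix j
    have "(\<integral>\<^sup>+x. ennreal (4^j * (cmod (?h j x))\<^sup>2) \<partial>lborel) = ennreal (LINT x|lborel. 4^j * (cmod (?h j x))\<^sup>2)"
      by (intro nn_integral_eq_integral integrable_mult_right L2_space_integrable hs) auto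
    also have "(LINT x|lborel. 4^j * (cmod (?h j x))\<^sup>2) = 4^j * (L2_norm (?h j))\<^sup>2"
      by (simp add: L2_norm_power2)
    also have "\<dots> \<le> 4^j * ((1/4)^j)\<^sup>2"
      by (intro mult_left_mono power_mono h) auto
    also have "\<dots> = (1/4::real)^j"
      by (simp add: power2_eq_square power_divide)
    finally show "(\<integral>\<^sup>+x. ennreal (4^j * (cmod (?h j x))\<^sup>2) \<partial>lborel) \<le> ennreal ((1/4)^j)"
      by (simp add: ennreal_leI)
  qed
  also have "\<dots> = ennreal (\<Sum>j. (1/4)^j)"
    by (intro suminf_ennreal2 summable_geometric) auto
  finally have fin: "(\<integral>\<^sup>+x. (\<Sum>j. ennreal (4^j * (cmod (?h j x))\<^sup>2)) \<partial>lborel) \<noteq> \<infinity>"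
    by (auto simp: top_unique)
  have "AE x in lborel. (\<Sum>j. ennreal (4^j * (cmod (?h j x))\<^sup>2)) \<noteq> \<infinity>"
    by (rule nn_integral_PInf_AE[OF _ fin]) measurable
  then have conv: "AE x in lborel. convergent (\<lambda>j. F (r j) x)"
  proof eventually_elim
    fix x assume fin: "(\<Sum>j. ennreal (4^j * (cmod (?h j x))\<^sup>2)) \<noteq> \<infinity>"
    define S where "S = enn2real (\<Sum>j. ennreal (4^j * (cmod (?h j x))\<^sup>2))"
    have S: "(\<Sum>j. ennreal (4^j * (cmod (?h j x))\<^sup>2)) = ennreal S"
      using fin by (simp add: S_def less_top)
    have S0: "0 \<le> S" by (simp add: S_def)
    \<comment> \<open>Every single term is at most the finite sum \<open>S\<close>; taking square
      roots, the weight \<open>4^j\<close> leaves the geometric factor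
      \<open>(1/2)^j\<close>.\<close>
    have b: "cmod (?h j x) \<le> sqrt S * (1/2)^j" for j
    proof -
      have "ennreal (4^j * (cmod (?h j x))\<^sup>2) \<le> ennreal S"
        using sum_le_suminf[OF summableI, of "{j}" "\<lambda>j. ennreal (4^j * (cmod (?h j x))\<^sup>2)"] S by simp
      then have "4^j * (cmod (?h j x))\<^sup>2 \<le> S" using S0 by simp
      moreover have "((2::real)^j)\<^sup>2 = 4^j" by (simp add: power2_eq_square flip: power_mult_distrib)
      ultimately have "(2^j * cmod (?h j x))\<^sup>2 \<le> (sqrt S)\<^sup>2"
        using S0 by (simp add: power_mult_distrib)
      then have "2^j * cmod (?h j x) \<le> sqrt S" by (rule power2_le_imp_le) (simp add: S0)
      then show ?thesis by (simp add: power_divide field_simps)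
    qed
    have "summable (\<lambda>j. ?h j x)"
      by (rule summable_comparison_test'[where N=0 and g="\<lambda>j. sqrt S * (1/2)^j"])
        (use b in \<open>auto intro!: summable_mult summable_geometric\<close>)
    then have "convergent (\<lambda>n. \<Sum>j<n. ?h j x)" by (simp add: summable_iff_convergent)
    then have "convergent (\<lambda>n. (\<Sum>j<n. ?h j x) + F (r 0) x)"
      by (intro convergent_add convergent_const)
    moreover have "(\<Sum>j<n. ?h j x) + F (r 0) x = F (r n) x" for n
      by (subst sum_lessThan_telescope) simp
    ultimately show "convergent (\<lambda>j. F (r j) x)" by simp
  qed
  define g where "g x = lim (\<lambda>j. F (r j) x)" for x
  have [measurable]: "g \<in> borel_measurable lborel" unfolding g_def by measurable
  have lim: "AE x in lborel. (\<lambda>j. F (r j) x) \<longlonglongrightarrow> g x"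
    using conv unfolding g_def by eventually_elim (rule convergent_LIMSEQ_iff[THEN iffD1])
  \<comment> \<open>Fatou is applied along the subsequence with \<open>m\<close> fixed, which gives
    convergence of the whole sequence and not merely of the subsequence.\<close>
  have est: "(\<lambda>x. F m x - g x) \<in> L2_space \<and> L2_norm (\<lambda>x. F m x - g x) \<le> (1/4)^k" if m: "m \<ge> N k" for m k
  proof -
    have s: "L2_norm (\<lambda>x. F m x - F (r (j + k)) x) \<le> (1/4)^k" for j
    proof -
      have "mono r" using r_Suc by (simp add: mono_iff_le_Suc)
      then have "r k \<le> r (j + k)" by (rule monoD) simp
      then show ?thesis using N[OF m, of "r (j + k)"] rN[of k] by simp
    qed
    have l: "AE x in lborel. (\<lambda>j. F m x - F (r (j + k)) x) \<longlonglongrightarrow> F m x - g x"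
      using lim by eventually_elim (intro tendsto_intros LIMSEQ_ignore_initial_segment)
    show ?thesis
      by (intro conjI L2_fatou[OF L2_space_diff[OF F F] _ l s tendsto_const]) measurable
  qed
  have "(\<lambda>x. F (N 0) x - (F (N 0) x - g x)) \<in> L2_space"
    by (rule L2_space_diff[OF F]) (use est[of 0 "N 0"] in auto)
  then have g: "g \<in> L2_space" by simp
  have "(\<lambda>m. L2_norm (\<lambda>x. F m x - g x)) \<longlonglongrightarrow> 0"
  proof (rule LIMSEQ_I)
    fix e :: real assume "0 < e"
    then obtain k where k: "(1/4)^k < e" using real_arch_pow_inv[of e "1/4"] by auto
    have "norm (L2_norm (\<lambda>x. F m x - g x) - 0) < e" if "m \<ge> N k" for m
      using est[OF that] k by simp
    then show "\<exists>no. \<forall>m\<ge>no. norm (L2_norm (\<lambda>x. F m x - g x) - 0) < e" by blast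
  qed
  then show ?thesis using F g by (auto simp: L2_tendsto_def)
qed

section \<open>Plancherel's identity for bounded continuous integrable functions\<close>

abbreviation (input) fourier_scale :: "'a::euclidean_space itself \<Rightarrow> real" where
  "fourier_scale _ \<equiv> sqrt (2 * pi) ^ DIM('a)"

text \<open>Continuity makes the Gaussian averages of \<open>g\<close> converge at every point, and
  boundedness dominates them, so the right-hand side of the regularised identity has a limit as the
  width tends to 0.\<close>

lemma plancherel_continuous:
  fixes g :: "'a::euclidean_space \<Rightarrow> complex"
  assumes cont: "continuous_on UNIV g" and B: "\<And>x. cmod (g x) \<le> B" and g: "integrable lborel g"
  shows "fourier_integral g \<in> L2_space"
    and "L2_norm (fourier_integral g) = fourier_scale TYPE('a) * L2_norm g"
proof -
  let ?S = "fourier_scale TYPE('a)"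
  have [measurable]: "g \<in> borel_measurable borel" using g by auto
  have B0: "0 \<le> B" using B[of 0] norm_ge_zero order.trans by blast
  have gp: "0 \<le> gauss x" for x :: 'a using gauss_bounds(1)[of x] by simp
  define c :: "nat \<Rightarrow> real" where "c k = inverse (Suc k)" for k
  have c: "c k > 0" "c k \<le> 1" for k by (auto simp: c_def field_simps)
  have cl: "c \<longlonglongrightarrow> 0" unfolding c_def by (rule LIMSEQ_inverse_real_of_nat)
  define J where "J k x = (LINT z|lborel. g (x + c k *\<^sub>R z) * complex_of_real (?S * gauss z))" for k x
  have Jm [measurable]: "J k \<in> borel_measurable borel" for k unfolding J_def by measurable
  have gi: "integrable lborel (\<lambda>z::'a. B * (?S * gauss z))"
    using gauss_integral(1)[of 1] by (intro integrable_mult_right) simp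
  have gint: "(LINT z|lborel. gauss (z::'a)) = ?S" using gauss_integral(2)[of 1, where ?'a='a] by simp
  have bd: "cmod (g (x + c k *\<^sub>R z) * complex_of_real (?S * gauss z)) \<le> B * (?S * gauss z)" for k x z
  proof -
    have "0 \<le> ?S * gauss z" using gp by simp
    then show ?thesis unfolding norm_mult norm_of_real
      using B[of "x + c k *\<^sub>R z"] by (simp only: abs_of_nonneg mult_right_mono)
  qed
  \<comment> \<open>One factor \<open>?S\<close> is built into \<open>J\<close>, the other is the
    total mass of the Gaussian.\<close>
  have Jlim: "(\<lambda>k. J k x) \<longlonglongrightarrow> g x * complex_of_real (?S * ?S)" for x
  proof -
    have "(\<lambda>k. J k x) \<longlonglongrightarrow> (LINT z|lborel. g x * complex_of_real (?S * gauss (z::'a)))"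
      unfolding J_def
    proof (rule integral_dominated_convergence[where w="\<lambda>z::'a. B * (?S * gauss z)"])
      show "AE z in lborel. (\<lambda>k. g (x + c k *\<^sub>R z) * complex_of_real (?S * gauss z))
          \<longlonglongrightarrow> g x * complex_of_real (?S * gauss z)"
      proof (rule AE_I2)
        fix z :: 'a
        have "(\<lambda>k. x + c k *\<^sub>R z) \<longlonglongrightarrow> x + 0 *\<^sub>R z" by (intro tendsto_intros cl)
        then have "(\<lambda>k. g (x + c k *\<^sub>R z)) \<longlonglongrightarrow> g x"
          using cont by (intro continuous_on_tendsto_compose[OF cont]) auto
        then show "(\<lambda>k. g (x + c k *\<^sub>R z) * complex_of_real (?S * gauss z))
          \<longlonglongrightarrow> g x * complex_of_real (?S * gauss z)" by (intro tendsto_intros)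
      qed
      show "integrable lborel (\<lambda>z::'a. B * (?S * gauss z))" by (rule gi)
      show "AE z in lborel. norm (g (x + c k *\<^sub>R z) * complex_of_real (?S * gauss z)) \<le> B * (?S * gauss z)" for k
        using bd by simp
    qed measurable
    moreover have "(LINT z|lborel. g x * complex_of_real (?S * gauss (z::'a))) = g x * complex_of_real (?S * ?S)"
      by (simp only: integral_mult_right_zero integral_complex_of_real gint)
    ultimately show ?thesis by (simp only:)
  qed
  have Jb: "cmod (J k x) \<le> B * (?S * ?S)" for k x
  proof -
    have "cmod (J k x) \<le> (LINT z|lborel. B * (?S * gauss (z::'a)))"
      unfolding J_def
    proof (rule order.trans[OF integral_norm_bound], rule integral_mono)
      have "integrable lborel (\<lambda>z. g (x + c k *\<^sub>R z) * complex_of_real (?S * gauss z))"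
      proof (rule Bochner_Integration.integrable_bound[OF gi])
        show "AE z in lborel. norm (g (x + c k *\<^sub>R z) * complex_of_real (?S * gauss z)) \<le> norm (B * (?S * gauss z))"
          using bd unfolding real_norm_def by (intro AE_I2 order.trans[OF bd abs_ge_self])
      qed measurable
      then show "integrable lborel (\<lambda>z. norm (g (x + c k *\<^sub>R z) * complex_of_real (?S * gauss z)))"
        by (rule integrable_norm)
    qed (use bd gi in auto)
    then show ?thesis by (simp only: integral_mult_right_zero gint)
  qed
  define I where "I k = (LINT \<xi>|lborel. (cmod (fourier_integral g \<xi>))\<^sup>2 * gauss (c k *\<^sub>R \<xi>))" for k
  have Ieq: "I k = Re (LINT x|lborel. g x * cnj (J k x))" for k
    unfolding I_def J_def by (rule fourier_integral_gauss_regularized(1)[OF g c(1)])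
  have "(\<lambda>k. LINT x|lborel. g x * cnj (J k x)) \<longlonglongrightarrow> (LINT x|lborel. g x * cnj (g x * complex_of_real (?S * ?S)))"
  proof (rule integral_dominated_convergence[where w="\<lambda>x. cmod (g x) * (B * (?S * ?S))"])
    show "integrable lborel (\<lambda>x. cmod (g x) * (B * (?S * ?S)))"
      using g by (intro integrable_mult_left integrable_norm)
    show "AE x in lborel. (\<lambda>k. g x * cnj (J k x)) \<longlonglongrightarrow> g x * cnj (g x * complex_of_real (?S * ?S))"
      by (intro AE_I2 tendsto_intros Jlim)
    show "AE x in lborel. norm (g x * cnj (J k x)) \<le> cmod (g x) * (B * (?S * ?S))" for k
      using Jb by (intro AE_I2) (simp only: norm_mult complex_mod_cnj mult_left_mono norm_ge_zero)
  qed measurable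
  then have "I \<longlonglongrightarrow> Re (LINT x|lborel. g x * cnj (g x * complex_of_real (?S * ?S)))"
    unfolding Ieq by (rule tendsto_Re)
  also have "(\<lambda>x. g x * cnj (g x * complex_of_real (?S * ?S))) = (\<lambda>x. complex_of_real (?S * ?S * (cmod (g x))\<^sup>2))"
    unfolding of_real_mult complex_norm_square by (auto simp: mult_ac)
  also have "Re (LINT x|lborel. complex_of_real (?S * ?S * (cmod (g x))\<^sup>2)) = (?S * L2_norm g)\<^sup>2"
    by (simp only: integral_complex_of_real Re_complex_of_real integral_mult_right_zero power_mult_distrib
        L2_norm_power2 power2_eq_square[of ?S])
  finally have Ilim: "I \<longlonglongrightarrow> (?S * L2_norm g)\<^sup>2" .
  have gl: "(\<lambda>k. gauss (c k *\<^sub>R \<xi>)) \<longlonglongrightarrow> 1" for \<xi> :: 'a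
  proof -
    have "(\<lambda>k. exp (- (norm (c k *\<^sub>R \<xi>))\<^sup>2 / 2)) \<longlonglongrightarrow> exp (- (norm (0 *\<^sub>R \<xi>))\<^sup>2 / 2)"
      by (intro tendsto_intros cl) auto
    then show ?thesis by (simp add: gauss_def)
  qed
  \<comment> \<open>Taking the square root of the Gaussian makes \<open>I k\<close> the squared norm
    of \<open>?F k\<close>, so that \<open>L2_fatou\<close> can be used.\<close>
  let ?F = "\<lambda>k \<xi>. fourier_integral g \<xi> * complex_of_real (sqrt (gauss (c k *\<^sub>R \<xi>)))"
  have Fsq: "(cmod (?F k \<xi>))\<^sup>2 = (cmod (fourier_integral g \<xi>))\<^sup>2 * gauss (c k *\<^sub>R \<xi>)" for k \<xi>
    using gp by (simp add: norm_mult power_mult_distrib)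
  have FL: "?F k \<in> L2_space" for k
    unfolding L2_space_def mem_Collect_eq Fsq
    using fourier_integral_gauss_regularized(2)[OF g c(1)] by auto
  have Fn: "L2_norm (?F k) \<le> sqrt (I k)" for k
    unfolding L2_norm_def Fsq I_def ..
  have "(\<lambda>k. sqrt (I k)) \<longlonglongrightarrow> sqrt ((?S * L2_norm g)\<^sup>2)" by (intro tendsto_intros Ilim)
  then have sI: "(\<lambda>k. sqrt (I k)) \<longlonglongrightarrow> ?S * L2_norm g" by simp
  have Fl: "(\<lambda>k. ?F k \<xi>) \<longlonglongrightarrow> fourier_integral g \<xi>" for \<xi>
  proof -
    have "(\<lambda>k. ?F k \<xi>) \<longlonglongrightarrow> fourier_integral g \<xi> * complex_of_real (sqrt 1)"
      by (intro tendsto_intros gl)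
    then show ?thesis by simp
  qed
  \<comment> \<open>No integrable majorant of the squared transform is available yet, so membership
    comes from Fatou. After that the squared transform is its own majorant, and dominated
    convergence identifies the norm.\<close>
  show L2: "fourier_integral g \<in> L2_space"
    by (rule L2_fatou(1)[OF FL _ _ Fn sI]) (use Fl in auto)
  have "I \<longlonglongrightarrow> (LINT \<xi>|lborel. (cmod (fourier_integral g \<xi>))\<^sup>2 * 1)"
    unfolding I_def
  proof (rule integral_dominated_convergence[where w="\<lambda>\<xi>. (cmod (fourier_integral g \<xi>))\<^sup>2"])
    show "AE \<xi> in lborel. (\<lambda>k. (cmod (fourier_integral g \<xi>))\<^sup>2 * gauss (c k *\<^sub>R \<xi>)) \<longlonglongrightarrow> (cmod (fourier_integral g \<xi>))\<^sup>2 * 1"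
      by (intro AE_I2 tendsto_intros gl)
    show "AE \<xi> in lborel. norm ((cmod (fourier_integral g \<xi>))\<^sup>2 * gauss (c k *\<^sub>R \<xi>)) \<le> (cmod (fourier_integral g \<xi>))\<^sup>2" for k
      using gp gauss_bounds(2) by (intro AE_I2) (auto simp: abs_mult intro!: mult_left_le)
  qed (use L2_space_integrable[OF L2] in measurable)
  then have "(L2_norm (fourier_integral g))\<^sup>2 = (?S * L2_norm g)\<^sup>2"
    using LIMSEQ_unique[OF _ Ilim] by (simp add: L2_norm_power2)
  then show "L2_norm (fourier_integral g) = ?S * L2_norm g"
    by (rule power2_eq_imp_eq) auto
qed

section \<open>Density and Plancherel's theorem on the intersection of L1 and L2\<close>

definition L1_L2 :: "('a::euclidean_space \<Rightarrow> complex) set" where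
  "L1_L2 = {f. integrable lborel f} \<inter> L2_space"

lemma L1_L2_D: "f \<in> L1_L2 \<Longrightarrow> integrable lborel f" "f \<in> L1_L2 \<Longrightarrow> f \<in> L2_space"
  by (auto simp: L1_L2_def)

lemma L1_L2_diff: "f \<in> L1_L2 \<Longrightarrow> g \<in> L1_L2 \<Longrightarrow> (\<lambda>x. f x - g x) \<in> L1_L2"
  by (auto simp: L1_L2_def intro: L2_space_diff)

lemma fourier_integral_L1_L2_diff:
  assumes "f \<in> L1_L2" "g \<in> L1_L2"
  shows "fourier_integral (\<lambda>x. f x - g x) = (\<lambda>\<xi>. fourier_integral f \<xi> - fourier_integral g \<xi>)"
  by (intro ext fourier_integral_diff L1_L2_D assms)

text \<open>L1 convergence makes the Fourier integrals converge at every point, L2 convergence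
  controls the norms; one approximating sequence has to provide both.\<close>

definition L1_L2_dist :: "('a::euclidean_space \<Rightarrow> complex) \<Rightarrow> ('a \<Rightarrow> complex) \<Rightarrow> real" where
  "L1_L2_dist f g = (LINT x|lborel. cmod (f x - g x)) + L2_norm (\<lambda>x. f x - g x)"

lemma L1_L2_dist_triangle:
  assumes "f \<in> L1_L2" "g \<in> L1_L2" "h \<in> L1_L2"
  shows "L1_L2_dist f h \<le> L1_L2_dist f g + L1_L2_dist g h"
proof -
  have i: "integrable lborel f" "integrable lborel g" "integrable lborel h"
    and s: "f \<in> L2_space" "g \<in> L2_space" "h \<in> L2_space"
    using assms by (auto simp: L1_L2_def)
  have "(LINT x|lborel. cmod (f x - h x)) \<le> (LINT x|lborel. cmod (f x - g x) + cmod (g x - h x))"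
    using i by (intro integral_mono) (auto intro: order.trans[OF _ norm_triangle_ineq])
  also have "\<dots> = (LINT x|lborel. cmod (f x - g x)) + (LINT x|lborel. cmod (g x - h x))"
    using i by (intro Bochner_Integration.integral_add) auto
  finally show ?thesis unfolding L1_L2_dist_def using L2_norm_triangle3[OF s] by linarith
qed

lemma L1_L2_dominated_tendsto:
  fixes f :: "'a::euclidean_space \<Rightarrow> complex"
  assumes f: "f \<in> L1_L2" and F [measurable]: "\<And>k. F k \<in> borel_measurable borel"
    and w: "integrable lborel w" and w2: "integrable lborel (\<lambda>x. (w x)\<^sup>2)"
    and lim: "AE x in lborel. (\<lambda>k. F k x) \<longlonglongrightarrow> f x"
    and bound: "\<And>k x. cmod (F k x - f x) \<le> w x"
  shows "\<And>k. F k \<in> L1_L2" "(\<lambda>k. L1_L2_dist (F k) f) \<longlonglongrightarrow> 0"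
proof -
  have fi: "integrable lborel f" and fs: "f \<in> L2_space" using f by (auto simp: L1_L2_def)
  then have [measurable]: "f \<in> borel_measurable borel" by auto
  have [measurable]: "w \<in> borel_measurable borel" using w by auto
  have w0: "0 \<le> w x" for x using order.trans[OF norm_ge_zero bound] .
  have d0: "AE x in lborel. (\<lambda>k. F k x - f x) \<longlonglongrightarrow> 0"
    using lim by eventually_elim (simp add: LIM_zero)
  have 1: "(\<lambda>k. LINT x|lborel. cmod (F k x - f x)) \<longlonglongrightarrow> (LINT x|(lborel :: 'a measure). 0)"
    by (rule integral_dominated_convergence[where w=w])
      (use w bound d0 in \<open>auto elim!: eventually_mono intro: tendsto_norm_zero\<close>)
  have "(\<lambda>k. LINT x|lborel. (cmod (F k x - f x))\<^sup>2) \<longlonglongrightarrow> (LINT x|(lborel :: 'a measure). 0)"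
  proof (rule integral_dominated_convergence[where w="\<lambda>x. (w x)\<^sup>2"])
    show "AE x in lborel. (\<lambda>k. (cmod (F k x - f x))\<^sup>2) \<longlonglongrightarrow> 0"
      using d0
    proof eventually_elim
      fix x assume "(\<lambda>k. F k x - f x) \<longlonglongrightarrow> 0"
      then have "(\<lambda>k. (cmod (F k x - f x))\<^sup>2) \<longlonglongrightarrow> 0\<^sup>2" by (intro tendsto_power tendsto_norm_zero)
      then show "(\<lambda>k. (cmod (F k x - f x))\<^sup>2) \<longlonglongrightarrow> 0" by simp
    qed
    show "AE x in lborel. norm ((cmod (F k x - f x))\<^sup>2) \<le> (w x)\<^sup>2" for k
      using bound by (intro AE_I2) (simp add: power_mono)
  qed (use w2 in auto)
  then have "(\<lambda>k. sqrt (LINT x|lborel. (cmod (F k x - f x))\<^sup>2)) \<longlonglongrightarrow> sqrt 0"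
    by (intro tendsto_real_sqrt) simp
  then have 2: "(\<lambda>k. L2_norm (\<lambda>x. F k x - f x)) \<longlonglongrightarrow> 0" by (simp add: L2_norm_def)
  show "(\<lambda>k. L1_L2_dist (F k) f) \<longlonglongrightarrow> 0"
    unfolding L1_L2_dist_def using tendsto_add[OF 1 2] by simp
  fix k
  have di: "integrable lborel (\<lambda>x. F k x - f x)"
    by (rule Bochner_Integration.integrable_bound[OF w])
      (use bound in \<open>auto intro: order.trans[OF _ abs_ge_self]\<close>)
  have "integrable lborel (\<lambda>x. (cmod (F k x - f x))\<^sup>2)"
    by (rule Bochner_Integration.integrable_bound[OF w2]) (use bound in \<open>auto intro!: AE_I2 power_mono\<close>)
  then have ds: "(\<lambda>x. F k x - f x) \<in> L2_space" by (simp add: L2_space_def)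
  from Bochner_Integration.integrable_add[OF di fi] L2_space_add[OF ds fs]
  show "F k \<in> L1_L2" by (simp add: L1_L2_def)
qed

definition bcont_L1 :: "('a::euclidean_space \<Rightarrow> complex) set" where
  "bcont_L1 = {g. continuous_on UNIV g \<and> (\<exists>B. \<forall>x. cmod (g x) \<le> B) \<and> integrable lborel g}"

text \<open>A measurable function is an almost everywhere limit of continuous ones, but without
  control of their size. Projecting the values onto the disc of radius \<open>M\<close> and
  multiplying by the cutoff \<open>\<rho>\<close> preserves continuity and creates a common
  majorant; the limit is unchanged, because \<open>h\<close> already takes its values in the disc
  and vanishes where \<open>\<rho>\<close> is not 1.\<close>

lemma approx_compact_support:
  fixes h :: "'a::euclidean_space \<Rightarrow> complex"
  assumes [measurable]: "h \<in> borel_measurable borel"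
    and M: "\<And>x. cmod (h x) \<le> M" and R: "\<And>x. R < norm x \<Longrightarrow> h x = 0" and e: "0 < e"
  shows "h \<in> L1_L2" "\<exists>g\<in>bcont_L1 \<inter> L1_L2. L1_L2_dist g h < e"
proof -
  have M0: "0 \<le> M" using order.trans[OF norm_ge_zero M] .
  define w where "w x = 2 * M * indicat_real (cball 0 (R + 1)) x" for x :: 'a
  have i: "integrable lborel (indicat_real (cball 0 (R + 1) :: 'a set))"
    by (intro integrable_real_indicator emeasure_lborel_cball_finite) auto
  then have w: "integrable lborel w" unfolding w_def by (rule integrable_mult_right)
  have "(w x)\<^sup>2 = (2 * M)\<^sup>2 * indicat_real (cball 0 (R + 1)) x" for x
    by (auto simp: w_def indicator_def)
  then have w2: "integrable lborel (\<lambda>x. (w x)\<^sup>2)" using i by simp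
  have hw: "cmod (h x) \<le> w x" for x
    using M[of x] R[of x] M0 by (cases "R < norm x") (auto simp: w_def indicator_def)
  have hi: "integrable lborel h"
    by (rule Bochner_Integration.integrable_bound[OF w])
      (use hw in \<open>auto intro: order.trans[OF _ abs_ge_self]\<close>)
  have "integrable lborel (\<lambda>x. (cmod (h x))\<^sup>2)"
    by (rule Bochner_Integration.integrable_bound[OF w2]) (use hw in \<open>auto intro!: AE_I2 power_mono\<close>)
  then show h: "h \<in> L1_L2" using hi by (simp add: L1_L2_def L2_space_def)
  have "h measurable_on UNIV"
    by (rule lebesgue_measurable_imp_measurable_on) (auto intro: measurable_completion)
  then obtain N G where N: "negligible N" and G: "\<And>n. continuous_on UNIV (G n)"
    and Gl: "\<And>x. x \<notin> N \<Longrightarrow> (\<lambda>n. G n x) \<longlonglongrightarrow> h x"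
    unfolding measurable_on_def by auto
  let ?cl = "closest_point (cball 0 M :: complex set)"
  have clc: "continuous_on UNIV ?cl" using M0 by (intro continuous_on_closest_point) auto
  define \<rho> where "\<rho> x = max 0 (min 1 (R + 1 - norm x))" for x :: 'a
  have \<rho>c: "continuous_on UNIV \<rho>" unfolding \<rho>_def by (intro continuous_intros)
  have \<rho>01: "0 \<le> \<rho> x" "\<rho> x \<le> 1" for x by (auto simp: \<rho>_def)
  define F where "F n x = complex_of_real (\<rho> x) * ?cl (G n x)" for n x
  have Fc: "continuous_on UNIV (F n)" for n
    unfolding F_def
    by (intro continuous_intros \<rho>c continuous_on_compose2[OF clc G]) auto
  have [measurable]: "F n \<in> borel_measurable borel" for n
    by (rule borel_measurable_continuous_onI[OF Fc])
  have clM: "cmod (?cl z) \<le> M" for z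
    using closest_point_in_set[of "cball 0 M" z] M0 by auto
  have FM: "cmod (F n x) \<le> M" for n x
    using mult_mono[OF \<rho>01(2)[of x] clM[of "G n x"]] \<rho>01(1)[of x] by (simp add: F_def norm_mult)
  have F0: "F n x = 0" if "R + 1 < norm x" for n x using that by (simp add: F_def \<rho>_def)
  have bound: "cmod (F n x - h x) \<le> w x" for n x
  proof (cases "R + 1 < norm x")
    case True
    then show ?thesis using F0[OF True] R[of x] M0 by (simp add: w_def)
  next
    case False
    then have "w x = 2 * M" by (simp add: w_def)
    then show ?thesis using norm_triangle_ineq4[of "F n x" "h x"] FM[of n x] M[of x] by linarith
  qed
  have "AE x in lebesgue. x \<notin> N" using N by (intro AE_not_in) (simp add: negligible_iff_null_sets)
  then have "AE x in lborel. x \<notin> N" by (simp only: AE_completion_iff)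
  then have lim: "AE x in lborel. (\<lambda>n. F n x) \<longlonglongrightarrow> h x"
  proof eventually_elim
    fix x assume "x \<notin> N"
    then have "(\<lambda>n. ?cl (G n x)) \<longlonglongrightarrow> ?cl (h x)"
      using clc by (intro continuous_on_tendsto_compose[OF clc Gl]) auto
    moreover have "?cl (h x) = h x" using M[of x] by (intro closest_point_self) auto
    ultimately have "(\<lambda>n. F n x) \<longlonglongrightarrow> complex_of_real (\<rho> x) * h x"
      unfolding F_def by (intro tendsto_intros) simp
    moreover have "complex_of_real (\<rho> x) * h x = h x"
      using R[of x] by (cases "R < norm x") (auto simp: \<rho>_def)
    ultimately show "(\<lambda>n. F n x) \<longlonglongrightarrow> h x" by simp
  qed
  have Fm: "F n \<in> borel_measurable borel" for n by measurable
  note A = L1_L2_dominated_tendsto[OF h Fm w w2 lim bound]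
  from LIMSEQ_D[OF A(2) e] obtain n where "norm (L1_L2_dist (F n) h - 0) < e" by blast
  then have "L1_L2_dist (F n) h < e" by simp
  moreover have "F n \<in> bcont_L1" using Fc FM A(1) by (auto simp: bcont_L1_def L1_L2_def)
  ultimately show "\<exists>g\<in>bcont_L1 \<inter> L1_L2. L1_L2_dist g h < e" using A(1) by blast
qed

text \<open>Cutting off large arguments and large values reduces to
  \<open>approx_compact_support\<close>; the truncation error is dominated by
  \<open>cmod (f x)\<close>, which is integrable and square integrable.\<close>

lemma bcont_L1_dense:
  fixes f :: "'a::euclidean_space \<Rightarrow> complex"
  assumes f: "f \<in> L1_L2"
  obtains F where "\<And>k. F k \<in> bcont_L1" "\<And>k. F k \<in> L1_L2" "(\<lambda>k. L1_L2_dist (F k) f) \<longlonglongrightarrow> 0"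
proof -
  have fi: "integrable lborel f" and fs: "f \<in> L2_space" using f by (auto simp: L1_L2_def)
  then have [measurable]: "f \<in> borel_measurable borel" by auto
  define T where "T k x = (if norm x \<le> real k \<and> cmod (f x) \<le> real k then f x else 0)" for k :: nat and x
  have Tm [measurable]: "T k \<in> borel_measurable borel" for k unfolding T_def by measurable
  have lim: "AE x in lborel. (\<lambda>k. T k x) \<longlonglongrightarrow> f x"
  proof (intro AE_I2 tendsto_eventually)
    fix x
    obtain K where K: "max (norm x) (cmod (f x)) \<le> real K" using real_arch_simple by blast
    show "\<forall>\<^sub>F k in sequentially. T k x = f x"
      using eventually_ge_at_top[of K] by eventually_elim (use K in \<open>auto simp: T_def\<close>)
  qed
  have "(\<lambda>k. L1_L2_dist (T k) f) \<longlonglongrightarrow> 0"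
    by (rule L1_L2_dominated_tendsto(2)[OF f Tm integrable_norm[OF fi] L2_space_integrable[OF fs] lim])
      (simp add: T_def)
  then have ex: "\<exists>g. g \<in> bcont_L1 \<and> g \<in> L1_L2 \<and> L1_L2_dist g f < e" if e: "0 < e" for e
  proof -
    from \<open>(\<lambda>k. L1_L2_dist (T k) f) \<longlonglongrightarrow> 0\<close> obtain k where "norm (L1_L2_dist (T k) f - 0) < e / 2"
      using LIMSEQ_D[of _ 0 "e/2"] e by (metis half_gt_zero order_refl)
    then have k: "L1_L2_dist (T k) f < e / 2" by simp
    have "cmod (T k x) \<le> real k" "real k < norm x \<Longrightarrow> T k x = 0" for x by (auto simp: T_def)
    note ap = approx_compact_support[where R="real k" and M="real k" and e="e/2", OF Tm this]
    then obtain g where g: "g \<in> bcont_L1" "g \<in> L1_L2" "L1_L2_dist g (T k) < e / 2" using e by auto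
    have "L1_L2_dist g f < e"
      using L1_L2_dist_triangle[OF g(2) ap(1) f] g(3) k e by simp
    then show ?thesis using g by blast
  qed
  have "\<exists>F. \<forall>k. F k \<in> bcont_L1 \<and> F k \<in> L1_L2 \<and> L1_L2_dist (F k) f < inverse (real (Suc k))"
    by (rule choice) (use ex in auto)
  then obtain F where F: "\<And>k. F k \<in> bcont_L1" "\<And>k. F k \<in> L1_L2" "\<And>k. L1_L2_dist (F k) f < inverse (real (Suc k))"
    by blast
  have "0 \<le> L1_L2_dist (F k) f" for k unfolding L1_L2_dist_def by simp
  then have "(\<lambda>k. L1_L2_dist (F k) f) \<longlonglongrightarrow> 0"
    by (intro null_sequence_bound[OF _ LIMSEQ_inverse_real_of_nat]) (use F(3) less_imp_le in auto)
  with F show ?thesis by (intro that) auto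
qed

lemma L1_L2_dist_tendsto_D:
  assumes "(\<lambda>k. L1_L2_dist (F k) f) \<longlonglongrightarrow> 0"
  shows "(\<lambda>k. LINT x|lborel. cmod (F k x - f x)) \<longlonglongrightarrow> 0" "(\<lambda>k. L2_norm (\<lambda>x. F k x - f x)) \<longlonglongrightarrow> 0"
  by (rule null_sequence_bound[OF _ assms], simp add: L1_L2_dist_def)+

text \<open>Fatou yields an inequality only. Applied to differences \<open>F k - f\<close> it gives
  L2 convergence of the transforms, from which \<open>plancherel\<close> recovers equality.\<close>

lemma plancherel_le:
  fixes f :: "'a::euclidean_space \<Rightarrow> complex"
  assumes f: "f \<in> L1_L2"
  shows "fourier_integral f \<in> L2_space" "L2_norm (fourier_integral f) \<le> fourier_scale TYPE('a) * L2_norm f"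
proof -
  have fi: "integrable lborel f" and fs: "f \<in> L2_space" using f by (auto simp: L1_L2_def)
  then have [measurable]: "f \<in> borel_measurable borel" by auto
  obtain F where F: "\<And>k. F k \<in> bcont_L1" "\<And>k. F k \<in> L1_L2" "(\<lambda>k. L1_L2_dist (F k) f) \<longlonglongrightarrow> 0"
    using bcont_L1_dense[OF f] by blast
  have P: "fourier_integral (F k) \<in> L2_space"
    "L2_norm (fourier_integral (F k)) = fourier_scale TYPE('a) * L2_norm (F k)" for k
    using F(1)[of k] plancherel_continuous[of "F k"] by (auto simp: bcont_L1_def)
  have lim: "(\<lambda>k. fourier_integral (F k) \<xi>) \<longlonglongrightarrow> fourier_integral f \<xi>" for \<xi>
  proof -
    have "norm (fourier_integral (F k) \<xi> - fourier_integral f \<xi>) \<le> (LINT x|lborel. cmod (F k x - f x))" for k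
      using fourier_integral_bound[of "\<lambda>x. F k x - f x" \<xi>] fi L1_L2_D(1)[OF F(2)]
      by (simp add: fourier_integral_diff)
    from null_sequence_bound[OF this L1_L2_dist_tendsto_D(1)[OF F(3)]] show ?thesis by (simp add: LIM_zero_iff)
  qed
  have "L2_tendsto F f" using F(2) fs L1_L2_dist_tendsto_D(2)[OF F(3)] by (auto simp: L2_tendsto_def L1_L2_def)
  then have n: "(\<lambda>k. fourier_scale TYPE('a) * L2_norm (F k)) \<longlonglongrightarrow> fourier_scale TYPE('a) * L2_norm f"
    by (intro tendsto_intros L2_tendsto_norm)
  show "fourier_integral f \<in> L2_space" "L2_norm (fourier_integral f) \<le> fourier_scale TYPE('a) * L2_norm f"
    using L2_fatou[OF P(1) _ _ eq_refl[OF P(2)] n] lim by (auto simp: fourier_integral_borel)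
qed

theorem plancherel:
  fixes f :: "'a::euclidean_space \<Rightarrow> complex"
  assumes f: "f \<in> L1_L2"
  shows "L2_norm (fourier_integral f) = fourier_scale TYPE('a) * L2_norm f"
proof -
  let ?S = "fourier_scale TYPE('a)"
  obtain F where F: "\<And>k. F k \<in> bcont_L1" "\<And>k. F k \<in> L1_L2" "(\<lambda>k. L1_L2_dist (F k) f) \<longlonglongrightarrow> 0"
    using bcont_L1_dense[OF f] by blast
  have P: "L2_norm (fourier_integral (F k)) = ?S * L2_norm (F k)" for k
    using F(1)[of k] plancherel_continuous[of "F k"] by (auto simp: bcont_L1_def)
  have "L2_norm (\<lambda>\<xi>. fourier_integral (F k) \<xi> - fourier_integral f \<xi>) \<le> ?S * L2_norm (\<lambda>x. F k x - f x)" for k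
    using plancherel_le(2)[OF L1_L2_diff[OF F(2) f], of k] unfolding fourier_integral_L1_L2_diff[OF F(2) f] .
  then have "norm (L2_norm (\<lambda>\<xi>. fourier_integral (F k) \<xi> - fourier_integral f \<xi>)) \<le> ?S * L2_norm (\<lambda>x. F k x - f x)" for k
    by simp
  moreover have "(\<lambda>k. ?S * L2_norm (\<lambda>x. F k x - f x)) \<longlonglongrightarrow> 0"
    by (intro tendsto_mult_right_zero L1_L2_dist_tendsto_D(2) F)
  ultimately have "(\<lambda>k. L2_norm (\<lambda>\<xi>. fourier_integral (F k) \<xi> - fourier_integral f \<xi>)) \<longlonglongrightarrow> 0"
    by (rule null_sequence_bound)
  then have "L2_tendsto (\<lambda>k. fourier_integral (F k)) (fourier_integral f)"
    using plancherel_le(1) F(2) f by (auto simp: L2_tendsto_def)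
  then have "(\<lambda>k. ?S * L2_norm (F k)) \<longlonglongrightarrow> L2_norm (fourier_integral f)"
    using L2_tendsto_norm by (fastforce simp flip: P)
  moreover have "L2_tendsto F f"
    using F(2) f L1_L2_dist_tendsto_D(2)[OF F(3)] by (auto simp: L2_tendsto_def L1_L2_def)
  then have "(\<lambda>k. ?S * L2_norm (F k)) \<longlonglongrightarrow> ?S * L2_norm f"
    by (intro tendsto_intros L2_tendsto_norm)
  ultimately show ?thesis using LIMSEQ_unique by blast
qed

lemma L1_L2_dense:
  fixes f :: "'a::euclidean_space \<Rightarrow> complex"
  assumes f: "f \<in> L2_space"
  obtains F where "\<And>k. F k \<in> L1_L2" "L2_tendsto F f"
proof -
  have [measurable]: "f \<in> borel_measurable borel" using f by auto
  define T where "T k x = (if norm x \<le> real k then f x else 0)" for k :: nat and x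
  have [measurable]: "T k \<in> borel_measurable borel" for k unfolding T_def by measurable
  have i: "integrable lborel (\<lambda>x. indicat_real (cball 0 (real k) :: 'a set) x + (cmod (f x))\<^sup>2)" for k
    by (intro Bochner_Integration.integrable_add L2_space_integrable f integrable_real_indicator
        emeasure_lborel_cball_finite) auto
  \<comment> \<open>On a ball the constant 1 is integrable, so by this inequality the truncation of
    a square integrable function is integrable.\<close>
  have "y \<le> 1 + y\<^sup>2" for y :: real 
  proof -
    have "2 * y \<le> y\<^sup>2 + 1" using zero_le_power2[of "y - 1"] unfolding power2_diff by simp
    moreover have "0 \<le> y\<^sup>2" by simp
    ultimately show ?thesis by linarith
  qed
  then have b: "cmod (T k x) \<le> indicat_real (cball 0 (real k)) x + (cmod (f x))\<^sup>2" for k x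
    by (auto simp: T_def indicator_def)
  have "integrable lborel (T k)" for k
    by (rule Bochner_Integration.integrable_bound[OF i[of k]]) (use b[of k] in auto)
  moreover have TL: "T k \<in> L2_space" for k
    by (rule L2_dominated(1)[OF _ f, of _ 1]) (auto simp: T_def indicator_def)
  ultimately have "T k \<in> L1_L2" for k by (simp add: L1_L2_def)
  moreover have "L2_tendsto T f"
  proof -
    have "(\<lambda>k. LINT x|lborel. (cmod (T k x - f x))\<^sup>2) \<longlonglongrightarrow> (LINT x|(lborel :: 'a measure). 0)"
    proof (rule integral_dominated_convergence[where w="\<lambda>x. (cmod (f x))\<^sup>2"])
      show "AE x in lborel. (\<lambda>k. (cmod (T k x - f x))\<^sup>2) \<longlonglongrightarrow> 0"
      proof (intro AE_I2 tendsto_eventually)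
        fix x :: 'a
        obtain K where K: "norm x \<le> real K" using real_arch_simple by blast
        show "\<forall>\<^sub>F k in sequentially. (cmod (T k x - f x))\<^sup>2 = 0"
          using eventually_ge_at_top[of K] by eventually_elim (use K in \<open>auto simp: T_def\<close>)
      qed
      show "AE x in lborel. norm ((cmod (T k x - f x))\<^sup>2) \<le> (cmod (f x))\<^sup>2" for k
        by (auto simp: T_def indicator_def)
    qed (use L2_space_integrable[OF f] in auto)
    then have "(\<lambda>k. sqrt (LINT x|lborel. (cmod (T k x - f x))\<^sup>2)) \<longlonglongrightarrow> sqrt 0"
      by (intro tendsto_real_sqrt) simp
    then show ?thesis using TL f by (simp add: L2_tendsto_def L2_norm_def)
  qed
  ultimately show ?thesis by (rule that)
qed

section \<open>The Fourier transform on L2: isometry, uniqueness, existence, surjectivity\<close>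

lemma is_fourier_L2: "is_fourier f g \<Longrightarrow> f \<in> L2_space" "is_fourier f g \<Longrightarrow> g \<in> L2_space"
  by (auto simp: is_fourier_def L2_tendsto_def)

lemma is_fourierE:
  assumes "is_fourier f g"
  obtains F where "\<And>k. F k \<in> L1_L2" "L2_tendsto F f" "L2_tendsto (\<lambda>k. fourier_integral (F k)) g"
  using assms unfolding is_fourier_def L1_L2_def L2_tendsto_def by auto

lemma is_fourierI:
  assumes "\<And>k. F k \<in> L1_L2" "L2_tendsto F f" "L2_tendsto (\<lambda>k. fourier_integral (F k)) g"
  shows "is_fourier f g"
  using assms unfolding is_fourier_def L1_L2_def by auto

lemma is_fourier_norm:
  fixes f g :: "'a::euclidean_space \<Rightarrow> complex"
  assumes "is_fourier f g"
  shows "L2_norm g = fourier_scale TYPE('a) * L2_norm f"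
proof -
  obtain F where F: "\<And>k. F k \<in> L1_L2" "L2_tendsto F f" "L2_tendsto (\<lambda>k. fourier_integral (F k)) g"
    using is_fourierE[OF assms] by blast
  have "(\<lambda>k. fourier_scale TYPE('a) * L2_norm (F k)) \<longlonglongrightarrow> L2_norm g"
    using L2_tendsto_norm[OF F(3)] plancherel[OF F(1)] by simp
  moreover have "(\<lambda>k. fourier_scale TYPE('a) * L2_norm (F k)) \<longlonglongrightarrow> fourier_scale TYPE('a) * L2_norm f"
    by (intro tendsto_intros L2_tendsto_norm F)
  ultimately show ?thesis by (rule LIMSEQ_unique)
qed

lemma is_fourier_add:
  assumes "is_fourier f g" "is_fourier f' g'"
  shows "is_fourier (\<lambda>x. f x + f' x) (\<lambda>x. g x + g' x)"
proof -
  obtain F where F: "\<And>k. F k \<in> L1_L2" "L2_tendsto F f" "L2_tendsto (\<lambda>k. fourier_integral (F k)) g"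
    using is_fourierE[OF assms(1)] by blast
  obtain F' where F': "\<And>k. F' k \<in> L1_L2" "L2_tendsto F' f'" "L2_tendsto (\<lambda>k. fourier_integral (F' k)) g'"
    using is_fourierE[OF assms(2)] by blast
  have "fourier_integral (\<lambda>x. F k x + F' k x) = (\<lambda>\<xi>. fourier_integral (F k) \<xi> + fourier_integral (F' k) \<xi>)" for k
    by (intro ext fourier_integral_add L1_L2_D F F')
  then show ?thesis
    using L2_tendsto_add[OF F(2) F'(2)] L2_tendsto_add[OF F(3) F'(3)] F(1) F'(1)
    by (intro is_fourierI[of "\<lambda>k x. F k x + F' k x"]) (auto simp: L1_L2_def intro: L2_space_add)
qed

lemma is_fourier_cmult:
  assumes "is_fourier f g"
  shows "is_fourier (\<lambda>x. c * f x) (\<lambda>x. c * g x)"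
proof -
  obtain F where F: "\<And>k. F k \<in> L1_L2" "L2_tendsto F f" "L2_tendsto (\<lambda>k. fourier_integral (F k)) g"
    using is_fourierE[OF assms(1)] by blast
  have "fourier_integral (\<lambda>x. c * F k x) = (\<lambda>\<xi>. c * fourier_integral (F k) \<xi>)" for k
    by (intro ext fourier_integral_cmult)
  then show ?thesis
    using L2_tendsto_cmult[OF F(2), of c] L2_tendsto_cmult[OF F(3), of c] F(1)
    by (intro is_fourierI[of "\<lambda>k x. c * F k x"]) (auto simp: L1_L2_def intro: L2_space_cmult)
qed

lemma is_fourier_diff:
  assumes "is_fourier f g" "is_fourier f' g'"
  shows "is_fourier (\<lambda>x. f x - f' x) (\<lambda>x. g x - g' x)"
  using is_fourier_add[OF assms(1) is_fourier_cmult[OF assms(2), of "-1"]] by simp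

lemma L2_norm_eq_0I:
  assumes "AE x in lborel. f x = 0" shows "L2_norm f = 0"
proof -
  have "(LINT x|lborel. (cmod (f x))\<^sup>2) = 0" by (rule integral_eq_zero_AE) (use assms in auto)
  then show ?thesis by (simp add: L2_norm_def)
qed

lemma is_fourier_unique:
  assumes "is_fourier f g" "is_fourier f' g'" "AE x in lborel. f x = f' x"
  shows "AE \<xi> in lborel. g \<xi> = g' \<xi>"
proof -
  have d: "is_fourier (\<lambda>x. f x - f' x) (\<lambda>x. g x - g' x)" by (rule is_fourier_diff[OF assms(1,2)])
  have [measurable]: "f \<in> borel_measurable lborel" "f' \<in> borel_measurable lborel"
    using is_fourier_L2(1)[OF assms(1)] is_fourier_L2(1)[OF assms(2)] by auto
  have "L2_norm (\<lambda>x. f x - f' x) = 0"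
    by (rule L2_norm_eq_0I) (use assms(3) in auto)
  then have "L2_norm (\<lambda>x. g x - g' x) = 0" using is_fourier_norm[OF d] by simp
  from L2_norm_eq_0D[OF is_fourier_L2(2)[OF d] this] show ?thesis by simp
qed

lemma is_fourier_inj:
  assumes "is_fourier f g" "is_fourier f' g'" "AE \<xi> in lborel. g \<xi> = g' \<xi>"
  shows "AE x in lborel. f x = f' x"
proof -
  have d: "is_fourier (\<lambda>x. f x - f' x) (\<lambda>x. g x - g' x)" by (rule is_fourier_diff[OF assms(1,2)])
  have [measurable]: "g \<in> borel_measurable lborel" "g' \<in> borel_measurable lborel"
    using is_fourier_L2(2)[OF assms(1)] is_fourier_L2(2)[OF assms(2)] by auto
  have "L2_norm (\<lambda>x. g x - g' x) = 0"
    by (rule L2_norm_eq_0I) (use assms(3) in auto)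
  then have "L2_norm (\<lambda>x. f x - f' x) = 0" using is_fourier_norm[OF d] by simp
  from L2_norm_eq_0D[OF is_fourier_L2(1)[OF d] this] show ?thesis by simp
qed

text \<open>Since \<open>fourier f\<close> is a choice, facts about it rest on this existence proof:
  by Plancherel the transforms of an approximating sequence in \<open>L1_L2\<close> are Cauchy, and
  L2 is complete.\<close>

lemma fourier_is_fourier:
  fixes f :: "'a::euclidean_space \<Rightarrow> complex"
  assumes "f \<in> L2_space"
  shows "is_fourier f (fourier f)"
proof -
  let ?S = "fourier_scale TYPE('a)"
  obtain F where F: "\<And>k. F k \<in> L1_L2" "L2_tendsto F f" using L1_L2_dense[OF assms] by blast
  have FL: "F k \<in> L2_space" for k using F(1) by (rule L1_L2_D)
  have "\<exists>g. L2_tendsto (\<lambda>k. fourier_integral (F k)) g"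
  proof (rule L2_complete[OF plancherel_le(1)[OF F(1)]])
    fix e :: real assume e: "0 < e"
    have S: "0 < ?S" by simp
    have "(\<lambda>k. L2_norm (\<lambda>x. F k x - f x)) \<longlonglongrightarrow> 0" using F(2) by (simp add: L2_tendsto_def)
    from LIMSEQ_D[OF this, of "e / ?S / 2"] obtain N where
      N: "\<And>k. k \<ge> N \<Longrightarrow> L2_norm (\<lambda>x. F k x - f x) < e / ?S / 2"
      using e S by auto
    have "L2_norm (\<lambda>x. fourier_integral (F m) x - fourier_integral (F n) x) < e" if "m \<ge> N" "n \<ge> N" for m n
    proof -
      have "L2_norm (\<lambda>x. fourier_integral (F m) x - fourier_integral (F n) x) = ?S * L2_norm (\<lambda>x. F m x - F n x)"
        using plancherel[OF L1_L2_diff[OF F(1) F(1)], of m n]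
        unfolding fourier_integral_L1_L2_diff[OF F(1) F(1)] .
      also have "L2_norm (\<lambda>x. F m x - F n x) < e / ?S"
        using L2_norm_triangle3[OF FL assms FL, of m n] N[OF that(1)] N[OF that(2)]
          L2_norm_minus_commute[of "F n" f] by linarith
      then have "?S * L2_norm (\<lambda>x. F m x - F n x) < e" using S by (simp add: field_simps)
      finally show ?thesis .
    qed
    then show "\<exists>N. \<forall>m\<ge>N. \<forall>n\<ge>N. L2_norm (\<lambda>x. fourier_integral (F m) x - fourier_integral (F n) x) < e"
      by blast
  qed
  then obtain g where "L2_tendsto (\<lambda>k. fourier_integral (F k)) g" by blast
  then have "is_fourier f g" by (rule is_fourierI[OF F])
  then show ?thesis unfolding fourier_def by (rule someI[of "is_fourier f"])
qed

lemma fourier_L2: "f \<in> L2_space \<Longrightarrow> fourier f \<in> L2_space"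
  using fourier_is_fourier is_fourier_L2(2) by blast

lemma fourier_AE_eqI: "is_fourier f g \<Longrightarrow> AE \<xi> in lborel. fourier f \<xi> = g \<xi>"
  by (rule is_fourier_unique[OF fourier_is_fourier[OF is_fourier_L2(1)]]) auto

lemma fourier_L1_L2:
  assumes "f \<in> L1_L2" shows "AE \<xi> in lborel. fourier f \<xi> = fourier_integral f \<xi>"
  by (intro fourier_AE_eqI is_fourierI[of "\<lambda>_. f"])
    (use assms plancherel_le(1)[OF assms] in \<open>auto simp: L2_tendsto_def L1_L2_D, auto simp: L2_norm_def\<close>)

lemma is_fourier_mult:
  assumes "is_fourier f g" "is_fourier f' g'"
  shows "(LINT x|lborel. g x * f' x) = (LINT x|lborel. f x * g' x)"
proof -
  obtain F where F: "\<And>k. F k \<in> L1_L2" "L2_tendsto F f" "L2_tendsto (\<lambda>k. fourier_integral (F k)) g"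
    using is_fourierE[OF assms(1)] by blast
  obtain F' where F': "\<And>k. F' k \<in> L1_L2" "L2_tendsto F' f'" "L2_tendsto (\<lambda>k. fourier_integral (F' k)) g'"
    using is_fourierE[OF assms(2)] by blast
  have "(LINT x|lborel. fourier_integral (F k) x * F' k x) = (LINT x|lborel. F k x * fourier_integral (F' k) x)" for k
    by (intro fourier_integral_mult L1_L2_D F F')
  then show ?thesis
    using LIMSEQ_unique[OF L2_tendsto_bilinear[OF F(3) F'(2)]] L2_tendsto_bilinear[OF F(2) F'(3)] by simp
qed

lemma L2_norm_diff_power2:
  assumes f: "f \<in> L2_space" and g: "g \<in> L2_space"
  shows "(L2_norm (\<lambda>x. f x - g x))\<^sup>2 = (L2_norm f)\<^sup>2 - 2 * Re (LINT x|lborel. f x * cnj (g x)) + (L2_norm g)\<^sup>2"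
proof -
  have i: "integrable lborel (\<lambda>x. f x * cnj (g x))" by (rule L2_mult(1)[OF f L2_space_cnj[OF g]])
  have "(cmod (a - b))\<^sup>2 = (cmod a)\<^sup>2 - 2 * Re (a * cnj b) + (cmod b)\<^sup>2" for a b
    by (simp add: cmod_power2 power2_diff algebra_simps)
  then have "(L2_norm (\<lambda>x. f x - g x))\<^sup>2
      = (LINT x|lborel. (cmod (f x))\<^sup>2 - 2 * Re (f x * cnj (g x)) + (cmod (g x))\<^sup>2)"
    unfolding L2_norm_power2 by (simp only:)
  also have "\<dots> = (LINT x|lborel. (cmod (f x))\<^sup>2) - 2 * (LINT x|lborel. Re (f x * cnj (g x))) + (LINT x|lborel. (cmod (g x))\<^sup>2)"
    using L2_space_integrable[OF f] L2_space_integrable[OF g] integrable_Re[OF i]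
    by (simp only: Bochner_Integration.integral_add Bochner_Integration.integral_diff
        integral_mult_right_zero Bochner_Integration.integrable_diff integrable_mult_right)
  also have "(LINT x|lborel. Re (f x * cnj (g x))) = Re (LINT x|lborel. f x * cnj (g x))"
    by (rule integral_Re[OF i])
  finally show ?thesis by (simp only: L2_norm_power2)
qed

text \<open>By the multiplication formula the adjoint of the Fourier transform \<open>U\<close> is \<open>g \<mapsto> cnj (U (cnj g))\<close>.
  Up to scaling both are isometries, which forces \<open>U\<close> to be onto.\<close>

theorem is_fourier_surj:
  fixes g :: "'a::euclidean_space \<Rightarrow> complex"
  assumes g: "g \<in> L2_space"
  obtains f where "is_fourier f g"
proof -
  let ?S = "fourier_scale TYPE('a)"
  have S: "0 < ?S" by simp
  let ?g = "\<lambda>x. cnj (g x)"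
  have g': "?g \<in> L2_space" by (rule L2_space_cnj[OF g])
  define G where "G = fourier ?g"
  have G: "is_fourier ?g G" unfolding G_def by (rule fourier_is_fourier[OF g'])
  \<comment> \<open>\<open>?S\<^sup>2\<close> is the constant of the inversion formula; dividing by
    it gives \<open>fourier f\<close> the same norm as \<open>g\<close>.\<close>
  define c where "c = complex_of_real (inverse (?S\<^sup>2))"
  define f where "f x = c * cnj (G x)" for x
  have f: "f \<in> L2_space" unfolding f_def by (intro L2_space_cmult L2_space_cnj is_fourier_L2(2)[OF G])
  have F: "is_fourier f (fourier f)" by (rule fourier_is_fourier[OF f])
  have Fs: "fourier f \<in> L2_space" by (rule fourier_L2[OF f])
  have n0: "L2_norm f = inverse (?S\<^sup>2) * L2_norm G"
    unfolding f_def L2_norm_cmult by (simp add: c_def norm_inverse norm_power)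
  have "L2_norm f = inverse ?S * L2_norm g"
    unfolding n0 is_fourier_norm[OF G] using S by (simp add: field_simps power2_eq_square)
  then have n1: "L2_norm (fourier f) = L2_norm g"
    unfolding is_fourier_norm[OF F] using S by (simp add: field_simps)
  \<comment> \<open>Expanding the square of the distance between \<open>fourier f\<close> and
    \<open>g\<close> leaves two equal squared norms minus twice the real part of this product. The
    multiplication formula shows that it is the same number, so the distance is 0.\<close>
  have "(LINT x|lborel. fourier f x * cnj (g x)) = (LINT x|lborel. f x * G x)"
    by (rule is_fourier_mult[OF F G])
  also have "\<dots> = (LINT x|lborel. complex_of_real (inverse (?S\<^sup>2) * (cmod (G x))\<^sup>2))"
    unfolding f_def c_def of_real_mult complex_norm_square by (simp only: mult_ac)
  also have "\<dots> = complex_of_real (inverse (?S\<^sup>2) * (L2_norm G)\<^sup>2)"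
    by (simp only: integral_complex_of_real integral_mult_right_zero L2_norm_power2)
  also have "inverse (?S\<^sup>2) * (L2_norm G)\<^sup>2 = (L2_norm g)\<^sup>2"
    unfolding is_fourier_norm[OF G] using S by (simp add: power_mult_distrib)
  finally have "(L2_norm (\<lambda>x. fourier f x - g x))\<^sup>2 = 0"
    unfolding L2_norm_diff_power2[OF Fs g] n1 by simp
  then have "L2_norm (\<lambda>x. fourier f x - g x) = 0" by simp
  then have ae: "AE x in lborel. fourier f x = g x"
    using L2_norm_eq_0D[OF L2_space_diff[OF Fs g]] by simp
  \<comment> \<open>\<open>is_fourier\<close> is needed for \<open>g\<close> itself, so the
    approximating sequence is carried over from \<open>fourier f\<close>, which equals
    \<open>g\<close> only almost everywhere.\<close>
  obtain H where H: "\<And>k. H k \<in> L1_L2" "L2_tendsto H f" "L2_tendsto (\<lambda>k. fourier_integral (H k)) (fourier f)"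
    using is_fourierE[OF F] by blast
  have "L2_norm (\<lambda>x. fourier_integral (H k) x - g x) = L2_norm (\<lambda>x. fourier_integral (H k) x - fourier f x)" for k
  proof (rule L2_norm_cong_AE)
    have "fourier_integral (H k) \<in> L2_space" by (rule plancherel_le(1)[OF H(1)])
    then show "(\<lambda>x. fourier_integral (H k) x - g x) \<in> borel_measurable lborel"
       "(\<lambda>x. fourier_integral (H k) x - fourier f x) \<in> borel_measurable lborel"
      using g Fs by (auto intro!: borel_measurable_diff)
  qed (use ae in auto)
  then have "L2_tendsto (\<lambda>k. fourier_integral (H k)) g"
    using H(3) g by (simp add: L2_tendsto_def)
  then have "is_fourier f g" by (rule is_fourierI[OF H(1,2)])
  then show ?thesis by (rule that)
qed

section \<open>Solutions of the damped oscillator\<close>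

definition damp :: "real \<Rightarrow> real" where
  "damp m = 1 / (2 * (1 + m))"

text \<open>If \<open>y\<close> solves the oscillator equation, then
  \<open>z = exp (damp m * t) * y\<close> solves \<open>z'' + freq2 m * z = 0\<close>. The sign
  separates the oscillating regime from the overdamped one at small \<open>m\<close>.\<close>

definition freq2 :: "real \<Rightarrow> real" where
  "freq2 m = m - (damp m)\<^sup>2"

text \<open>\<open>prop0 m\<close> and \<open>prop1 m\<close> are the solutions of \<open>y'' + 2 damp m y' + m y = 0\<close> with initial data
  \<open>(1, 0)\<close> and \<open>(0, 1)\<close>. At the double root \<open>freq2 m = 0\<close> they are junk because \<open>osc_s\<close> divides by 0, but
  \<open>freq2 (Lsym \<xi>) = 0\<close> only on a sphere.\<close>

definition osc_c :: "real \<Rightarrow> real \<Rightarrow> real" where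
  "osc_c q t = (if 0 < q then cos (sqrt q * t) else cosh (sqrt (- q) * t))"

definition osc_s :: "real \<Rightarrow> real \<Rightarrow> real" where
  "osc_s q t = (if 0 < q then sin (sqrt q * t) / sqrt q else sinh (sqrt (- q) * t) / sqrt (- q))"

definition prop0 :: "real \<Rightarrow> real \<Rightarrow> real" where
  "prop0 m t = exp (- damp m * t) * (osc_c (freq2 m) t + damp m * osc_s (freq2 m) t)"

definition prop1 :: "real \<Rightarrow> real \<Rightarrow> real" where
  "prop1 m t = exp (- damp m * t) * osc_s (freq2 m) t"

lemma damp_bounds: "0 \<le> m \<Longrightarrow> 0 < damp m" "0 \<le> m \<Longrightarrow> damp m \<le> 1 / 2"
  by (auto simp: damp_def field_simps)

lemma osc_deriv:
  assumes "q \<noteq> 0"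
  shows "(osc_c q has_real_derivative - q * osc_s q t) (at t)"
    and "(osc_s q has_real_derivative osc_c q t) (at t)"
proof -
  consider "0 < q" | "q < 0" using assms by linarith
  then have "(osc_c q has_real_derivative - q * osc_s q t) (at t)
     \<and> (osc_s q has_real_derivative osc_c q t) (at t)"
  proof cases
    case 1
    then have e: "osc_c q = (\<lambda>t. cos (sqrt q * t))" "osc_s q = (\<lambda>t. sin (sqrt q * t) / sqrt q)"
      by (auto simp: osc_c_def osc_s_def fun_eq_iff)
    have r: "q = sqrt q * sqrt q" "sqrt q \<noteq> 0" using 1 by auto
    show ?thesis unfolding e
      by (intro conjI; (rule derivative_eq_intros refl | use r in \<open>simp add: field_simps\<close>)+)
  next
    case 2
    then have e: "osc_c q = (\<lambda>t. cosh (sqrt (- q) * t))" "osc_s q = (\<lambda>t. sinh (sqrt (- q) * t) / sqrt (- q))"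
      by (auto simp: osc_c_def osc_s_def fun_eq_iff)
    define \<mu> where "\<mu> = sqrt (- q)"
    have r: "q = - (\<mu> * \<mu>)" "\<mu> \<noteq> 0" using 2 by (auto simp: \<mu>_def)
    show ?thesis unfolding e \<mu>_def[symmetric]
      by (intro conjI; (rule derivative_eq_intros refl | use r in \<open>simp add: field_simps\<close>)+)
  qed
  then show "(osc_c q has_real_derivative - q * osc_s q t) (at t)"
    "(osc_s q has_real_derivative osc_c q t) (at t)" by auto
qed

lemma osc_0 [simp]: "osc_c q 0 = 1" "osc_s q 0 = 0"
  by (auto simp: osc_c_def osc_s_def)

lemma prop_0 [simp]: "prop0 m 0 = 1" "prop1 m 0 = 0"
  by (auto simp: prop0_def prop1_def)

text \<open>The derivatives are again combinations of the two propagators. This closed system yields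
  the second derivatives as well, without differentiating \<open>osc_c\<close> and
  \<open>osc_s\<close> again.\<close>

lemma prop_deriv:
  assumes "freq2 m \<noteq> 0"
  shows "(prop0 m has_real_derivative - m * prop1 m t) (at t)"
    and "(prop1 m has_real_derivative prop0 m t - 2 * damp m * prop1 m t) (at t)"
proof -
  have q: "freq2 m = m - damp m * damp m" by (simp add: freq2_def power2_eq_square)
  note [derivative_intros] = osc_deriv[OF assms, THEN DERIV_chain2]
  show "(prop0 m has_real_derivative - m * prop1 m t) (at t)"
    unfolding prop0_def prop1_def
    by (rule derivative_eq_intros refl)+ (simp add: q algebra_simps)
  show "(prop1 m has_real_derivative prop0 m t - 2 * damp m * prop1 m t) (at t)"
    unfolding prop0_def prop1_def
    by (rule derivative_eq_intros refl)+ (simp add: algebra_simps)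
qed

text \<open>Used in the form \<open>sinh (\<mu> * t) / \<mu> \<le> t * cosh (\<mu> * t)\<close>,
  which stays bounded as \<open>\<mu>\<close> tends to 0, that is, near the double root.\<close>

lemma sinh_le_mult_cosh:
  fixes x :: real assumes "0 \<le> x" shows "sinh x \<le> x * cosh x"
proof -
  have "x * cosh x - sinh x \<ge> 0 * cosh 0 - sinh 0"
  proof (rule DERIV_nonneg_imp_nondecreasing[OF assms])
    fix y :: real assume "0 \<le> y" "y \<le> x"
    have "((\<lambda>x. x * cosh x - sinh x) has_real_derivative y * sinh y) (at y)"
      by (rule derivative_eq_intros refl)+ simp
    moreover have "0 \<le> y * sinh y" using \<open>0 \<le> y\<close> by simp
    ultimately show "\<exists>d. ((\<lambda>x. x * cosh x - sinh x) has_real_derivative d) (at y) \<and> 0 \<le> d"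
      by blast
  qed
  then show ?thesis by simp
qed

lemma exp_mult_cosh_le: 
  fixes x y :: real assumes "0 \<le> y" shows "exp (- x) * cosh y \<le> exp (- (x - y))"
proof -
  have "cosh y \<le> exp y" using assms by (simp add: cosh_field_def)
  then have "exp (- x) * cosh y \<le> exp (- x) * exp y" by (intro mult_left_mono) auto
  then show ?thesis by (simp add: exp_add[symmetric])
qed

text \<open>The bounds are uniform in \<open>m\<close>, across the double root, which accounts for
  the linear growth in \<open>t\<close>. In the overdamped case \<open>\<mu> \<le> damp m\<close>,
  so the exponential absorbs the hyperbolic growth.\<close>

lemma prop_bounds:
  assumes m: "0 \<le> m" and q: "freq2 m \<noteq> 0" and t: "0 \<le> t"
  shows "\<bar>prop0 m t\<bar> \<le> 1 + t" "\<bar>prop1 m t\<bar> \<le> t"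
proof -
  let ?q = "freq2 m" and ?a = "damp m"
  have a: "0 < ?a" "?a \<le> 1 / 2" using damp_bounds[OF m] by auto
  have e: "0 < exp (- ?a * t)" "exp (- ?a * t) \<le> 1" using a t by auto
  have "exp (- ?a * t) * \<bar>osc_c ?q t\<bar> \<le> 1 \<and> exp (- ?a * t) * \<bar>osc_s ?q t\<bar> \<le> t"
  proof (cases "0 < ?q")
    case True
    have c: "\<bar>osc_c ?q t\<bar> \<le> 1" using True by (simp add: osc_c_def)
    have s: "\<bar>osc_s ?q t\<bar> \<le> t"
      using True t abs_sin_x_le_abs_x[of "sqrt ?q * t"] by (simp add: osc_s_def abs_mult field_simps)
    show ?thesis using mult_mono[OF e(2) c] mult_mono[OF e(2) s] e(1) t by simp
  next
    case False
    define \<mu> where "\<mu> = sqrt (- ?q)"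
    have mu: "0 < \<mu>" using False q by (simp add: \<mu>_def)
    have "\<mu> \<le> ?a" using m a unfolding \<mu>_def freq2_def by (intro real_le_lsqrt) auto
    then have "exp (- (?a * t - \<mu> * t)) \<le> 1" using t by (simp add: mult_right_mono)
    then have c: "exp (- ?a * t) * cosh (\<mu> * t) \<le> 1"
      using order.trans[OF exp_mult_cosh_le[of "\<mu> * t" "?a * t"]] mu t by simp
    have "sinh (\<mu> * t) / \<mu> \<le> t * cosh (\<mu> * t)"
      using sinh_le_mult_cosh[of "\<mu> * t"] mu t by (simp add: field_simps)
    then have "exp (- ?a * t) * (sinh (\<mu> * t) / \<mu>) \<le> exp (- ?a * t) * (t * cosh (\<mu> * t))"
      by (intro mult_left_mono) auto
    also have "\<dots> = t * (exp (- ?a * t) * cosh (\<mu> * t))" by simp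
    also have "\<dots> \<le> t * 1" using c t by (intro mult_left_mono) auto
    finally have s: "exp (- ?a * t) * (sinh (\<mu> * t) / \<mu>) \<le> t" by simp
    have "0 \<le> sinh (\<mu> * t)" using mu t by simp
    then show ?thesis using c s mu False unfolding osc_c_def osc_s_def \<mu>_def[symmetric] by simp
  qed
  then have cs: "exp (- ?a * t) * \<bar>osc_c ?q t\<bar> \<le> 1" "exp (- ?a * t) * \<bar>osc_s ?q t\<bar> \<le> t" by auto
  show p1: "\<bar>prop1 m t\<bar> \<le> t" using cs(2) by (simp add: prop1_def abs_mult)
  have "prop0 m t = exp (- ?a * t) * osc_c ?q t + ?a * prop1 m t"
    by (simp add: prop0_def prop1_def algebra_simps)
  then have "\<bar>prop0 m t\<bar> \<le> exp (- ?a * t) * \<bar>osc_c ?q t\<bar> + ?a * \<bar>prop1 m t\<bar>"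
    using abs_triangle_ineq[of "exp (- ?a * t) * osc_c ?q t" "?a * prop1 m t"] a by (simp add: abs_mult)
  also have "\<dots> \<le> 1 + 1 * t"
    using cs(1) p1 a t by (intro add_mono mult_mono) auto
  finally show "\<bar>prop0 m t\<bar> \<le> 1 + t" by simp
qed

section \<open>First and second order increments of the propagators\<close>

lemma mvt_bound:
  fixes f f' :: "real \<Rightarrow> real"
  assumes f: "\<And>z. (f has_real_derivative f' z) (at z)"
    and b: "\<And>z. 0 \<le> z \<Longrightarrow> z \<le> T \<Longrightarrow> \<bar>f' z\<bar> \<le> C"
    and x: "0 \<le> x" "x \<le> T" and y: "0 \<le> y" "y \<le> T"
  shows "\<bar>f y - f x\<bar> \<le> C * \<bar>y - x\<bar>"
  using field_differentiable_bound[of "{0..T}" f f' C y x] assms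
  by (auto intro: has_field_derivative_at_within)

text \<open>Two successive mean value estimates lose the factor 1/2 of Taylor's formula; only the
  quadratic order of the remainder matters.\<close>

lemma taylor2_bound:
  fixes f f' f'' :: "real \<Rightarrow> real"
  assumes f: "\<And>z. (f has_real_derivative f' z) (at z)"
    and f': "\<And>z. (f' has_real_derivative f'' z) (at z)"
    and b: "\<And>z. 0 \<le> z \<Longrightarrow> z \<le> T \<Longrightarrow> \<bar>f'' z\<bar> \<le> C"
    and x: "0 \<le> x" "x \<le> T" and y: "0 \<le> y" "y \<le> T"
  shows "\<bar>f y - f x - (y - x) * f' x\<bar> \<le> C * \<bar>y - x\<bar> * \<bar>y - x\<bar>"
proof -
  have C0: "0 \<le> C" using b[OF x] by linarith
  have s: "closed_segment x y \<subseteq> {0..T}" using x y by (auto simp: closed_segment_eq_real_ivl)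
  have "norm ((\<lambda>z. f z - z * f' x) y - (\<lambda>z. f z - z * f' x) x) \<le> (C * \<bar>y - x\<bar>) * norm (y - x)"
  proof (rule field_differentiable_bound[of "closed_segment x y" _ "\<lambda>z. f' z - f' x"])
    fix z assume z: "z \<in> closed_segment x y"
    have "((\<lambda>z. f z - z * f' x) has_real_derivative f' z - f' x) (at z)"
      by (rule derivative_eq_intros f refl)+ simp
    then show "((\<lambda>z. f z - z * f' x) has_real_derivative f' z - f' x) (at z within closed_segment x y)"
      by (rule has_field_derivative_at_within)
    have "\<bar>f' z - f' x\<bar> \<le> C * \<bar>z - x\<bar>"
      using s z by (intro mvt_bound[where T=T and f'=f''] f' b x) auto
    also have "\<bar>z - x\<bar> \<le> \<bar>y - x\<bar>" using z by (auto simp: closed_segment_eq_real_ivl split: if_splits)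
    finally show "norm (f' z - f' x) \<le> C * \<bar>y - x\<bar>" using C0 by (simp add: mult_left_mono)
  qed auto
  then show ?thesis by (simp add: algebra_simps)
qed

text \<open>\<open>C\<close> majorises the first and second derivatives of both propagators on
  \<open>{0..T}\<close>. Each derivative costs a factor \<open>m\<close> or
  \<open>2 * damp m\<close>, hence the restriction to \<open>m \<le> R\<close>.\<close>

lemma prop_increments:
  assumes m: "0 \<le> m" "m \<le> R" and q: "freq2 m \<noteq> 0"
    and x: "0 \<le> x" "x \<le> T" and y: "0 \<le> y" "y \<le> T"
  defines "C \<equiv> (2 * R + 2) * (1 + T)"
  shows "\<bar>prop0 m y - prop0 m x\<bar> \<le> C * \<bar>y - x\<bar>"
    and "\<bar>prop1 m y - prop1 m x\<bar> \<le> C * \<bar>y - x\<bar>"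
    and "\<bar>prop0 m y - prop0 m x + (y - x) * (m * prop1 m x)\<bar> \<le> C * \<bar>y - x\<bar> * \<bar>y - x\<bar>"
    and "\<bar>prop1 m y - prop1 m x - (y - x) * (prop0 m x - 2 * damp m * prop1 m x)\<bar> \<le> C * \<bar>y - x\<bar> * \<bar>y - x\<bar>"
proof -
  have T: "0 \<le> T" and R: "0 \<le> R" using x m by auto
  have a: "0 \<le> 2 * damp m" "2 * damp m \<le> 1" using damp_bounds[OF m(1)] by auto
  note d = prop_deriv[OF q]
  have b0: "\<bar>prop0 m z\<bar> \<le> 1 + T" if "0 \<le> z" "z \<le> T" for z using prop_bounds(1)[OF m(1) q that(1)] that by linarith
  have b1: "\<bar>prop1 m z\<bar> \<le> 1 + T" if "0 \<le> z" "z \<le> T" for z using prop_bounds(2)[OF m(1) q that(1)] that by linarith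
  have d0: "\<bar>- m * prop1 m z\<bar> \<le> R * (1 + T)" if "0 \<le> z" "z \<le> T" for z
    using mult_mono[OF m(2) b1[OF that]] m by (simp add: abs_mult)
  have d1: "\<bar>prop0 m z - 2 * damp m * prop1 m z\<bar> \<le> 2 * (1 + T)" if "0 \<le> z" "z \<le> T" for z
  proof -
    have "\<bar>2 * damp m * prop1 m z\<bar> \<le> 1 * (1 + T)"
      unfolding abs_mult[of "2 * damp m"] using a b1[OF that] by (intro mult_mono) auto
    moreover have "\<bar>prop0 m z - 2 * damp m * prop1 m z\<bar> \<le> \<bar>prop0 m z\<bar> + \<bar>2 * damp m * prop1 m z\<bar>"
      by (rule abs_triangle_ineq4)
    ultimately show ?thesis using b0[OF that] by (simp only: distrib_left mult_1_right mult_1_left)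
  qed
  have dd0: "\<bar>- m * (prop0 m z - 2 * damp m * prop1 m z)\<bar> \<le> R * (2 * (1 + T))" if "0 \<le> z" "z \<le> T" for z
    using mult_mono[OF m(2) d1[OF that]] m by (simp add: abs_mult)
  have dd1: "\<bar>- m * prop1 m z - 2 * damp m * (prop0 m z - 2 * damp m * prop1 m z)\<bar> \<le> R * (1 + T) + 2 * (1 + T)"
    if "0 \<le> z" "z \<le> T" for z
  proof -
    have "\<bar>2 * damp m * (prop0 m z - 2 * damp m * prop1 m z)\<bar> \<le> 1 * (2 * (1 + T))"
      unfolding abs_mult[of "2 * damp m"] using a d1[OF that] by (intro mult_mono) auto
    moreover have "\<bar>- m * prop1 m z - 2 * damp m * (prop0 m z - 2 * damp m * prop1 m z)\<bar>
        \<le> \<bar>- m * prop1 m z\<bar> + \<bar>2 * damp m * (prop0 m z - 2 * damp m * prop1 m z)\<bar>"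
      by (rule abs_triangle_ineq4)
    ultimately show ?thesis using d0[OF that] by linarith
  qed
  have RT: "0 \<le> R * T" using R T by simp
  have CR: "R * (1 + T) \<le> C" "2 * (1 + T) \<le> C" "R * (2 * (1 + T)) \<le> C" "R * (1 + T) + 2 * (1 + T) \<le> C"
    using R T RT by (auto simp: C_def algebra_simps)
  show "\<bar>prop0 m y - prop0 m x\<bar> \<le> C * \<bar>y - x\<bar>"
    by (rule mvt_bound[OF d(1) _ x y]) (use d0 CR in \<open>fastforce intro: order.trans\<close>)
  show "\<bar>prop1 m y - prop1 m x\<bar> \<le> C * \<bar>y - x\<bar>"
    by (rule mvt_bound[OF d(2) _ x y]) (use d1 CR in \<open>fastforce intro: order.trans\<close>)
  have "\<bar>prop0 m y - prop0 m x - (y - x) * (- m * prop1 m x)\<bar> \<le> C * \<bar>y - x\<bar> * \<bar>y - x\<bar>"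
    by (rule taylor2_bound[OF d(1) DERIV_cmult[OF d(2)] _ x y])
      (use dd0 CR in \<open>fastforce intro: order.trans\<close>)
  then show "\<bar>prop0 m y - prop0 m x + (y - x) * (m * prop1 m x)\<bar> \<le> C * \<bar>y - x\<bar> * \<bar>y - x\<bar>" by simp
  show "\<bar>prop1 m y - prop1 m x - (y - x) * (prop0 m x - 2 * damp m * prop1 m x)\<bar> \<le> C * \<bar>y - x\<bar> * \<bar>y - x\<bar>"
    by (rule taylor2_bound[OF d(2) DERIV_diff[OF d(1) DERIV_cmult[OF d(2)]] _ x y])
      (use dd1 CR in \<open>fastforce intro: order.trans\<close>)
qed

lemma damp_borel [measurable]: "damp \<in> borel_measurable borel"
  unfolding damp_def by measurable

lemma cosh_sinh_borel [measurable]: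
  "(cosh :: real \<Rightarrow> real) \<in> borel_measurable borel" "(sinh :: real \<Rightarrow> real) \<in> borel_measurable borel"
  by (intro borel_measurable_continuous_onI continuous_intros)+

lemma prop_borel [measurable]:
  "(\<lambda>m. prop0 m t) \<in> borel_measurable borel" "(\<lambda>m. prop1 m t) \<in> borel_measurable borel"
  unfolding prop0_def prop1_def osc_c_def osc_s_def freq2_def by measurable

section \<open>The propagator formula for curves in L2\<close>

definition L2_bounded_by :: "('a::euclidean_space \<Rightarrow> real) \<Rightarrow> real \<Rightarrow> bool" where
  "L2_bounded_by \<phi> c \<longleftrightarrow> (\<lambda>x. complex_of_real (\<phi> x)) \<in> L2_space \<and>
     L2_norm (\<lambda>x. complex_of_real (\<phi> x)) \<le> c"

lemma L2_bounded_by_cmod: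
  assumes f: "f \<in> L2_space" shows "L2_bounded_by (\<lambda>x. cmod (f x)) (L2_norm f)"
proof -
  have [measurable]: "f \<in> borel_measurable borel" using f by auto
  show ?thesis using L2_dominated[of "\<lambda>x. complex_of_real (cmod (f x))" f 1] f
    unfolding L2_bounded_by_def by simp
qed

lemma L2_bounded_by_add:
  "L2_bounded_by \<phi> c \<Longrightarrow> L2_bounded_by \<psi> d \<Longrightarrow> L2_bounded_by (\<lambda>x. \<phi> x + \<psi> x) (c + d)"
  unfolding L2_bounded_by_def
  using L2_space_add[of "\<lambda>x. complex_of_real (\<phi> x)" "\<lambda>x. complex_of_real (\<psi> x)"]
    L2_norm_triangle[of "\<lambda>x. complex_of_real (\<phi> x)" "\<lambda>x. complex_of_real (\<psi> x)"]
  by auto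

lemma L2_bounded_by_mult:
  "L2_bounded_by \<phi> c \<Longrightarrow> 0 \<le> k \<Longrightarrow> L2_bounded_by (\<lambda>x. k * \<phi> x) (k * c)"
  unfolding L2_bounded_by_def
  using L2_space_cmult[of "\<lambda>x. complex_of_real (\<phi> x)" "complex_of_real k"]
    L2_norm_cmult[of "complex_of_real k" "\<lambda>x. complex_of_real (\<phi> x)"]
  by (auto intro: mult_left_mono)

text \<open>The purpose of the predicate: a pointwise majorant with many terms is bounded in norm
  term by term, with square integrability carried along.\<close>

lemma L2_bounded_byD:
  assumes "L2_bounded_by \<phi> c" "f \<in> borel_measurable lborel" "AE x in lborel. cmod (f x) \<le> \<phi> x"
  shows "f \<in> L2_space" "L2_norm f \<le> c"
proof -
  have le: "AE x in lborel. cmod (f x) \<le> 1 * cmod (complex_of_real (\<phi> x))"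
    using assms(3) by eventually_elim simp
  show "f \<in> L2_space" "L2_norm f \<le> c"
    using L2_dominated[OF assms(2) _ _ le] assms(1) by (auto simp: L2_bounded_by_def)
qed

text \<open>A discrete product rule at one frequency, with \<open>u'\<close>, \<open>v'\<close> as
  values at \<open>s\<close> and \<open>u\<close>, \<open>v\<close>, \<open>w\<close> as values at
  \<open>t\<close>. To first order in \<open>s - t\<close> the increment is
  \<open>prop1 m (T - t)\<close> times the residual \<open>w + m * u + 2 * damp m * v\<close> of the
  equation; what remains are the errors of the difference quotients and terms quadratic in
  \<open>s - t\<close>.\<close>

lemma prop_pointwise_increment:
  fixes u u' v v' w :: complex
  assumes m: "0 \<le> m" "m \<le> R" and q: "freq2 m \<noteq> 0"
    and s: "0 \<le> s" "s \<le> T" and t: "0 \<le> t" "t \<le> T" and st: "s \<noteq> t"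
  defines "C \<equiv> (2 * R + 2) * (1 + T)"
  shows "cmod ((prop0 m (T - s) * u' + prop1 m (T - s) * v') - (prop0 m (T - t) * u + prop1 m (T - t) * v))
    \<le> \<bar>s - t\<bar> * ((1 + T) * cmod ((u' - u) / complex_of_real (s - t) - v)
        + (1 + T) * cmod ((v' - v) / complex_of_real (s - t) - w)
        + (1 + T) * cmod (w + m * u + 2 * damp m * v)
        + \<bar>s - t\<bar> * (C * cmod u + C * (2 * cmod v) + C * cmod w))"
proof -
  define \<delta> where "\<delta> = s - t"
  have d: "\<delta> \<noteq> 0" using st by (simp add: \<delta>_def)
  define A0 where "A0 = prop0 m (T - t)"
  define B0 where "B0 = prop1 m (T - t)"
  define A1 where "A1 = prop0 m (T - s)"
  define B1 where "B1 = prop1 m (T - s)"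
  define p where "p = (u' - u) / complex_of_real \<delta> - v"
  define r where "r = (v' - v) / complex_of_real \<delta> - w"
  define z where "z = w + m * u + 2 * damp m * v"
  \<comment> \<open>Second order remainders. The propagators are evaluated at \<open>T - s\<close>
    and \<open>T - t\<close>, which reverses time and flips the signs of the derivative
    terms.\<close>
  define eA where "eA = A1 - A0 - \<delta> * (m * B0)"
  define eB where "eB = B1 - B0 + \<delta> * (A0 - 2 * damp m * B0)"
  have u': "u' = u + \<delta> * (v + p)" and v': "v' = v + \<delta> * (w + r)"
    using d by (simp_all add: p_def r_def)
  have "0 \<le> T - t" "T - t \<le> T" "0 \<le> T - s" "T - s \<le> T" using s t by auto
  note inc = prop_increments[OF m q this, folded C_def A0_def A1_def B0_def B1_def]
  have dd: "T - s - (T - t) = - \<delta>" by (simp add: \<delta>_def)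
  have iA: "\<bar>A1 - A0\<bar> \<le> C * \<bar>\<delta>\<bar>" and iB: "\<bar>B1 - B0\<bar> \<le> C * \<bar>\<delta>\<bar>"
    and rA: "\<bar>eA\<bar> \<le> \<bar>\<delta>\<bar> * (\<bar>\<delta>\<bar> * C)" and rB: "\<bar>eB\<bar> \<le> \<bar>\<delta>\<bar> * (\<bar>\<delta>\<bar> * C)"
    using inc unfolding dd by (simp_all add: eA_def eB_def mult_ac)
  have bA: "\<bar>A1\<bar> \<le> 1 + T" using prop_bounds(1)[OF m(1) q, of "T - s"] s by (simp add: A1_def)
  have bB: "\<bar>B1\<bar> \<le> 1 + T" using prop_bounds(2)[OF m(1) q, of "T - s"] s by (simp add: B1_def)
  have bB0: "\<bar>B0\<bar> \<le> 1 + T" using prop_bounds(2)[OF m(1) q, of "T - t"] t by (simp add: B0_def)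
  have id: "(A1 * u' + B1 * v') - (A0 * u + B0 * v)
     = \<delta> * (A1 * p + B1 * r + complex_of_real (A1 - A0) * v + complex_of_real (B1 - B0) * w + B0 * z)
       + complex_of_real eA * u + complex_of_real eB * v"
    unfolding u' v' z_def eA_def eB_def by (simp add: algebra_simps)
  have "cmod (A1 * p + B1 * r + complex_of_real (A1 - A0) * v + complex_of_real (B1 - B0) * w + B0 * z)
     \<le> (1 + T) * cmod p + (1 + T) * cmod r + C * \<bar>\<delta>\<bar> * cmod v + C * \<bar>\<delta>\<bar> * cmod w + (1 + T) * cmod z"
    by (intro norm_triangle_le add_mono) (auto simp: norm_mult simp del: of_real_diff intro!: mult_right_mono bA bB bB0 iA iB)
  then have "cmod (\<delta> * (A1 * p + B1 * r + complex_of_real (A1 - A0) * v + complex_of_real (B1 - B0) * w + B0 * z))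
     \<le> \<bar>\<delta>\<bar> * ((1 + T) * cmod p + (1 + T) * cmod r + C * \<bar>\<delta>\<bar> * cmod v + C * \<bar>\<delta>\<bar> * cmod w + (1 + T) * cmod z)"
    unfolding norm_mult norm_of_real by (intro mult_left_mono) auto
  moreover have "cmod (complex_of_real eA * u) \<le> \<bar>\<delta>\<bar> * (\<bar>\<delta>\<bar> * C) * cmod u"
    unfolding norm_mult norm_of_real by (intro mult_right_mono rA) auto
  moreover have "cmod (complex_of_real eB * v) \<le> \<bar>\<delta>\<bar> * (\<bar>\<delta>\<bar> * C) * cmod v"
    unfolding norm_mult norm_of_real by (intro mult_right_mono rB) auto
  ultimately have "cmod ((A1 * u' + B1 * v') - (A0 * u + B0 * v))
    \<le> \<bar>\<delta>\<bar> * ((1 + T) * cmod p + (1 + T) * cmod r + C * \<bar>\<delta>\<bar> * cmod v + C * \<bar>\<delta>\<bar> * cmod w + (1 + T) * cmod z)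
     + \<bar>\<delta>\<bar> * (\<bar>\<delta>\<bar> * C) * cmod u + \<bar>\<delta>\<bar> * (\<bar>\<delta>\<bar> * C) * cmod v"
    unfolding id by (intro norm_triangle_le add_mono)
  also have "\<dots> = \<bar>\<delta>\<bar> * ((1 + T) * cmod p + (1 + T) * cmod r + (1 + T) * cmod z
        + \<bar>\<delta>\<bar> * (C * cmod u + C * (2 * cmod v) + C * cmod w))"
    by (simp add: algebra_simps)
  finally show ?thesis
    unfolding A0_def A1_def B0_def B1_def p_def r_def z_def \<delta>_def by simp
qed

text \<open>For fixed \<open>T\<close> the backward propagator turns the solution into the curve
  \<open>h t = prop0 (T - t) U t + prop1 (T - t) V t\<close>, whose derivative vanishes by the equation. Restricting to
  \<open>m \<le> R\<close> makes all coefficients bounded.\<close>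

lemma propagate:
  fixes U V W :: "real \<Rightarrow> 'a::euclidean_space \<Rightarrow> complex" and m :: "'a \<Rightarrow> real"
  assumes m [measurable]: "m \<in> borel_measurable borel" and m0: "\<And>x. 0 \<le> m x"
    and q: "AE x in lborel. freq2 (m x) \<noteq> 0"
    and UV: "curve_has_derivative L2_space L2_norm U V"
    and VW: "curve_has_derivative L2_space L2_norm V W"
    and eq: "\<And>t. 0 < t \<Longrightarrow> AE x in lborel. W t x + m x * U t x + 2 * damp (m x) * V t x = 0"
    and T: "0 < T"
  shows "AE x in lborel. U T x = prop0 (m x) T * U 0 x + prop1 (m x) T * V 0 x"
proof -
  have US: "U t \<in> L2_space" and VS: "V t \<in> L2_space" and WS: "W t \<in> L2_space" if "0 \<le> t" for t
    using UV VW that by (auto simp: curve_has_derivative_def)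
  have Um [measurable]: "U t \<in> borel_measurable borel" and Vm [measurable]: "V t \<in> borel_measurable borel"
    and Wm [measurable]: "W t \<in> borel_measurable borel" if "0 \<le> t" for t
    using US[OF that] VS[OF that] WS[OF that] by auto
  have "AE x in lborel. m x \<le> real R \<longrightarrow> U T x = prop0 (m x) T * U 0 x + prop1 (m x) T * V 0 x" for R :: nat
  proof -
    define \<chi>R where "\<chi>R x = complex_of_real (if m x \<le> real R then 1 else 0)" for x
    have [measurable]: "\<chi>R \<in> borel_measurable borel" unfolding \<chi>R_def by measurable
    define h where "h t x = \<chi>R x * (prop0 (m x) (T - t) * U t x + prop1 (m x) (T - t) * V t x)" for t x
    define E where "E t x = \<chi>R x * (W t x + m x * U t x + 2 * damp (m x) * V t x)" for t x
    have hm [measurable]: "h t \<in> borel_measurable borel" and Em [measurable]: "E t \<in> borel_measurable borel"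
      if "0 \<le> t" for t
      using that unfolding h_def E_def by measurable
    have hS: "h t \<in> L2_space" if t: "0 \<le> t" "t \<le> T" for t
    proof (rule L2_bounded_byD(1))
      show "L2_bounded_by (\<lambda>x. (1 + T) * cmod (U t x) + (1 + T) * cmod (V t x))
          ((1 + T) * L2_norm (U t) + (1 + T) * L2_norm (V t))"
        using US[OF t(1)] VS[OF t(1)] T
        by (intro L2_bounded_by_add L2_bounded_by_mult L2_bounded_by_cmod) auto
      show "AE x in lborel. cmod (h t x) \<le> (1 + T) * cmod (U t x) + (1 + T) * cmod (V t x)"
        using q
      proof eventually_elim
        fix x assume "freq2 (m x) \<noteq> 0"
        note pb = prop_bounds[OF m0 this, of "T - t"]
        have "cmod (prop0 (m x) (T - t) * U t x + prop1 (m x) (T - t) * V t x)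
            \<le> (1 + T) * cmod (U t x) + (1 + T) * cmod (V t x)"
          using pb t by (intro norm_triangle_le add_mono) (auto simp: norm_mult intro!: mult_right_mono)
        moreover have "cmod (\<chi>R x) \<le> 1" by (simp add: \<chi>R_def)
        ultimately show "cmod (h t x) \<le> (1 + T) * cmod (U t x) + (1 + T) * cmod (V t x)"
          unfolding h_def norm_mult[of "\<chi>R x"] by (meson mult_left_le_one_le norm_ge_zero order_trans)
      qed
    qed (use hm[OF t(1)] in simp)
    have ES: "E t \<in> L2_space" if t: "0 \<le> t" for t
    proof (rule L2_bounded_byD(1))
      show "L2_bounded_by (\<lambda>x. cmod (W t x) + real R * cmod (U t x) + 1 * cmod (V t x))
          (L2_norm (W t) + real R * L2_norm (U t) + 1 * L2_norm (V t))"
        using US[OF t(1)] VS[OF t(1)] WS[OF t] T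
        by (intro L2_bounded_by_add L2_bounded_by_mult L2_bounded_by_cmod) auto
      show "AE x in lborel. cmod (E t x) \<le> cmod (W t x) + real R * cmod (U t x) + 1 * cmod (V t x)"
      proof (rule AE_I2)
        fix x
        show "cmod (E t x) \<le> cmod (W t x) + real R * cmod (U t x) + 1 * cmod (V t x)"
        proof (cases "m x \<le> real R")
          case True
          have "cmod (W t x + m x * U t x + 2 * damp (m x) * V t x)
              \<le> cmod (W t x) + real R * cmod (U t x) + 1 * cmod (V t x)"
            using True m0[of x] damp_bounds[OF m0, of x]
            by (intro norm_triangle_le add_mono) (auto simp: norm_mult intro!: mult_right_mono mult_left_le_one_le)
          then show ?thesis using True by (simp add: E_def \<chi>R_def)
        qed (simp add: E_def \<chi>R_def)
      qed
    qed (use Em[OF t(1)] in simp)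
    have E0: "L2_norm (E t) = 0" if "0 < t" for t
      by (rule L2_norm_eq_0I) (use eq[OF that] in \<open>auto simp: E_def\<close>)
    define C where "C = (2 * real R + 2) * (1 + T)"
    have C0: "0 \<le> C" using T by (simp add: C_def)
    define QU where "QU t s = L2_norm (\<lambda>x. (U s x - U t x) / complex_of_real (s - t) - V t x)" for t s
    define QV where "QV t s = L2_norm (\<lambda>x. (V s x - V t x) / complex_of_real (s - t) - W t x)" for t s
    define K where "K t = C * L2_norm (U t) + C * (2 * L2_norm (V t)) + C * L2_norm (W t)" for t
    define e where "e t s = (1 + T) * QU t s + (1 + T) * QV t s + (1 + T) * L2_norm (E t) + \<bar>s - t\<bar> * K t" for t s
    have inc: "L2_norm (\<lambda>x. h s x - h t x) \<le> \<bar>s - t\<bar> * e t s"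
      if s: "0 \<le> s" "s \<le> T" and t: "0 \<le> t" "t \<le> T" and st: "s \<noteq> t" for s t
    proof (rule L2_bounded_byD(2))
      have D1: "(\<lambda>x. (U s x - U t x) / complex_of_real (s - t) - V t x) \<in> L2_space"
        unfolding divide_inverse mult.commute[of _ "inverse _"]
        by (intro L2_space_diff L2_space_cmult US VS s t)
      have D2: "(\<lambda>x. (V s x - V t x) / complex_of_real (s - t) - W t x) \<in> L2_space"
        unfolding divide_inverse mult.commute[of _ "inverse _"]
        by (intro L2_space_diff L2_space_cmult WS VS s t)
      show "L2_bounded_by (\<lambda>x. \<bar>s - t\<bar> * ((1 + T) * cmod ((U s x - U t x) / complex_of_real (s - t) - V t x)
        + (1 + T) * cmod ((V s x - V t x) / complex_of_real (s - t) - W t x)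
        + (1 + T) * cmod (E t x)
        + \<bar>s - t\<bar> * (C * cmod (U t x) + C * (2 * cmod (V t x)) + C * cmod (W t x)))) (\<bar>s - t\<bar> * e t s)"
        unfolding e_def QU_def QV_def K_def
        using T C0 by (intro L2_bounded_by_add L2_bounded_by_mult L2_bounded_by_cmod D1 D2 ES US VS WS t) auto
      show "AE x in lborel. cmod (h s x - h t x) \<le> \<bar>s - t\<bar> * ((1 + T) * cmod ((U s x - U t x) / complex_of_real (s - t) - V t x)
        + (1 + T) * cmod ((V s x - V t x) / complex_of_real (s - t) - W t x)
        + (1 + T) * cmod (E t x)
        + \<bar>s - t\<bar> * (C * cmod (U t x) + C * (2 * cmod (V t x)) + C * cmod (W t x)))"
        using q
      proof eventually_elim
        fix x assume qx: "freq2 (m x) \<noteq> 0"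
        show "cmod (h s x - h t x) \<le> \<bar>s - t\<bar> * ((1 + T) * cmod ((U s x - U t x) / complex_of_real (s - t) - V t x)
        + (1 + T) * cmod ((V s x - V t x) / complex_of_real (s - t) - W t x)
        + (1 + T) * cmod (E t x)
        + \<bar>s - t\<bar> * (C * cmod (U t x) + C * (2 * cmod (V t x)) + C * cmod (W t x)))"
        proof (cases "m x \<le> real R")
          case True
          then have "\<chi>R x = 1" by (simp add: \<chi>R_def)
          then show ?thesis
            using prop_pointwise_increment[OF m0 True qx s t st] unfolding h_def E_def C_def by simp
        next
          case False
          then have "\<chi>R x = 0" by (simp add: \<chi>R_def)
          then show ?thesis using T C0 by (simp add: h_def E_def)
        qed
      qed
    qed (use hm[OF s(1)] hm[OF t(1)] in simp)
    have el: "((\<lambda>s. e t s) \<longlongrightarrow> (1 + T) * L2_norm (E t)) (at t within {0..T})" if t: "0 \<le> t" for t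
    proof -
      have "((\<lambda>s. QU t s) \<longlongrightarrow> 0) (at t within {0..})" "((\<lambda>s. QV t s) \<longlongrightarrow> 0) (at t within {0..})"
        using UV VW t by (auto simp: curve_has_derivative_def QU_def QV_def)
      then have l: "((\<lambda>s. QU t s) \<longlongrightarrow> 0) (at t within {0..T})" "((\<lambda>s. QV t s) \<longlongrightarrow> 0) (at t within {0..T})"
        by (auto elim!: tendsto_within_subset)
      have "((\<lambda>s. e t s) \<longlongrightarrow> (1 + T) * 0 + (1 + T) * 0 + (1 + T) * L2_norm (E t) + \<bar>t - t\<bar> * K t) (at t within {0..T})"
        unfolding e_def by (intro tendsto_intros l)
      then show ?thesis by simp
    qed
    \<comment> \<open>Testing the curve against its own total increment reduces the claim to a
      scalar function: \<open>f T - f 0\<close> is the squared norm of \<open>g\<close>, so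
      constancy of \<open>f\<close> forces \<open>g\<close> to vanish.\<close>
    define g where "g x = h T x - h 0 x" for x
    have gS: "g \<in> L2_space" unfolding g_def using T by (intro L2_space_diff hS) auto
    define f where "f t = Re (LINT x|lborel. h t x * cnj (g x))" for t
    have diff: "(LINT x|lborel. h s x * cnj (g x)) - (LINT x|lborel. h t x * cnj (g x))
        = (LINT x|lborel. (h s x - h t x) * cnj (g x))"
      if s: "0 \<le> s" "s \<le> T" and t: "0 \<le> t" "t \<le> T" for s t
      unfolding left_diff_distrib
      by (rule Bochner_Integration.integral_diff[symmetric]; intro L2_mult(1) hS L2_space_cnj gS s t)
    have fi: "\<bar>f s - f t\<bar> \<le> \<bar>s - t\<bar> * (e t s * L2_norm g)"
      if s: "0 \<le> s" "s \<le> T" and t: "0 \<le> t" "t \<le> T" and st: "s \<noteq> t" for s t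
    proof -
      have "\<bar>f s - f t\<bar> \<le> cmod (LINT x|lborel. (h s x - h t x) * cnj (g x))"
        unfolding f_def diff[OF s t, symmetric] using abs_Re_le_cmod by (metis minus_complex.simps(1))
      also have "\<dots> \<le> L2_norm (\<lambda>x. h s x - h t x) * L2_norm g"
        using L2_mult(3)[OF L2_space_diff[OF hS[OF s] hS[OF t]] L2_space_cnj[OF gS]] by simp
      also have "\<dots> \<le> (\<bar>s - t\<bar> * e t s) * L2_norm g"
        by (intro mult_right_mono inc s t st) simp
      finally show ?thesis by (simp add: mult.assoc)
    qed
    have ev: "\<forall>\<^sub>F s in at t within {0..T}. 0 \<le> s \<and> s \<le> T \<and> s \<noteq> t" for t
      by (auto simp: eventually_at_filter)
    \<comment> \<open>The equation holds for positive times only, so \<open>E 0\<close> need not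
      vanish. At the end points continuity is enough; the derivative is computed in the
      interior.\<close>
    have "continuous_on {0..T} f"
      unfolding continuous_on_def
    proof
      fix t assume t: "t \<in> {0..T}"
      have "((\<lambda>s. \<bar>s - t\<bar> * (e t s * L2_norm g)) \<longlongrightarrow> \<bar>t - t\<bar> * ((1 + T) * L2_norm (E t) * L2_norm g)) (at t within {0..T})"
        using t by (intro tendsto_intros el) auto
      then have "((\<lambda>s. \<bar>s - t\<bar> * (e t s * L2_norm g)) \<longlongrightarrow> 0) (at t within {0..T})" by simp
      then have "((\<lambda>s. f s - f t) \<longlongrightarrow> 0) (at t within {0..T})"
        by (rule Lim_null_comparison[rotated])
          (use ev[of t] in \<open>eventually_elim, use fi t in auto\<close>)
      then show "(f \<longlongrightarrow> f t) (at t within {0..T})" by (simp add: LIM_zero_iff)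
    qed
    moreover have "(f has_real_derivative 0) (at t)" if t: "0 < t" "t < T" for t
    proof -
      have "((\<lambda>s. e t s * L2_norm g) \<longlongrightarrow> (1 + T) * L2_norm (E t) * L2_norm g) (at t within {0..T})"
        using t by (intro tendsto_intros el) auto
      then have "((\<lambda>s. e t s * L2_norm g) \<longlongrightarrow> 0) (at t within {0..T})" using E0[OF t(1)] by simp
      then have "((\<lambda>s. (f s - f t) / (s - t)) \<longlongrightarrow> 0) (at t within {0..T})"
      proof (rule Lim_null_comparison[rotated])
        show "\<forall>\<^sub>F s in at t within {0..T}. norm ((f s - f t) / (s - t)) \<le> e t s * L2_norm g"
          using ev[of t]
        proof eventually_elim
          fix s assume s: "0 \<le> s \<and> s \<le> T \<and> s \<noteq> t"
          then have "\<bar>f s - f t\<bar> \<le> \<bar>s - t\<bar> * (e t s * L2_norm g)" using t by (intro fi) auto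
          then show "norm ((f s - f t) / (s - t)) \<le> e t s * L2_norm g"
            using s by (simp add: abs_divide field_simps)
        qed
      qed
      then have "(f has_real_derivative 0) (at t within {0..T})" by (simp add: has_field_derivative_iff)
      then show ?thesis using t by (simp add: at_within_Icc_at)
    qed
    ultimately have "f T = f 0" using DERIV_isconst_end[OF T] by blast
    moreover have "f T - f 0 = (L2_norm g)\<^sup>2"
    proof -
      have "f T - f 0 = Re (LINT x|lborel. g x * cnj (g x))"
        unfolding f_def using diff[of T 0] T
        by (simp only: g_def[symmetric] minus_complex.simps(1)[symmetric])
      also have "(\<lambda>x. g x * cnj (g x)) = (\<lambda>x. complex_of_real ((cmod (g x))\<^sup>2))"
        by (simp only: complex_norm_square)
      finally show ?thesis by (simp only: integral_complex_of_real Re_complex_of_real L2_norm_power2)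
    qed
    ultimately have "L2_norm g = 0" by simp
    from L2_norm_eq_0D[OF gS this] show ?thesis
    proof eventually_elim
      fix x assume "g x = 0"
      then show "m x \<le> real R \<longrightarrow> U T x = prop0 (m x) T * U 0 x + prop1 (m x) T * V 0 x"
        by (auto simp: g_def h_def \<chi>R_def)
    qed
  qed
  \<comment> \<open>The exceptional null set depends on \<open>R\<close>; with \<open>R\<close>
    ranging over the naturals the union is still null, and every \<open>m x\<close> lies below some
    \<open>R\<close>.\<close>
  then have "AE x in lborel. \<forall>R::nat. m x \<le> real R \<longrightarrow> U T x = prop0 (m x) T * U 0 x + prop1 (m x) T * V 0 x"
    unfolding AE_all_countable by blast
  then show ?thesis by eventually_elim (use real_arch_simple in blast)
qed

section \<open>The equation on the Fourier side\<close>

lemma Lsym_nonneg [simp]: "0 \<le> Lsym x"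
  by (simp add: Lsym_def)

lemma Lsym_borel [measurable]: "Lsym \<in> borel_measurable borel"
  unfolding Lsym_def by measurable

lemma fourier_cong_AE:
  assumes "f \<in> L2_space" "g \<in> L2_space" "AE x in lborel. f x = g x"
  shows "AE \<xi> in lborel. fourier f \<xi> = fourier g \<xi>"
  by (rule is_fourier_unique[OF fourier_is_fourier fourier_is_fourier]) (use assms in auto)

lemma fourier_add:
  assumes "f \<in> L2_space" "g \<in> L2_space"
  shows "AE \<xi> in lborel. fourier (\<lambda>x. f x + g x) \<xi> = fourier f \<xi> + fourier g \<xi>"
  by (intro fourier_AE_eqI is_fourier_add fourier_is_fourier assms)

lemma fourier_diff:
  assumes "f \<in> L2_space" "g \<in> L2_space"
  shows "AE \<xi> in lborel. fourier (\<lambda>x. f x - g x) \<xi> = fourier f \<xi> - fourier g \<xi>"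
  by (intro fourier_AE_eqI is_fourier_diff fourier_is_fourier assms)

lemma fourier_cmult:
  assumes "f \<in> L2_space"
  shows "AE \<xi> in lborel. fourier (\<lambda>x. c * f x) \<xi> = c * fourier f \<xi>"
  by (intro fourier_AE_eqI is_fourier_cmult fourier_is_fourier assms)

lemma fourier_norm:
  fixes f :: "'a::euclidean_space \<Rightarrow> complex"
  shows "f \<in> L2_space \<Longrightarrow> L2_norm (fourier f) = fourier_scale TYPE('a) * L2_norm f"
  using is_fourier_norm[OF fourier_is_fourier] .

lemma inv_fourier:
  assumes g: "g \<in> L2_space"
  shows "inv_fourier g \<in> L2_space" "AE \<xi> in lborel. fourier (inv_fourier g) \<xi> = g \<xi>"
proof -
  obtain f where f: "is_fourier f g" using is_fourier_surj[OF g] by blast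
  have "\<exists>f. f \<in> L2_space \<and> (AE \<xi> in lborel. fourier f \<xi> = g \<xi>)"
    by (intro exI[of _ f] conjI is_fourier_L2(1)[OF f] fourier_AE_eqI[OF f])
  from someI_ex[OF this] show "inv_fourier g \<in> L2_space" "AE \<xi> in lborel. fourier (inv_fourier g) \<xi> = g \<xi>"
    unfolding inv_fourier_def by auto
qed

lemma fourier_quotient:
  fixes c :: complex
  assumes f: "f \<in> L2_space" and g: "g \<in> L2_space" and h: "h \<in> L2_space"
  defines "D \<equiv> \<lambda>x. (f x - g x) / c - h x"
  shows "D \<in> L2_space" "AE \<xi> in lborel. fourier D \<xi> = (fourier f \<xi> - fourier g \<xi>) / c - fourier h \<xi>"
proof -
  have D: "D = (\<lambda>x. inverse c * (f x - g x) - h x)" unfolding D_def by (simp add: field_simps)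
  have q: "is_fourier D (\<lambda>\<xi>. inverse c * (fourier f \<xi> - fourier g \<xi>) - fourier h \<xi>)"
    unfolding D by (intro is_fourier_diff is_fourier_cmult fourier_is_fourier f g h)
  then show "D \<in> L2_space" by (rule is_fourier_L2(1))
  from fourier_AE_eqI[OF q] show "AE \<xi> in lborel. fourier D \<xi> = (fourier f \<xi> - fourier g \<xi>) / c - fourier h \<xi>"
    by (simp add: field_simps)
qed

section \<open>Transforms of differentiable curves\<close>

lemma fourier_curve_derivative_L2:
  fixes u v :: "real \<Rightarrow> 'a::euclidean_space \<Rightarrow> complex"
  assumes "curve_has_derivative L2_space L2_norm u v"
  shows "curve_has_derivative L2_space L2_norm (\<lambda>t. fourier (u t)) (\<lambda>t. fourier (v t))"
  unfolding curve_has_derivative_def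
proof (intro conjI allI impI)
  fix t :: real assume t: "0 \<le> t"
  have us: "u s \<in> L2_space" "v s \<in> L2_space" if "0 \<le> s" for s
    using assms that by (auto simp: curve_has_derivative_def)
  show "fourier (u t) \<in> L2_space" "fourier (v t) \<in> L2_space" using us[OF t] by (auto intro: fourier_L2)
  let ?D = "\<lambda>s x. (u s x - u t x) / complex_of_real (s - t) - v t x"
  have "((\<lambda>s. fourier_scale TYPE('a) * L2_norm (?D s)) \<longlongrightarrow> 0) (at t within {0..})"
    using assms t by (intro tendsto_mult_right_zero) (auto simp: curve_has_derivative_def)
  moreover have "fourier_scale TYPE('a) * L2_norm (?D s)
     = L2_norm (\<lambda>x. (fourier (u s) x - fourier (u t) x) / complex_of_real (s - t) - fourier (v t) x)"
    if s: "0 \<le> s" for s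
  proof -
    note D = fourier_quotient[OF us(1)[OF s] us(1)[OF t] us(2)[OF t], of "complex_of_real (s - t)"]
    have [measurable]: "fourier (u s) \<in> borel_measurable borel" "fourier (u t) \<in> borel_measurable borel"
       "fourier (v t) \<in> borel_measurable borel" "fourier (?D s) \<in> borel_measurable borel"
      using us[OF s] us[OF t] D(1) by (auto intro: fourier_L2)
    show ?thesis unfolding fourier_norm[OF D(1), symmetric]
      by (rule L2_norm_cong_AE[OF _ _ D(2)]) measurable
  qed
  then have "\<forall>\<^sub>F s in at t within {0..}. fourier_scale TYPE('a) * L2_norm (?D s)
     = L2_norm (\<lambda>x. (fourier (u s) x - fourier (u t) x) / complex_of_real (s - t) - fourier (v t) x)"
    by (auto simp: eventually_at_filter)
  ultimately show "((\<lambda>s. L2_norm (\<lambda>x. (fourier (u s) x - fourier (u t) x) / complex_of_real (s - t) - fourier (v t) x))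
      \<longlongrightarrow> 0) (at t within {0..})"
    by (rule Lim_transform_eventually)
qed

text \<open>The weight is at least 1, so the Y norm of the difference quotient dominates the L2 norm
  of its transform. As the integral of a non-integrable function is 0, this comparison requires the
  weighted square to be integrable, which takes up most of the proof.\<close>

lemma fourier_curve_derivative_Y1:
  fixes u v :: "real \<Rightarrow> 'a::euclidean_space \<Rightarrow> complex"
  assumes "curve_has_derivative (Y_space 1) (Y_norm 1) u v"
  shows "curve_has_derivative L2_space L2_norm (\<lambda>t. fourier (u t)) (\<lambda>t. fourier (v t))"
  unfolding curve_has_derivative_def
proof (intro conjI allI impI)
  fix t :: real assume t: "0 \<le> t"
  have Y: "u s \<in> Y_space 1" "v s \<in> Y_space 1" if "0 \<le> s" for s
    using assms that by (auto simp: curve_has_derivative_def)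
  then have us: "u s \<in> L2_space" "v s \<in> L2_space" if "0 \<le> s" for s
    using that by (auto simp: Y_space_def)
  have iY: "integrable lborel (\<lambda>\<xi>. (1 + Lsym \<xi>) * (cmod (fourier f \<xi>))\<^sup>2)" if "f \<in> Y_space 1" for f :: "'a \<Rightarrow> complex"
    using that by (simp add: Y_space_def)
  show "fourier (u t) \<in> L2_space" "fourier (v t) \<in> L2_space" using us[OF t] by (auto intro: fourier_L2)
  let ?D = "\<lambda>s x. (u s x - u t x) / complex_of_real (s - t) - v t x"
  let ?F = "\<lambda>s x. (fourier (u s) x - fourier (u t) x) / complex_of_real (s - t) - fourier (v t) x"
  have "((\<lambda>s. Y_norm 1 (?D s)) \<longlongrightarrow> 0) (at t within {0..})"
    using assms t by (auto simp: curve_has_derivative_def)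
  moreover have "L2_norm (?F s) \<le> Y_norm 1 (?D s)" if s: "0 \<le> s" for s
  proof -
    note D = fourier_quotient[OF us(1)[OF s] us(1)[OF t] us(2)[OF t], of "complex_of_real (s - t)"]
    have [measurable]: "fourier (u s) \<in> borel_measurable borel" "fourier (u t) \<in> borel_measurable borel"
       "fourier (v t) \<in> borel_measurable borel" "fourier (?D s) \<in> borel_measurable borel"
      using us[OF s] us[OF t] D(1) by (auto intro: fourier_L2)
    let ?c = "inverse (complex_of_real (s - t))"
    \<comment> \<open>The coefficients 4, 4 and 2 come from applying
      \<open>cmod_add_power2_le\<close> twice to a sum of three terms.\<close>
    have "integrable lborel (\<lambda>\<xi>. 4 * (cmod ?c)\<^sup>2 * ((1 + Lsym \<xi>) * (cmod (fourier (u s) \<xi>))\<^sup>2)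
      + 4 * (cmod ?c)\<^sup>2 * ((1 + Lsym \<xi>) * (cmod (fourier (u t) \<xi>))\<^sup>2) + 2 * ((1 + Lsym \<xi>) * (cmod (fourier (v t) \<xi>))\<^sup>2))"
      by (intro Bochner_Integration.integrable_add integrable_mult_right iY Y s t)
    then have i: "integrable lborel (\<lambda>\<xi>. (1 + Lsym \<xi>) * (cmod (?F s \<xi>))\<^sup>2)"
    proof (rule Bochner_Integration.integrable_bound)
      show "AE \<xi> in lborel. norm ((1 + Lsym \<xi>) * (cmod (?F s \<xi>))\<^sup>2) \<le> norm (4 * (cmod ?c)\<^sup>2 * ((1 + Lsym \<xi>) * (cmod (fourier (u s) \<xi>))\<^sup>2)
      + 4 * (cmod ?c)\<^sup>2 * ((1 + Lsym \<xi>) * (cmod (fourier (u t) \<xi>))\<^sup>2) + 2 * ((1 + Lsym \<xi>) * (cmod (fourier (v t) \<xi>))\<^sup>2))"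
      proof (rule AE_I2)
        fix \<xi>
        let ?a = "fourier (u s) \<xi>" and ?b = "fourier (u t) \<xi>" and ?d = "fourier (v t) \<xi>"
        have "?F s \<xi> = (?c * ?a + ?c * (- ?b)) + (- ?d)" by (simp add: divide_inverse algebra_simps)
        then have "(cmod (?F s \<xi>))\<^sup>2 \<le> 2 * (cmod (?c * ?a + ?c * (- ?b)))\<^sup>2 + 2 * (cmod (- ?d))\<^sup>2"
          using cmod_add_power2_le[of "?c * ?a + ?c * (- ?b)" "- ?d"] by (simp only:)
        moreover have "(cmod (?c * ?a + ?c * (- ?b)))\<^sup>2 \<le> 2 * (cmod (?c * ?a))\<^sup>2 + 2 * (cmod (?c * (- ?b)))\<^sup>2"
          by (rule cmod_add_power2_le)
        ultimately have "(cmod (?F s \<xi>))\<^sup>2 \<le> 4 * (cmod ?c)\<^sup>2 * (cmod ?a)\<^sup>2 + 4 * (cmod ?c)\<^sup>2 * (cmod ?b)\<^sup>2 + 2 * (cmod ?d)\<^sup>2"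
          unfolding norm_mult norm_minus_cancel power_mult_distrib by linarith
        then have "(1 + Lsym \<xi>) * (cmod (?F s \<xi>))\<^sup>2 \<le> (1 + Lsym \<xi>) * (4 * (cmod ?c)\<^sup>2 * (cmod ?a)\<^sup>2 + 4 * (cmod ?c)\<^sup>2 * (cmod ?b)\<^sup>2 + 2 * (cmod ?d)\<^sup>2)"
          by (intro mult_left_mono) auto
        also have "\<dots> = 4 * (cmod ?c)\<^sup>2 * ((1 + Lsym \<xi>) * (cmod ?a)\<^sup>2) + 4 * (cmod ?c)\<^sup>2 * ((1 + Lsym \<xi>) * (cmod ?b)\<^sup>2) + 2 * ((1 + Lsym \<xi>) * (cmod ?d)\<^sup>2)"
          by (simp only: distrib_left mult_ac)
        finally have *: "(1 + Lsym \<xi>) * (cmod (?F s \<xi>))\<^sup>2 \<le> 4 * (cmod ?c)\<^sup>2 * ((1 + Lsym \<xi>) * (cmod ?a)\<^sup>2) + 4 * (cmod ?c)\<^sup>2 * ((1 + Lsym \<xi>) * (cmod ?b)\<^sup>2) + 2 * ((1 + Lsym \<xi>) * (cmod ?d)\<^sup>2)" .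
        have "0 \<le> (1 + Lsym \<xi>) * (cmod (?F s \<xi>))\<^sup>2" by simp
        then show "norm ((1 + Lsym \<xi>) * (cmod (?F s \<xi>))\<^sup>2) \<le> norm (4 * (cmod ?c)\<^sup>2 * ((1 + Lsym \<xi>) * (cmod ?a)\<^sup>2) + 4 * (cmod ?c)\<^sup>2 * ((1 + Lsym \<xi>) * (cmod ?b)\<^sup>2) + 2 * ((1 + Lsym \<xi>) * (cmod ?d)\<^sup>2))"
          using * unfolding real_norm_def by linarith
      qed
    qed measurable
    have "(LINT \<xi>|lborel. (cmod (?F s \<xi>))\<^sup>2) \<le> (LINT \<xi>|lborel. (1 + Lsym \<xi>) * (cmod (?F s \<xi>))\<^sup>2)"
    proof (rule integral_mono)
      show "integrable lborel (\<lambda>\<xi>. (cmod (?F s \<xi>))\<^sup>2)"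
        by (rule Bochner_Integration.integrable_bound[OF i]) (auto simp: mult_le_cancel_right1 intro!: AE_I2)
      show "(cmod (?F s \<xi>))\<^sup>2 \<le> (1 + Lsym \<xi>) * (cmod (?F s \<xi>))\<^sup>2" for \<xi>
        by (simp add: mult_le_cancel_right1)
    qed (rule i)
    also have "\<dots> = (LINT \<xi>|lborel. (1 + Lsym \<xi>) powr 1 * (cmod (fourier (?D s) \<xi>))\<^sup>2)"
    proof (rule integral_cong_AE)
      show "AE \<xi> in lborel. (1 + Lsym \<xi>) * (cmod (?F s \<xi>))\<^sup>2 = (1 + Lsym \<xi>) powr 1 * (cmod (fourier (?D s) \<xi>))\<^sup>2"
        using D(2) by eventually_elim simp
    qed measurable
    finally show ?thesis unfolding L2_norm_def Y_norm_def by simp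
  qed
  then have "\<forall>\<^sub>F s in at t within {0..}. norm (L2_norm (?F s)) \<le> Y_norm 1 (?D s)"
    by (auto simp: eventually_at_filter)
  ultimately show "((\<lambda>s. L2_norm (?F s)) \<longlongrightarrow> 0) (at t within {0..})"
    by (rule Lim_null_comparison[rotated])
qed

section \<open>The operators of the equation as Fourier multipliers\<close>

lemma L_op_fourier:
  assumes "f \<in> L_dom"
  shows "L_op f \<in> L2_space" "AE \<xi> in lborel. fourier (L_op f) \<xi> = Lsym \<xi> * fourier f \<xi>"
  using assms inv_fourier unfolding L_op_def L_dom_def by auto

lemma Y_space_2_L_dom: "f \<in> Y_space 2 \<Longrightarrow> f \<in> L_dom"
proof -
  assume f: "f \<in> Y_space 2"
  then have fS: "f \<in> L2_space" and i: "integrable lborel (\<lambda>\<xi>. (1 + Lsym \<xi>) powr 2 * (cmod (fourier f \<xi>))\<^sup>2)"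
    by (auto simp: Y_space_def)
  have [measurable]: "fourier f \<in> borel_measurable borel" using fourier_L2[OF fS] by auto
  have p: "(1 + Lsym \<xi>) powr 2 = (1 + Lsym \<xi>)\<^sup>2" for \<xi> :: 'a
    by (simp add: add_nonneg_pos less_le add_nonneg_eq_0_iff)
  have "integrable lborel (\<lambda>\<xi>. (cmod (Lsym \<xi> * fourier f \<xi>))\<^sup>2)"
    by (rule Bochner_Integration.integrable_bound[OF i])
      (auto simp: p norm_mult power_mult_distrib intro!: AE_I2 mult_right_mono power_mono)
  then show "f \<in> L_dom" using fS by (simp add: L_dom_def L2_space_def)
qed

text \<open>The multiplier \<open>1 / (1 + Lsym \<xi>)\<close> supplies one solution of
  \<open>f + L_op f = g\<close>, so the choice is meaningful. Transforming the equation for the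
  chosen function and dividing by \<open>1 + Lsym \<xi>\<close> then determines its
  transform.\<close>

lemma I_plus_L_inv_fourier:
  assumes g: "g \<in> L2_space"
  shows "I_plus_L_inv g \<in> L2_space"
    "AE \<xi> in lborel. fourier (I_plus_L_inv g) \<xi> = fourier g \<xi> / (1 + Lsym \<xi>)"
proof -
  have n1: "1 + complex_of_real (Lsym \<xi>) \<noteq> 0" for \<xi> :: 'a
    by (metis Lsym_nonneg add_nonneg_pos less_irrefl of_real_1 of_real_add of_real_eq_0_iff add.commute zero_less_one)
  have Fg: "fourier g \<in> L2_space" by (rule fourier_L2[OF g])
  then have [measurable]: "fourier g \<in> borel_measurable borel" by auto
  let ?k = "\<lambda>\<xi>. fourier g \<xi> / (1 + Lsym \<xi>)"
  have kn: "cmod (?k \<xi>) = cmod (fourier g \<xi>) / (1 + Lsym \<xi>)" for \<xi>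
  proof -
    have "1 + complex_of_real (Lsym \<xi>) = complex_of_real (1 + Lsym \<xi>)" by simp
    then show ?thesis unfolding norm_divide by (simp only: norm_of_real) simp
  qed
  have k: "?k \<in> L2_space"
  proof (rule L2_dominated(1)[OF _ Fg, of _ 1])
    have "cmod z / (1 + Lsym \<xi>) \<le> 1 * cmod z" for z and \<xi> :: 'a
      using mult_nonneg_nonneg[OF norm_ge_zero[of z] Lsym_nonneg[of \<xi>]]
      by (simp add: divide_le_eq algebra_simps add_pos_nonneg)
    then show "AE \<xi> in lborel. cmod (?k \<xi>) \<le> 1 * cmod (fourier g \<xi>)"
      unfolding kn by (intro AE_I2)
  qed auto
  define f where "f = inv_fourier ?k"
  have f: "f \<in> L2_space" "AE \<xi> in lborel. fourier f \<xi> = ?k \<xi>"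
    unfolding f_def by (rule inv_fourier[OF k])+
  then have [measurable]: "fourier f \<in> borel_measurable borel" using fourier_L2 by auto
  have "(\<lambda>\<xi>. Lsym \<xi> * fourier f \<xi>) \<in> L2_space"
  proof (rule L2_dominated(1)[OF _ Fg, of _ 1])
    show "AE \<xi> in lborel. cmod (Lsym \<xi> * fourier f \<xi>) \<le> 1 * cmod (fourier g \<xi>)"
      using f(2) 
    proof eventually_elim
      fix \<xi> assume e: "fourier f \<xi> = ?k \<xi>"
      have "cmod (Lsym \<xi> * ?k \<xi>) = (Lsym \<xi> / (1 + Lsym \<xi>)) * cmod (fourier g \<xi>)"
        unfolding norm_mult kn by simp
      also have "Lsym \<xi> / (1 + Lsym \<xi>) \<le> 1" by (subst divide_le_eq_1_pos) (auto intro: add_pos_nonneg)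
      then have "(Lsym \<xi> / (1 + Lsym \<xi>)) * cmod (fourier g \<xi>) \<le> 1 * cmod (fourier g \<xi>)"
        by (rule mult_right_mono) simp
      finally show "cmod (Lsym \<xi> * fourier f \<xi>) \<le> 1 * cmod (fourier g \<xi>)" unfolding e .
    qed
  qed auto
  then have fd: "f \<in> L_dom" using f(1) by (simp add: L_dom_def)
  note Lf = L_op_fourier[OF fd]
  have sum: "AE \<xi> in lborel. fourier (\<lambda>x. f x + L_op f x) \<xi> = (1 + Lsym \<xi>) * fourier f \<xi>" if fd: "f \<in> L_dom" for f :: "'a \<Rightarrow> complex"
  proof -
    have "f \<in> L2_space" using fd by (simp add: L_dom_def)
    from fourier_add[OF this L_op_fourier(1)[OF fd]] L_op_fourier(2)[OF fd]
    show ?thesis by eventually_elim (simp add: algebra_simps)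
  qed
  have "AE \<xi> in lborel. fourier (\<lambda>x. f x + L_op f x) \<xi> = fourier g \<xi>"
    using sum[OF fd] f(2) by eventually_elim (use n1 in simp)
  then have "AE x in lborel. f x + L_op f x = g x"
    by (rule is_fourier_inj[OF fourier_is_fourier fourier_is_fourier[OF g], rotated])
      (intro L2_space_add f(1) Lf(1))
  then have "\<exists>f. f \<in> L_dom \<and> (AE x in lborel. f x + L_op f x = g x)" using fd by blast
  from someI_ex[OF this] have I: "I_plus_L_inv g \<in> L_dom" "AE x in lborel. I_plus_L_inv g x + L_op (I_plus_L_inv g) x = g x"
    unfolding I_plus_L_inv_def by auto
  then show IS: "I_plus_L_inv g \<in> L2_space" by (simp add: L_dom_def)
  have "AE \<xi> in lborel. fourier (\<lambda>x. I_plus_L_inv g x + L_op (I_plus_L_inv g) x) \<xi> = fourier g \<xi>"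
    by (rule fourier_cong_AE[OF _ g I(2)]) (intro L2_space_add IS L_op_fourier(1)[OF I(1)])
  with sum[OF I(1)] show "AE \<xi> in lborel. fourier (I_plus_L_inv g) \<xi> = fourier g \<xi> / (1 + Lsym \<xi>)"
    by eventually_elim (use n1 in \<open>simp add: field_simps\<close>)
qed

lemma freq2_Lsym_nonzero: "AE \<xi> in (lborel :: 'a::euclidean_space measure). freq2 (Lsym \<xi>) \<noteq> 0"
proof (cases "\<exists>\<xi>0 :: 'a. freq2 (Lsym \<xi>0) = 0")
  case True
  then obtain \<xi>0 :: 'a where x0: "freq2 (Lsym \<xi>0) = 0" by blast
  \<comment> \<open>As \<open>m\<close> grows, \<open>damp m\<close> shrinks; so
    \<open>freq2\<close> is strictly increasing and all its zeros share one value of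
    \<open>Lsym\<close>, hence one norm.\<close>
  have mono: "freq2 m < freq2 m'" if "0 \<le> m" "m < m'" for m m'
  proof -
    have "damp m' \<le> damp m" unfolding damp_def using that by (intro divide_left_mono) auto
    then have "(damp m')\<^sup>2 \<le> (damp m)\<^sup>2" using that damp_bounds(1)[of m'] by (intro power_mono) auto
    then show ?thesis using that by (simp add: freq2_def)
  qed
  have "norm \<xi> = norm \<xi>0" if "freq2 (Lsym \<xi>) = 0" for \<xi> :: 'a
  proof -
    have "Lsym \<xi> = Lsym \<xi>0"
      using mono[of "Lsym \<xi>" "Lsym \<xi>0"] mono[of "Lsym \<xi>0" "Lsym \<xi>"] that x0
      by (metis Lsym_nonneg less_irrefl linorder_neqE_linordered_idom)
    then have "1 + (norm \<xi>)\<^sup>2 = 1 + (norm \<xi>0)\<^sup>2"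
      unfolding Lsym_def by (subst (asm) ln_inj_iff) (auto simp: add_pos_nonneg)
    then show ?thesis by (simp add: power2_eq_iff_nonneg)
  qed
  then have sub: "{\<xi>. freq2 (Lsym \<xi>) = 0} \<subseteq> sphere (0::'a) (norm \<xi>0)" by (auto simp: sphere_def dist_norm)
  have "negligible {\<xi>::'a. freq2 (Lsym \<xi>) = 0}"
    by (rule negligible_subset[OF negligible_sphere sub])
  then have "AE \<xi> in lebesgue. \<xi> \<notin> {\<xi>::'a. freq2 (Lsym \<xi>) = 0}"
    by (intro AE_not_in) (simp add: negligible_iff_null_sets)
  then show ?thesis by (simp add: AE_completion_iff)
qed auto

theorem solution_formula:
  fixes u :: "real \<Rightarrow> 'a::euclidean_space \<Rightarrow> complex"
  assumes sol: "is_solution u0 u1 u" and u0: "u0 \<in> L2_space" and u1: "u1 \<in> L2_space" and t: "0 < t"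
  shows "u t \<in> L2_space"
    "AE \<xi> in lborel. fourier (u t) \<xi> = prop0 (Lsym \<xi>) t * fourier u0 \<xi> + prop1 (Lsym \<xi>) t * fourier u1 \<xi>"
proof -
  obtain v w where
    uc: "curve_continuous (Y_space 2) (Y_norm 2) u" and
    uv: "curve_has_derivative (Y_space 1) (Y_norm 1) u v" and
    vw: "curve_has_derivative L2_space L2_norm v w" and
    eq: "\<And>t. 0 < t \<Longrightarrow> AE x in lborel. w t x + L_op (u t) x + I_plus_L_inv (v t) x = 0" and
    i0: "AE x in lborel. u 0 x = u0 x" and i1: "AE x in lborel. v 0 x = u1 x"
    using sol unfolding is_solution_def by auto
  have uY: "u s \<in> Y_space 2" if "0 \<le> s" for s using uc that by (simp add: curve_continuous_def)
  then have uS: "u s \<in> L2_space" if "0 \<le> s" for s using that by (auto simp: Y_space_def)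
  have vS: "v s \<in> L2_space" and wS: "w s \<in> L2_space" if "0 \<le> s" for s
    using vw that by (auto simp: curve_has_derivative_def)
  show "u t \<in> L2_space" using t uS by simp
  have ode: "AE \<xi> in lborel. fourier (w s) \<xi> + Lsym \<xi> * fourier (u s) \<xi> + 2 * damp (Lsym \<xi>) * fourier (v s) \<xi> = 0"
    if s: "0 < s" for s
  proof -
    have s0: "0 \<le> s" using s by simp
    note L = L_op_fourier[OF Y_space_2_L_dom[OF uY[OF s0]]]
    note I = I_plus_L_inv_fourier[OF vS[OF s0]]
    have wL: "(\<lambda>x. w s x + L_op (u s) x) \<in> L2_space" by (intro L2_space_add wS[OF s0] L(1))
    \<comment> \<open>The zero function is written as \<open>0 * u0 x\<close>, so that
      \<open>fourier_cmult\<close> yields that its transform vanishes almost everywhere.\<close>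
    have z: "AE \<xi> in lborel. fourier (\<lambda>x. w s x + L_op (u s) x + I_plus_L_inv (v s) x) \<xi> = fourier (\<lambda>x. 0 * u0 x) \<xi>"
      by (rule fourier_cong_AE) (use eq[OF s] in \<open>auto intro!: L2_space_add wS s0 L(1) I(1)\<close>)
    from z fourier_cmult[OF u0, of 0] fourier_add[OF wL I(1)] fourier_add[OF wS[OF s0] L(1)] L(2) I(2)
    show ?thesis
    proof eventually_elim
      case (elim \<xi>)
      have "2 * damp (Lsym \<xi>) = 1 / (1 + Lsym \<xi>)"
        using Lsym_nonneg[of \<xi>] by (simp add: damp_def divide_simps)
      then have "complex_of_real (2 * damp (Lsym \<xi>)) = complex_of_real (1 / (1 + Lsym \<xi>))" by (simp only:)
      then have "2 * complex_of_real (damp (Lsym \<xi>)) = 1 / (1 + complex_of_real (Lsym \<xi>))" by simp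
      then show ?case using elim by simp
    qed
  qed
  have "AE \<xi> in lborel. fourier (u t) \<xi> = prop0 (Lsym \<xi>) t * fourier (u 0) \<xi> + prop1 (Lsym \<xi>) t * fourier (v 0) \<xi>"
    by (rule propagate[OF Lsym_borel Lsym_nonneg freq2_Lsym_nonzero
          fourier_curve_derivative_Y1[OF uv] fourier_curve_derivative_L2[OF vw] ode t])
  with fourier_cong_AE[OF uS[of 0] u0 i0, simplified] fourier_cong_AE[OF vS[of 0] u1 i1, simplified]
  show "AE \<xi> in lborel. fourier (u t) \<xi> = prop0 (Lsym \<xi>) t * fourier u0 \<xi> + prop1 (Lsym \<xi>) t * fourier u1 \<xi>"
    by eventually_elim simp
qed

section \<open>Decay estimates\<close>

lemma exp_decay_mono:
  fixes t c d :: real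
  shows "c \<le> d \<Longrightarrow> 0 \<le> t \<Longrightarrow> exp (- d * t) \<le> exp (- c * t)"
  by (simp add: mult_right_mono)

text \<open>Since \<open>t / k \<le> exp (t / k)\<close>, a factor \<open>t\<close> can be traded
  for \<open>1 / k\<close> of the exponential rate and the constant \<open>k\<close>.\<close>

lemma mult_exp_le:
  fixes t c d k :: real
  assumes "0 < k" "c + 1 / k \<le> d" "0 \<le> t"
  shows "t * exp (- d * t) \<le> k * exp (- c * t)"
proof -
  have "t / k \<le> exp (t / k)" using exp_ge_add_one_self[of "t / k"] by linarith
  then have "t \<le> k * exp (t / k)" using assms(1) by (simp add: field_simps)
  then have "t * exp (- d * t) \<le> k * exp (t / k) * exp (- d * t)" by (intro mult_right_mono) auto
  also have "\<dots> = k * exp (- (d - 1 / k) * t)" by (simp add: exp_add[symmetric] algebra_simps)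
  also have "\<dots> \<le> k * exp (- c * t)"
    using assms by (intro mult_left_mono exp_decay_mono) auto
  finally show ?thesis .
qed

text \<open>The slow root \<open>damp m - \<mu>\<close> of the overdamped regime dictates a rate
  proportional to \<open>m\<close>. The fraction 1/16 leaves room for absorbing a factor
  \<open>t\<close> through \<open>mult_exp_le\<close> with \<open>k = 16\<close>, and 9 is
  \<open>1 + 16 / 2\<close>, because \<open>damp m \<le> 1 / 2\<close>.\<close>

lemma prop_low:
  assumes m: "0 < m" "m \<le> 1" and q: "freq2 m \<noteq> 0" and t: "0 \<le> t"
  shows "\<bar>prop1 m t\<bar> \<le> 16 * exp (- (m / 16) * t)" "\<bar>prop0 m t\<bar> \<le> 9 * exp (- (m / 16) * t)"
proof -
  let ?q = "freq2 m" and ?a = "damp m" and ?e = "exp (- (m / 16) * t)"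
  have a: "1 / 4 \<le> ?a" "?a \<le> 1 / 2" using m by (auto simp: damp_def field_simps)
  have mono: "exp (- c * t) \<le> ?e" if "m / 16 \<le> c" for c using that t by (rule exp_decay_mono)
  have te: "t * exp (- d * t) \<le> 16 * ?e" if "m / 16 + 1 / 16 \<le> d" for d
    using mult_exp_le[of 16 "m / 16" d t] that t by simp
  have "exp (- ?a * t) * \<bar>osc_c ?q t\<bar> \<le> ?e \<and> exp (- ?a * t) * \<bar>osc_s ?q t\<bar> \<le> 16 * ?e"
  proof (cases "0 < ?q")
    case True
    have c: "\<bar>osc_c ?q t\<bar> \<le> 1" using True by (simp add: osc_c_def)
    have s: "\<bar>osc_s ?q t\<bar> \<le> t"
      using True t abs_sin_x_le_abs_x[of "sqrt ?q * t"] by (simp add: osc_s_def abs_mult field_simps)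
    have "exp (- ?a * t) * \<bar>osc_c ?q t\<bar> \<le> exp (- ?a * t) * 1" by (intro mult_left_mono c) auto
    also have "\<dots> \<le> ?e" using mono[of ?a] a m by simp
    finally have 1: "exp (- ?a * t) * \<bar>osc_c ?q t\<bar> \<le> ?e" .
    have "exp (- ?a * t) * \<bar>osc_s ?q t\<bar> \<le> exp (- ?a * t) * t" by (intro mult_left_mono s) auto
    also have "\<dots> \<le> 16 * ?e" using te[of ?a] a m by (simp add: mult.commute)
    finally show ?thesis using 1 by simp
  next
    case False
    define \<mu> where "\<mu> = sqrt (- ?q)"
    have mu: "0 < \<mu>" using False q by (simp add: \<mu>_def)
    have mu2: "\<mu> * \<mu> = ?a * ?a - m" using False by (simp add: \<mu>_def freq2_def power2_eq_square)
    have mua: "\<mu> \<le> ?a" using m a unfolding \<mu>_def freq2_def by (intro real_le_lsqrt) auto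
    \<comment> \<open>The product of the two decay rates is \<open>m\<close> and the faster one is
      at most 1, so the slower one is at least \<open>m\<close>.\<close>
    have "m = (?a - \<mu>) * (?a + \<mu>)" using mu2 by (simp add: algebra_simps)
    also have "\<dots> \<le> (?a - \<mu>) * 1" using mua a by (intro mult_left_mono) auto
    finally have gap: "m \<le> ?a - \<mu>" by simp
    have cosh: "exp (- ?a * t) * cosh (\<mu> * t) \<le> exp (- (?a - \<mu>) * t)"
      using exp_mult_cosh_le[of "\<mu> * t" "?a * t"] mu t by (simp add: algebra_simps)
    have c: "exp (- ?a * t) * cosh (\<mu> * t) \<le> ?e"
      using cosh mono[of "?a - \<mu>"] gap m by linarith
    \<comment> \<open>For \<open>\<mu>\<close> at least 1/8 dividing by \<open>\<mu>\<close> costs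
      only a factor 8. Below 1/8 the quotient costs a factor \<open>t\<close>, but then the slow
      rate exceeds \<open>1/4 - 1/8\<close>, which covers \<open>m / 16 + 1 / 16\<close> for
      \<open>m \<le> 1\<close>.\<close>
    have s: "exp (- ?a * t) * (sinh (\<mu> * t) / \<mu>) \<le> 16 * ?e"
    proof (cases "1 / 8 \<le> \<mu>")
      case True
      have "sinh (\<mu> * t) / \<mu> \<le> 8 * cosh (\<mu> * t)"
      proof -
        have "sinh (\<mu> * t) \<le> cosh (\<mu> * t)" by (rule sinh_le_cosh_real)
        also have "\<dots> \<le> (8 * \<mu>) * cosh (\<mu> * t)" using True mult_right_mono[of 1 "8 * \<mu>" "cosh (\<mu> * t)"] by simp
        finally show ?thesis using mu by (simp add: field_simps)
      qed
      then have "exp (- ?a * t) * (sinh (\<mu> * t) / \<mu>) \<le> exp (- ?a * t) * (8 * cosh (\<mu> * t))"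
        by (intro mult_left_mono) auto
      then show ?thesis using c exp_gt_zero[of "- (m / 16) * t"] by linarith
    next
      case False
      have "sinh (\<mu> * t) / \<mu> \<le> t * cosh (\<mu> * t)"
        using sinh_le_mult_cosh[of "\<mu> * t"] mu t by (simp add: field_simps)
      then have "exp (- ?a * t) * (sinh (\<mu> * t) / \<mu>) \<le> exp (- ?a * t) * (t * cosh (\<mu> * t))"
        by (intro mult_left_mono) auto
      also have "\<dots> = t * (exp (- ?a * t) * cosh (\<mu> * t))" by simp
      also have "\<dots> \<le> t * exp (- (?a - \<mu>) * t)" by (intro mult_left_mono cosh t)
      also have "\<dots> \<le> 16 * ?e" using te[of "?a - \<mu>"] False a m by simp
      finally show ?thesis .
    qed
    have "0 \<le> sinh (\<mu> * t)" using mu t by simp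
    then show ?thesis using c s mu \<open>\<not> 0 < ?q\<close> unfolding osc_c_def osc_s_def \<mu>_def[symmetric] by simp
  qed
  then have cs: "exp (- ?a * t) * \<bar>osc_c ?q t\<bar> \<le> ?e" "exp (- ?a * t) * \<bar>osc_s ?q t\<bar> \<le> 16 * ?e" by auto
  show p1: "\<bar>prop1 m t\<bar> \<le> 16 * ?e" using cs(2) by (simp add: prop1_def abs_mult)
  have "prop0 m t = exp (- ?a * t) * osc_c ?q t + ?a * prop1 m t"
    by (simp add: prop0_def prop1_def algebra_simps)
  then have "\<bar>prop0 m t\<bar> \<le> exp (- ?a * t) * \<bar>osc_c ?q t\<bar> + ?a * \<bar>prop1 m t\<bar>"
    using abs_triangle_ineq[of "exp (- ?a * t) * osc_c ?q t" "?a * prop1 m t"] a by (simp add: abs_mult)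
  also have "\<dots> \<le> ?e + 1 / 2 * (16 * ?e)"
    using cs(1) p1 a by (intro add_mono mult_mono) auto
  finally show "\<bar>prop0 m t\<bar> \<le> 9 * ?e" by simp
qed

section \<open>The multipliers of the profile and their distance from the propagators\<close>

definition approx0 :: "real \<Rightarrow> real \<Rightarrow> real" where
  "approx0 m t = exp (- t / (2 * m)) * cos (sqrt m * t)"

definition approx1 :: "real \<Rightarrow> real \<Rightarrow> real" where
  "approx1 m t = exp (- t / (2 * m)) * (sin (sqrt m * t) / sqrt m)"

lemma approx_borel [measurable]:
  "(\<lambda>m. approx0 m t) \<in> borel_measurable borel" "(\<lambda>m. approx1 m t) \<in> borel_measurable borel"
  unfolding approx0_def approx1_def by measurable

lemma approx_bounds:
  assumes "0 < m" "0 \<le> t"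
  shows "\<bar>approx0 m t\<bar> \<le> exp (- t / (2 * m))" "\<bar>approx1 m t\<bar> \<le> t * exp (- t / (2 * m))"
proof -
  show "\<bar>approx0 m t\<bar> \<le> exp (- t / (2 * m))" by (simp add: approx0_def abs_mult mult_left_le)
  have "\<bar>sin (sqrt m * t) / sqrt m\<bar> \<le> t"
    using abs_sin_x_le_abs_x[of "sqrt m * t"] assms by (simp add: abs_mult field_simps)
  then show "\<bar>approx1 m t\<bar> \<le> t * exp (- t / (2 * m))"
    unfolding approx1_def abs_mult[of "exp _"] mult.commute[of t] abs_exp_cancel by (rule mult_left_mono) simp
qed

text \<open>For \<open>m \<le> 1\<close> the exponent \<open>1 / (2 * m)\<close> is at least 1/2;
  the decay is weakened to the rate of \<open>prop_low\<close> so that both can be added.\<close>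

lemma approx_low:
  assumes m: "0 < m" "m \<le> 1" and t: "0 \<le> t"
  shows "\<bar>approx0 m t\<bar> \<le> exp (- (m / 16) * t)" "\<bar>approx1 m t\<bar> \<le> 16 * exp (- (m / 16) * t)"
proof -
  have "1 / 2 \<le> 1 / (2 * m)" using m by (simp add: field_simps)
  then have "1 / 2 * t \<le> 1 / (2 * m) * t" using t by (rule mult_right_mono)
  then have e: "exp (- t / (2 * m)) \<le> exp (- (1 / 2) * t)" by simp
  also have "\<dots> \<le> exp (- (m / 16) * t)" using m t by (intro exp_decay_mono) auto
  finally show "\<bar>approx0 m t\<bar> \<le> exp (- (m / 16) * t)" using approx_bounds(1)[OF m(1) t] by linarith
  have "t * exp (- t / (2 * m)) \<le> t * exp (- (1 / 2) * t)" by (rule mult_left_mono[OF e t])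
  also have "\<dots> \<le> 16 * exp (- (m / 16) * t)" using m t by (intro mult_exp_le) auto
  finally show "\<bar>approx1 m t\<bar> \<le> 16 * exp (- (m / 16) * t)" using approx_bounds(2)[OF m(1) t] by linarith
qed

lemma abs_cos_diff_le: "\<bar>cos x - cos y\<bar> \<le> \<bar>x - y :: real\<bar>"
  using field_differentiable_bound[of UNIV cos "\<lambda>x. - sin x" 1 x y]
  by (auto intro!: derivative_eq_intros)

lemma abs_sin_diff_le: "\<bar>sin x - sin y\<bar> \<le> \<bar>x - y :: real\<bar>"
  using field_differentiable_bound[of UNIV sin cos 1 x y]
  by (auto intro!: derivative_eq_intros)

text \<open>Replacing the frequency and replacing the exponential each cost
  \<open>t / p\<^sup>2\<close>; the change of amplitude costs \<open>1 / p\<close>. In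
  \<open>prop1\<close> all terms carry a further inverse frequency of size
  \<open>2 / sqrt p\<close>, which is why \<open>u1\<close> needs one power of the weight less than
  \<open>u0\<close>.\<close>

lemma prop_approx_high:
  assumes m: "1 \<le> m" and t: "0 \<le> t"
  defines "p \<equiv> 1 + m"
  defines "G \<equiv> exp (- damp m * t) * (2 * t / p\<^sup>2 + 1 / p)"
  shows "\<bar>prop0 m t - approx0 m t\<bar> \<le> G" "\<bar>prop1 m t - approx1 m t\<bar> \<le> 2 / sqrt p * G"
proof -
  let ?a = "damp m"
  define \<omega> where "\<omega> = sqrt (freq2 m)"
  have p: "2 \<le> p" using m by (simp add: p_def)
  have a: "?a = 1 / (2 * p)" by (simp add: damp_def p_def)
  have a2: "?a\<^sup>2 \<le> 1 / p\<^sup>2" using p by (simp add: a power2_eq_square divide_simps)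
  have a16: "?a\<^sup>2 \<le> 1 / 16"
  proof -
    have "?a \<le> 1 / 4" using p by (simp add: a field_simps)
    then have "?a\<^sup>2 \<le> (1 / 4)\<^sup>2" using p by (intro power_mono) (auto simp: a)
    then show ?thesis by (simp add: power2_eq_square)
  qed
  have q: "p / 4 \<le> freq2 m" "0 < freq2 m" using a16 m by (auto simp: freq2_def p_def)
  have w2: "\<omega> * \<omega> = m - ?a\<^sup>2" using q by (simp add: \<omega>_def freq2_def)
  have wp: "sqrt p / 2 \<le> \<omega>"
  proof -
    have "sqrt (p / 4) \<le> \<omega>" unfolding \<omega>_def using q(1) by (rule real_sqrt_le_mono)
    then show ?thesis by (simp add: real_sqrt_divide)
  qed
  have sp: "1 \<le> sqrt p" using p by simp
  have w0: "1 / 2 \<le> \<omega>" "0 < \<omega>" using wp sp by linarith+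
  have mp: "sqrt p / 2 \<le> sqrt m" and m1: "1 \<le> sqrt m"
  proof -
    have "sqrt (p / 4) \<le> sqrt m" using m by (intro real_sqrt_le_mono) (simp add: p_def)
    then show "sqrt p / 2 \<le> sqrt m" by (simp add: real_sqrt_divide)
    show "1 \<le> sqrt m" using m by simp
  qed
  have iw: "1 / \<omega> \<le> 2 / sqrt p"
    using divide_left_mono[OF wp, of 1] w0 sp by simp
  have im: "1 / sqrt m \<le> 2 / sqrt p"
    using divide_left_mono[OF mp, of 1] m1 sp by simp
  \<comment> \<open>The difference of the square roots is
    \<open>?a\<^sup>2 / (sqrt m + \<omega>)\<close> with a denominator of at least 1.\<close>
  have dw: "0 \<le> sqrt m - \<omega>" "sqrt m - \<omega> \<le> 1 / p\<^sup>2"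
  proof -
    have "freq2 m \<le> m" by (simp add: freq2_def)
    then show 0: "0 \<le> sqrt m - \<omega>" unfolding \<omega>_def by simp
    have "(sqrt m - \<omega>) * 1 \<le> (sqrt m - \<omega>) * (sqrt m + \<omega>)" using 0 m1 w0 by (intro mult_left_mono) auto
    also have "\<dots> = ?a\<^sup>2" using w2 m by (simp add: algebra_simps)
    finally show "sqrt m - \<omega> \<le> 1 / p\<^sup>2" using a2 by simp
  qed
  have phase: "\<bar>\<omega> * t - sqrt m * t\<bar> \<le> t / p\<^sup>2"
  proof -
    have "\<bar>\<omega> * t - sqrt m * t\<bar> = (sqrt m - \<omega>) * t"
      using mult_nonneg_nonneg[OF dw(1) t] by (simp add: algebra_simps)
    also have "\<dots> \<le> 1 / p\<^sup>2 * t" by (rule mult_right_mono[OF dw(2) t])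
    finally show ?thesis by simp
  qed
  let ?e = "exp (- ?a * t)" and ?f = "exp (- t / (2 * m))"
  have ef: "\<bar>?e - ?f\<bar> \<le> ?e * (t / p\<^sup>2)"
  proof -
    \<comment> \<open>\<open>y\<close> is the gap between the two exponents. It is nonnegative, so
      \<open>?e\<close> is the larger exponential and can be factored out of every error
      term.\<close>
    define y where "y = t / (2 * m) - ?a * t"
    have y: "y = t / (2 * (m * p))" using m p unfolding y_def a p_def by (simp add: divide_simps) (simp add: algebra_simps)
    have y0: "0 \<le> y" using m p t by (simp add: y)
    have "p * p \<le> (2 * m) * p" using m p by (intro mult_right_mono) (auto simp: p_def)
    then have "p\<^sup>2 \<le> 2 * (m * p)" by (simp add: power2_eq_square)
    then have yp: "y \<le> t / p\<^sup>2" unfolding y using t p m by (intro divide_left_mono) auto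
    have "?f = ?e * exp (- y)" unfolding y_def by (simp add: exp_add[symmetric])
    then have "?e - ?f = ?e * (1 - exp (- y))" by (simp add: right_diff_distrib)
    then have "\<bar>?e - ?f\<bar> = ?e * \<bar>1 - exp (- y)\<bar>" by (simp only: abs_mult abs_exp_cancel)
    also have "\<bar>1 - exp (- y)\<bar> = 1 - exp (- y)" using y0 by simp
    also have "1 - exp (- y) \<le> y" using exp_ge_add_one_self[of "- y"] by linarith
    also note yp
    finally show ?thesis by simp
  qed
  have cs: "osc_c (freq2 m) t = cos (\<omega> * t)" "osc_s (freq2 m) t = sin (\<omega> * t) / \<omega>"
    using q by (auto simp: osc_c_def osc_s_def \<omega>_def)
  have e0: "0 < ?e" by simp
  have "prop0 m t - approx0 m t
    = ?e * (cos (\<omega> * t) - cos (sqrt m * t)) + (?e - ?f) * cos (sqrt m * t) + ?e * (?a * (sin (\<omega> * t) / \<omega>))"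
    by (simp add: prop0_def approx0_def cs algebra_simps)
  also have "\<bar>\<dots>\<bar> \<le> ?e * (t / p\<^sup>2) + ?e * (t / p\<^sup>2) + ?e * (1 / p)"
  proof (intro order.trans[OF abs_triangle_ineq] add_mono)
    show "\<bar>?e * (cos (\<omega> * t) - cos (sqrt m * t))\<bar> \<le> ?e * (t / p\<^sup>2)"
      unfolding abs_mult abs_exp_cancel by (intro mult_left_mono order.trans[OF abs_cos_diff_le phase]) simp
    show "\<bar>(?e - ?f) * cos (sqrt m * t)\<bar> \<le> ?e * (t / p\<^sup>2)"
      unfolding abs_mult using mult_mono[OF ef abs_cos_le_one[of "sqrt m * t"]] t p by simp
    have "\<bar>?a * (sin (\<omega> * t) / \<omega>)\<bar> = ?a * \<bar>sin (\<omega> * t)\<bar> * (1 / \<omega>)" using w0 p by (simp add: abs_mult a)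
    also have "\<dots> \<le> ?a * 1 * 2" using w0 p by (intro mult_mono) (auto simp: a field_simps)
    also have "\<dots> = 1 / p" using p by (simp add: a)
    finally show "\<bar>?e * (?a * (sin (\<omega> * t) / \<omega>))\<bar> \<le> ?e * (1 / p)"
      unfolding abs_mult[of ?e] abs_exp_cancel by (rule mult_left_mono) simp
  qed
  also have "\<dots> = G" by (simp add: G_def algebra_simps)
  finally show "\<bar>prop0 m t - approx0 m t\<bar> \<le> G" .
  have "prop1 m t - approx1 m t
    = ?e * ((sin (\<omega> * t) - sin (sqrt m * t)) * (1 / \<omega>)) + (?e - ?f) * (sin (sqrt m * t) * (1 / sqrt m))
      + ?e * (sin (sqrt m * t) * (1 / \<omega> - 1 / sqrt m))"
    by (simp add: prop1_def approx1_def cs algebra_simps)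
  also have "\<bar>\<dots>\<bar> \<le> ?e * (t / p\<^sup>2 * (2 / sqrt p)) + ?e * (t / p\<^sup>2) * (1 * (2 / sqrt p)) + ?e * (1 * (1 / p * (2 / sqrt p)))"
  proof (intro order.trans[OF abs_triangle_ineq] add_mono)
    show "\<bar>?e * ((sin (\<omega> * t) - sin (sqrt m * t)) * (1 / \<omega>))\<bar> \<le> ?e * (t / p\<^sup>2 * (2 / sqrt p))"
      unfolding abs_mult using order.trans[OF abs_sin_diff_le phase] iw w0 t p by (intro mult_mono) auto
    show "\<bar>(?e - ?f) * (sin (sqrt m * t) * (1 / sqrt m))\<bar> \<le> ?e * (t / p\<^sup>2) * (1 * (2 / sqrt p))"
      unfolding abs_mult using ef im m1 t p by (intro mult_mono) auto
    have "1 / \<omega> - 1 / sqrt m = (sqrt m - \<omega>) * (1 / \<omega>) * (1 / sqrt m)" using w0 m1 by (simp add: field_simps)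
    also have "\<bar>\<dots>\<bar> \<le> 1 / p * (2 / sqrt p) * 1"
    proof -
      have "1 / p\<^sup>2 \<le> 1 / p" using p by (intro divide_left_mono) (auto simp: power2_eq_square)
      then have "\<bar>sqrt m - \<omega>\<bar> \<le> 1 / p" using dw by linarith
      then show ?thesis unfolding abs_mult using iw w0 m1 p by (intro mult_mono) auto
    qed
    finally have "\<bar>1 / \<omega> - 1 / sqrt m\<bar> \<le> 1 / p * (2 / sqrt p)" by simp
    then show "\<bar>?e * (sin (sqrt m * t) * (1 / \<omega> - 1 / sqrt m))\<bar> \<le> ?e * (1 * (1 / p * (2 / sqrt p)))"
      unfolding abs_mult by (intro mult_mono) auto
  qed
  also have "\<dots> = 2 / sqrt p * G" by (simp add: G_def algebra_simps)
  finally show "\<bar>prop1 m t - approx1 m t\<bar> \<le> 2 / sqrt p * G" .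
qed

section \<open>The supremum over high frequencies\<close>

lemma powr_exp_bound:
  fixes x k :: real assumes "0 < x" "0 < k"
  shows "x powr k * exp (- x) \<le> k powr k"
proof -
  have "x / k \<le> exp (x / k)" using exp_ge_add_one_self[of "x / k"] by linarith
  then have "x \<le> k * exp (x / k)" using assms by (simp add: field_simps)
  then have "x powr k \<le> (k * exp (x / k)) powr k" using assms by (intro powr_mono2) auto
  also have "\<dots> = k powr k * exp x" using assms by (simp add: powr_mult exp_powr_real)
  finally have "x powr k * exp (- x) \<le> k powr k * exp x * exp (- x)" by (intro mult_right_mono) auto
  then show ?thesis by (simp only: mult.assoc exp_minus_inverse mult_1_right)
qed

text \<open>Bounds \<open>x powr (l + 3) * (2 * x + 1)\<^sup>2 * exp (- x)\<close> for positive
  \<open>x\<close>: the square is at most \<open>8 * x\<^sup>2 + 2\<close>, and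
  \<open>x powr k * exp (- x) \<le> k powr k\<close> is used for \<open>k = l + 5\<close> and
  \<open>k = l + 3\<close>.\<close>

definition high_const :: "real \<Rightarrow> real" where
  "high_const l = 8 * (l + 5) powr (l + 5) + 2 * (l + 3) powr (l + 3)"

text \<open>The scaling variable is \<open>x = t / p\<close>. The weight contributes
  \<open>l + 1\<close> powers of \<open>p\<close> and the factor \<open>1 / p\<^sup>2\<close> two
  more; converting all of them into powers of \<open>t\<close> produces the exponent
  \<open>l + 3\<close> and leaves a bounded function of \<open>x\<close>.\<close>

lemma high_weight_bound:
  assumes t: "0 < t" and p: "0 < p" and l: "0 \<le> l"
  shows "(exp (- (t / (2 * p))) * (2 * t / p\<^sup>2 + 1 / p))\<^sup>2 \<le> high_const l * t powr (- (l + 3)) * p powr (l + 1)"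
proof -
  define x where "x = t / p"
  have x: "0 < x" using t p by (simp add: x_def)
  have tp: "t = x * p" using p by (simp add: x_def)
  have "(exp (- (t / (2 * p))) * (2 * t / p\<^sup>2 + 1 / p))\<^sup>2 = exp (- x) * ((2 * x + 1)\<^sup>2 / p\<^sup>2)"
  proof -
    have "2 * t / p\<^sup>2 + 1 / p = (2 * x + 1) / p" using p by (simp add: tp power2_eq_square field_simps)
    moreover have "(exp (- (t / (2 * p))))\<^sup>2 = exp (- x)"
      using p by (simp add: tp power2_eq_square exp_add[symmetric])
    ultimately show ?thesis by (simp add: power_mult_distrib power_divide)
  qed
  also have "\<dots> = (x powr (l + 3) * (2 * x + 1)\<^sup>2 * exp (- x)) * (t powr (- (l + 3)) * p powr (l + 1))"
  proof -
    have 1: "t powr (- (l + 3)) = x powr (- (l + 3)) * p powr (- (l + 3))"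
      unfolding tp using x p by (simp add: powr_mult)
    have 2: "x powr (l + 3) * x powr (- (l + 3)) = 1" using x by (simp flip: powr_add)
    have 3: "p powr (- (l + 3)) * p powr (l + 1) = 1 / p\<^sup>2"
      using p by (simp add: powr_minus_divide powr_numeral flip: powr_add)
    have "(x powr (l + 3) * (2 * x + 1)\<^sup>2 * exp (- x)) * (t powr (- (l + 3)) * p powr (l + 1))
        = (x powr (l + 3) * x powr (- (l + 3))) * (p powr (- (l + 3)) * p powr (l + 1)) * ((2 * x + 1)\<^sup>2 * exp (- x))"
      unfolding 1 by (simp only: mult_ac)
    then show ?thesis unfolding 2 3 by simp
  qed
  also have "\<dots> \<le> high_const l * (t powr (- (l + 3)) * p powr (l + 1))"
  proof (rule mult_right_mono)
    have "(2 * x + 1)\<^sup>2 \<le> 8 * x\<^sup>2 + 2"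
      using zero_le_power2[of "2 * x - 1"] by (simp add: power2_eq_square algebra_simps)
    then have "x powr (l + 3) * (2 * x + 1)\<^sup>2 * exp (- x) \<le> x powr (l + 3) * (8 * x\<^sup>2 + 2) * exp (- x)"
      by (intro mult_right_mono mult_left_mono) auto
    also have "\<dots> = 8 * (x powr (l + 5) * exp (- x)) + 2 * (x powr (l + 3) * exp (- x))"
    proof -
      have "l + 5 = (l + 3) + 2" by simp
      then have "x powr (l + 5) = x powr (l + 3) * x powr 2" by (simp only: powr_add)
      then have "x powr (l + 5) = x powr (l + 3) * x\<^sup>2" using x by (simp add: powr_numeral)
      then show ?thesis by (simp add: algebra_simps)
    qed
    also have "\<dots> \<le> high_const l"
      unfolding high_const_def using x l by (intro add_mono mult_left_mono powr_exp_bound) auto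
    finally show "x powr (l + 3) * (2 * x + 1)\<^sup>2 * exp (- x) \<le> high_const l" .
  qed auto
  finally show ?thesis by (simp add: mult.assoc)
qed

section \<open>From multiplier bounds to the L2 estimate\<close>

lemma Lsym_ge:
  assumes "Lsym x \<le> 1" shows "(norm x)\<^sup>2 / 3 \<le> Lsym x"
proof -
  define r where "r = (norm x)\<^sup>2"
  have r: "0 \<le> r" by (simp add: r_def)
  have L: "Lsym x = ln (1 + r)" by (simp add: Lsym_def r_def)
  have "1 + r = exp (Lsym x)" using r by (simp add: L)
  also have "\<dots> \<le> exp 1" using assms by simp
  also have "\<dots> \<le> 3" by (rule exp_le)
  finally have r3: "1 + r \<le> 3" .
  \<comment> \<open>The logarithm inequality at the reciprocal gives
    \<open>r / (1 + r) \<le> Lsym x\<close>, and \<open>Lsym x \<le> 1\<close> bounds the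
    denominator by \<open>exp 1\<close>, hence by 3.\<close>
  have "ln (1 / (1 + r)) \<le> 1 / (1 + r) - 1" using r by (intro ln_le_minus_one) auto
  then have "1 - 1 / (1 + r) \<le> Lsym x" using r by (simp add: L ln_div)
  moreover have "r / 3 \<le> 1 - 1 / (1 + r)"
  proof -
    have "r * (1 + r) \<le> r * 3" using r r3 by (intro mult_left_mono)
    then show ?thesis using r by (simp add: field_simps)
  qed
  ultimately show ?thesis by (simp add: r_def)
qed

lemma fourier_L11_bound:
  assumes "f \<in> L11_space" "f \<in> L2_space"
  shows "AE \<xi> in lborel. cmod (fourier f \<xi>) \<le> L11_norm f"
proof -
  have i: "integrable lborel f" "integrable lborel (\<lambda>x. (1 + norm x) * cmod (f x))"
    using assms(1) by (auto simp: L11_space_def)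
  have "(LINT x|lborel. cmod (f x)) \<le> L11_norm f"
    unfolding L11_norm_def using i by (intro integral_mono) (auto simp: distrib_right)
  then have "cmod (fourier_integral f \<xi>) \<le> L11_norm f" for \<xi>
    using fourier_integral_bound[OF i(1), of \<xi>] by linarith
  moreover have "f \<in> L1_L2" using i assms by (simp add: L1_L2_def)
  ultimately show ?thesis using fourier_L1_L2 by fastforce
qed

lemma Y_normD:
  assumes "f \<in> Y_space \<delta>"
  shows "f \<in> L2_space" "integrable lborel (\<lambda>\<xi>. (1 + Lsym \<xi>) powr \<delta> * (cmod (fourier f \<xi>))\<^sup>2)"
    "(LINT \<xi>|lborel. (1 + Lsym \<xi>) powr \<delta> * (cmod (fourier f \<xi>))\<^sup>2) = (Y_norm \<delta> f)\<^sup>2"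
  using assms by (auto simp: Y_space_def Y_norm_def)

lemma Lsym_pos_AE: "AE \<xi> in (lborel :: 'a::euclidean_space measure). 0 < Lsym \<xi>"
proof -
  have "AE \<xi> in (lborel :: 'a measure). \<xi> \<noteq> 0" by (rule AE_lborel_singleton)
  then show ?thesis by eventually_elim (auto simp: Lsym_def intro!: ln_gt_zero)
qed

lemma phi2_eq:
  "phi2 u0 u1 t \<xi> = approx0 (Lsym \<xi>) t * fourier u0 \<xi> + approx1 (Lsym \<xi>) t * fourier u1 \<xi>"
  by (simp add: phi2_def approx0_def approx1_def)

lemma phi2_L2:
  assumes u0: "u0 \<in> L2_space" and u1: "u1 \<in> L2_space" and t: "0 \<le> t"
  shows "phi2 u0 u1 t \<in> L2_space"
proof (rule L2_bounded_byD(1))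
  have F: "fourier u0 \<in> L2_space" "fourier u1 \<in> L2_space" using u0 u1 by (auto intro: fourier_L2)
  then have [measurable]: "fourier u0 \<in> borel_measurable borel" "fourier u1 \<in> borel_measurable borel" by auto
  show "L2_bounded_by (\<lambda>\<xi>. cmod (fourier u0 \<xi>) + t * cmod (fourier u1 \<xi>))
      (L2_norm (fourier u0) + t * L2_norm (fourier u1))"
    by (intro L2_bounded_by_add L2_bounded_by_mult L2_bounded_by_cmod F t)
  show "phi2 u0 u1 t \<in> borel_measurable lborel" unfolding phi2_eq[abs_def] by measurable
  show "AE \<xi> in lborel. cmod (phi2 u0 u1 t \<xi>) \<le> cmod (fourier u0 \<xi>) + t * cmod (fourier u1 \<xi>)"
    using Lsym_pos_AE
  proof eventually_elim
    fix \<xi> :: 'a assume L: "0 < Lsym \<xi>"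
    have e: "exp (- t / (2 * Lsym \<xi>)) \<le> 1" using L t by simp
    note ab = approx_bounds[OF L t]
    have "\<bar>approx0 (Lsym \<xi>) t\<bar> \<le> 1" using ab(1) e by linarith
    moreover have "\<bar>approx1 (Lsym \<xi>) t\<bar> \<le> t" using ab(2) mult_left_mono[OF e t] by simp
    ultimately show "cmod (phi2 u0 u1 t \<xi>) \<le> cmod (fourier u0 \<xi>) + t * cmod (fourier u1 \<xi>)"
      unfolding phi2_eq by (intro norm_triangle_le add_mono)
        (auto simp: norm_mult mult_left_le_one_le intro: mult_right_mono)
  qed
qed

text \<open>The majorant is the sum of those for the two regimes, so a single inequality holds at
  almost every frequency and the integral need not be split. The function \<open>g\<close> has to
  dominate the exponential only where \<open>m \<le> 1\<close>, which lets it be a Gaussian.\<close>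

lemma difference_pointwise:
  fixes a b :: complex
  assumes L: "0 < m" and q: "freq2 m \<noteq> 0" and t: "0 < t" and l: "0 \<le> l"
    and a: "cmod a \<le> N0" and b: "cmod b \<le> N1" and g: "m \<le> 1 \<Longrightarrow> exp (- (m / 8) * t) \<le> g" and g0: "0 \<le> g"
  shows "(cmod ((prop0 m t - approx0 m t) * a + (prop1 m t - approx1 m t) * b))\<^sup>2
    \<le> 2048 * (N0\<^sup>2 + N1\<^sup>2) * g
      + 8 * high_const l * t powr (- (l + 3)) * ((1 + m) powr (l + 1) * (cmod a)\<^sup>2 + (1 + m) powr l * (cmod b)\<^sup>2)"
proof (cases "m \<le> 1")
  case True
  let ?e = "exp (- (m / 16) * t)"
  have t0: "0 \<le> t" using t by simp
  \<comment> \<open>The common constant 32 covers \<open>9 + 1\<close> for the first difference and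
    \<open>16 + 16\<close> for the second. Its square 1024, doubled by
    \<open>cmod_add_power2_le\<close>, is the 2048 of the statement.\<close>
  have d0: "\<bar>prop0 m t - approx0 m t\<bar> \<le> 32 * ?e"
    using prop_low(2)[OF L True q t0] approx_low(1)[OF L True t0] exp_gt_zero[of "- (m / 16) * t"] by linarith
  have d1: "\<bar>prop1 m t - approx1 m t\<bar> \<le> 32 * ?e"
    using prop_low(1)[OF L True q t0] approx_low(2)[OF L True t0] by linarith
  have sq: "(cmod (complex_of_real d * z))\<^sup>2 \<le> 1024 * g * N\<^sup>2" if "\<bar>d\<bar> \<le> 32 * ?e" "cmod z \<le> N" for d z N
  proof -
    have "(cmod (complex_of_real d * z))\<^sup>2 \<le> (32 * ?e * N)\<^sup>2"
      unfolding norm_mult norm_of_real using that by (intro power_mono mult_mono) auto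
    also have "\<dots> = 1024 * exp (- (m / 8) * t) * N\<^sup>2"
      by (simp add: power2_eq_square exp_add[symmetric])
    also have "\<dots> \<le> 1024 * g * N\<^sup>2" by (intro mult_right_mono mult_left_mono g True) auto
    finally show ?thesis .
  qed
  have "(cmod ((prop0 m t - approx0 m t) * a + (prop1 m t - approx1 m t) * b))\<^sup>2
    \<le> 2 * (1024 * g * N0\<^sup>2) + 2 * (1024 * g * N1\<^sup>2)"
    by (intro order.trans[OF cmod_add_power2_le] add_mono mult_left_mono sq[OF d0 a] sq[OF d1 b]) auto
  also have "\<dots> = 2048 * (N0\<^sup>2 + N1\<^sup>2) * g" by (simp add: algebra_simps)
  also have "\<dots> \<le> 2048 * (N0\<^sup>2 + N1\<^sup>2) * g
      + 8 * high_const l * t powr (- (l + 3)) * ((1 + m) powr (l + 1) * (cmod a)\<^sup>2 + (1 + m) powr l * (cmod b)\<^sup>2)"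
    by (simp add: high_const_def)
  finally show ?thesis .
next
  case False
  then have m: "1 \<le> m" by simp
  define p where "p = 1 + m"
  have p: "0 < p" using L by (simp add: p_def)
  define G where "G = exp (- damp m * t) * (2 * t / p\<^sup>2 + 1 / p)"
  have G0: "0 \<le> G" using p t by (simp add: G_def)
  have G: "G\<^sup>2 \<le> high_const l * t powr (- (l + 3)) * p powr (l + 1)"
    using high_weight_bound[OF t p l] by (simp add: G_def damp_def p_def)
  note d = prop_approx_high[OF m less_imp_le[OF t], folded p_def, folded G_def]
  have "(cmod ((prop0 m t - approx0 m t) * a))\<^sup>2 \<le> (G * cmod a)\<^sup>2"
    unfolding norm_mult norm_of_real by (intro power_mono mult_right_mono d(1)) auto
  moreover have "(cmod ((prop1 m t - approx1 m t) * b))\<^sup>2 \<le> (2 / sqrt p * G * cmod b)\<^sup>2"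
    unfolding norm_mult norm_of_real by (intro power_mono mult_right_mono d(2)) auto
  ultimately have "(cmod ((prop0 m t - approx0 m t) * a + (prop1 m t - approx1 m t) * b))\<^sup>2
    \<le> 2 * (G * cmod a)\<^sup>2 + 2 * (2 / sqrt p * G * cmod b)\<^sup>2"
    by (intro order.trans[OF cmod_add_power2_le] add_mono mult_left_mono) auto
  also have "\<dots> = G\<^sup>2 * (2 * (cmod a)\<^sup>2 + 8 / p * (cmod b)\<^sup>2)"
    using p by (simp add: power_mult_distrib power_divide algebra_simps)
  also have "\<dots> \<le> (high_const l * t powr (- (l + 3)) * p powr (l + 1)) * (2 * (cmod a)\<^sup>2 + 8 / p * (cmod b)\<^sup>2)"
    using p by (intro mult_right_mono G) auto
  \<comment> \<open>The coefficient 2 is raised to 8 to match \<open>8 / p\<close>, which is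
    \<open>2 * (2 / sqrt p)\<^sup>2\<close>; its \<open>1 / p\<close> lowers the weight of
    \<open>b\<close> from \<open>l + 1\<close> to \<open>l\<close>.\<close>
  also have "\<dots> \<le> (high_const l * t powr (- (l + 3)) * p powr (l + 1)) * (8 * (cmod a)\<^sup>2 + 8 / p * (cmod b)\<^sup>2)"
    using p by (intro mult_left_mono add_mono) (auto simp: high_const_def)
  also have "\<dots> = 8 * high_const l * t powr (- (l + 3)) * (p powr (l + 1) * (cmod a)\<^sup>2 + p powr l * (cmod b)\<^sup>2)"
  proof -
    have "p powr (l + 1) = p powr l * p" using p by (simp add: powr_add)
    then show ?thesis using p by (simp add: field_simps)
  qed
  also have "\<dots> \<le> 2048 * (N0\<^sup>2 + N1\<^sup>2) * g + 8 * high_const l * t powr (- (l + 3)) * (p powr (l + 1) * (cmod a)\<^sup>2 + p powr l * (cmod b)\<^sup>2)"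
    using g0 by simp
  finally show ?thesis by (simp add: p_def)
qed

text \<open>The squared error has a part of order \<open>t powr (- n / 2)\<close> and one of order
  \<open>t powr (- (l + 3))\<close>. As \<open>t \<ge> 1\<close>, any \<open>2 * r\<close> not
  exceeding either exponent is admissible, so the cases of the theorem differ only in the choice of
  \<open>r\<close>. The divisor in \<open>C\<close> is the Plancherel constant.\<close>

lemma asymptotic_profile:
  fixes u :: "real \<Rightarrow> 'a::euclidean_space \<Rightarrow> complex"
  assumes l: "0 \<le> l"
    and u0: "u0 \<in> L11_space \<inter> Y_space (l + 1)" and u1: "u1 \<in> L11_space \<inter> Y_space l"
    and sol: "is_solution u0 u1 u" and t: "1 \<le> t"
    and r: "2 * r \<le> real DIM('a) / 2" "2 * r \<le> l + 3"
  defines "C \<equiv> sqrt (2048 * sqrt (24 * pi) ^ DIM('a) + 8 * high_const l) / fourier_scale TYPE('a)"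
  shows "(\<lambda>x. u t x - inv_fourier (phi2 u0 u1 t) x) \<in> L2_space"
    and "L2_norm (\<lambda>x. u t x - inv_fourier (phi2 u0 u1 t) x) \<le> C * I0 l u0 u1 * t powr (- r)"
proof -
  let ?n = "DIM('a)"
  have t0: "0 < t" "0 \<le> t" using t by auto
  have Y0: "u0 \<in> Y_space (l + 1)" and Y1: "u1 \<in> Y_space l" using u0 u1 by auto
  note y0 = Y_normD[OF Y0] and y1 = Y_normD[OF Y1]
  have phi: "phi2 u0 u1 t \<in> L2_space" by (rule phi2_L2[OF y0(1) y1(1) t0(2)])
  note sf = solution_formula[OF sol y0(1) y1(1) t0(1)]
  note iv = inv_fourier[OF phi]
  let ?D = "\<lambda>x. u t x - inv_fourier (phi2 u0 u1 t) x"
  show D: "?D \<in> L2_space" by (intro L2_space_diff sf(1) iv(1))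
  \<comment> \<open>With this scale \<open>g \<xi>\<close> is
    \<open>exp (- (norm \<xi>)\<^sup>2 * t / 24)\<close>; the 24 is the 8 of the squared
    low-frequency rate \<open>m / 8\<close> times the 3 of \<open>Lsym_ge\<close>.\<close>
  define g where "g \<xi> = gauss (sqrt (t / 12) *\<^sub>R \<xi>)" for \<xi> :: 'a
  have st: "0 < sqrt (t / 12)" using t0 by simp
  have gi: "integrable lborel g" unfolding g_def by (rule gauss_integral(1)[OF st])
  have gI: "(LINT \<xi>|lborel. g \<xi>) = sqrt (24 * pi) ^ ?n * t powr (- (real ?n / 2))"
  proof -
    have "sqrt (2 * pi) / sqrt (t / 12) = sqrt (24 * pi) * t powr (- (1 / 2))"
      using t0 by (simp add: real_sqrt_divide[symmetric] powr_minus powr_half_sqrt divide_inverse[symmetric])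
    moreover have "(t powr (- (1 / 2))) ^ ?n = t powr (- (real ?n / 2))"
      using t0 by (simp add: powr_realpow[symmetric] powr_powr)
    ultimately show ?thesis unfolding g_def gauss_integral(2)[OF st] by (simp only: power_mult_distrib)
  qed
  define N where "N = (L11_norm u0)\<^sup>2 + (L11_norm u1)\<^sup>2"
  define P where "P \<xi> = (1 + Lsym \<xi>) powr (l + 1) * (cmod (fourier u0 \<xi>))\<^sup>2 + (1 + Lsym \<xi>) powr l * (cmod (fourier u1 \<xi>))\<^sup>2" for \<xi>
  have Pi: "integrable lborel P" unfolding P_def by (intro Bochner_Integration.integrable_add y0(2) y1(2))
  have PI: "(LINT \<xi>|lborel. P \<xi>) = (Y_norm (l + 1) u0)\<^sup>2 + (Y_norm l u1)\<^sup>2"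
    unfolding P_def Bochner_Integration.integral_add[OF y0(2) y1(2)] y0(3) y1(3) ..
  define H where "H = 8 * high_const l"
  have H0: "0 \<le> H" by (simp add: H_def high_const_def)
  define B where "B \<xi> = 2048 * N * g \<xi> + H * t powr (- (l + 3)) * P \<xi>" for \<xi>
  have Bi: "integrable lborel B" unfolding B_def by (intro Bochner_Integration.integrable_add integrable_mult_right gi Pi)
  have le: "AE \<xi> in lborel. (cmod (fourier ?D \<xi>))\<^sup>2 \<le> B \<xi>"
    using fourier_diff[OF sf(1) iv(1)] sf(2) iv(2) Lsym_pos_AE freq2_Lsym_nonzero
      fourier_L11_bound[OF IntD1[OF u0] y0(1)] fourier_L11_bound[OF IntD1[OF u1] y1(1)]
  proof eventually_elim
    case (elim \<xi>)
    have "fourier ?D \<xi> = (prop0 (Lsym \<xi>) t - approx0 (Lsym \<xi>) t) * fourier u0 \<xi>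
        + (prop1 (Lsym \<xi>) t - approx1 (Lsym \<xi>) t) * fourier u1 \<xi>"
      using elim by (simp add: phi2_eq algebra_simps)
    moreover have "exp (- (Lsym \<xi> / 8) * t) \<le> g \<xi>" if "Lsym \<xi> \<le> 1"
    proof -
      have "(norm \<xi>)\<^sup>2 / 24 * t \<le> Lsym \<xi> / 8 * t" using Lsym_ge[OF that] t0 by (intro mult_right_mono) auto
      then show ?thesis using t0 by (simp add: g_def gauss_def power_mult_distrib)
    qed
    moreover have "0 \<le> g \<xi>" using gauss_bounds(1)[of "sqrt (t / 12) *\<^sub>R \<xi>"] by (simp add: g_def)
    ultimately show ?case
      using difference_pointwise[OF elim(4,5) t0(1) l elim(6,7), of "g \<xi>"]
      unfolding B_def N_def P_def H_def by (simp only:)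
  qed
  have FD: "fourier ?D \<in> L2_space" by (rule fourier_L2[OF D])
  define I where "I = I0 l u0 u1"
  have I0: "0 \<le> I" by (simp add: I_def I0_def)
  have I2: "I\<^sup>2 = N + ((Y_norm (l + 1) u0)\<^sup>2 + (Y_norm l u1)\<^sup>2)" by (simp add: I_def I0_def N_def)
  have N0: "0 \<le> N" by (simp add: N_def)
  define S where "S = sqrt (24 * pi) ^ ?n"
  have S0: "0 \<le> S" by (simp add: S_def)
  have tr: "t powr (- (real ?n / 2)) \<le> t powr (- (2 * r))" "t powr (- (l + 3)) \<le> t powr (- (2 * r))"
    using t r by (auto intro!: powr_mono)
  have "(L2_norm (fourier ?D))\<^sup>2 \<le> (LINT \<xi>|lborel. B \<xi>)"
    unfolding L2_norm_power2 by (rule integral_mono_AE[OF L2_space_integrable[OF FD] Bi le])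
  also have "\<dots> = 2048 * N * (S * t powr (- (real ?n / 2))) + H * t powr (- (l + 3)) * ((Y_norm (l + 1) u0)\<^sup>2 + (Y_norm l u1)\<^sup>2)"
    unfolding B_def
    by (subst Bochner_Integration.integral_add) (use gi Pi in \<open>auto simp: gI PI S_def\<close>)
  also have "\<dots> \<le> 2048 * I\<^sup>2 * (S * t powr (- (2 * r))) + H * t powr (- (2 * r)) * I\<^sup>2"
    using I2 N0 H0 S0 tr by (intro add_mono mult_mono) auto
  also have "\<dots> = (sqrt (2048 * S + H) * I * t powr (- r))\<^sup>2"
  proof -
    have "(t powr (- r))\<^sup>2 = t powr (- (2 * r))" by (simp add: power2_eq_square flip: powr_add)
    then show ?thesis using S0 H0 by (simp add: power_mult_distrib algebra_simps)
  qed
  finally have "L2_norm (fourier ?D) \<le> sqrt (2048 * S + H) * I * t powr (- r)"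
    by (rule power2_le_imp_le) (use I0 S0 H0 in auto)
  then have "L2_norm ?D \<le> sqrt (2048 * S + H) * I * t powr (- r) / fourier_scale TYPE('a)"
    unfolding fourier_norm[OF D] by (simp add: field_simps)
  then show "L2_norm ?D \<le> C * I0 l u0 u1 * t powr (- r)"
    unfolding C_def S_def H_def I_def by (simp add: field_simps)
qed

theorem theorem1p2:
  fixes l :: real
  assumes "CARD('n::finite) \<ge> 5" and "l \<ge> 1"
  shows "\<exists>C::real. \<exists>t0::real. C > 0 \<and> t0 > 1 \<and> (\<forall>(u0 :: real ^ 'n \<Rightarrow> complex) u1 u.
    u0 \<in> L11_space \<inter> Y_space (l + 1) \<longrightarrow> u1 \<in> L11_space \<inter> Y_space l \<longrightarrow> is_solution u0 u1 u \<longrightarrow>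
    (\<forall>t\<ge>t0.
      ((5 \<le> CARD('n) \<and> CARD('n) \<le> 8 \<and> 1 \<le> l \<and> l < real CARD('n) / 2 - 1) \<or>
       (CARD('n) > 8 \<and> real CARD('n) / 2 - 3 < l \<and> l < real CARD('n) / 2 - 1) \<longrightarrow>
        (\<lambda>x. u t x - inv_fourier (phi2 u0 u1 t) x) \<in> L2_space \<and>
        L2_norm (\<lambda>x. u t x - inv_fourier (phi2 u0 u1 t) x)
          \<le> C * I0 l u0 u1 * t powr (- (real CARD('n) / 4))) \<and>
      (CARD('n) > 8 \<and> 1 \<le> l \<and> l \<le> real CARD('n) / 2 - 3 \<longrightarrow>
        (\<lambda>x. u t x - inv_fourier (phi2 u0 u1 t) x) \<in> L2_space \<and>
        L2_norm (\<lambda>x. u t x - inv_fourier (phi2 u0 u1 t) x)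
          \<le> C * I0 l u0 u1 * t powr (- ((l + 3) / 2)))))"
proof -
  define C where "C = sqrt (2048 * sqrt (24 * pi) ^ DIM(real ^ 'n) + 8 * high_const l) / fourier_scale TYPE(real ^ 'n)"
  have "0 \<le> high_const l" by (simp add: high_const_def)
  then have C: "0 < C" unfolding C_def
    by (intro divide_pos_pos real_sqrt_gt_zero add_pos_nonneg mult_pos_pos zero_less_power) auto
  have D: "DIM(real ^ 'n) = CARD('n)" by simp
  have l0: "0 \<le> l" using assms by simp
  note main = asymptotic_profile[where 'a="real ^ 'n" and l=l, folded C_def, OF l0, unfolded D]
  show ?thesis
  \<comment> \<open>The estimates hold from time 1 on; 2 is a convenient number above 1.\<close>
  proof (rule exI[of _ C], rule exI[of _ 2], intro conjI[OF C] conjI[of "1 < (2::real)"] allI impI)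
    fix u0 u1 :: "real ^ 'n \<Rightarrow> complex" and u and t :: real
    assume h: "u0 \<in> L11_space \<inter> Y_space (l + 1)" "u1 \<in> L11_space \<inter> Y_space l" "is_solution u0 u1 u" and t: "2 \<le> t"
    have t1: "1 \<le> t" using t by simp
    let ?d = "\<lambda>x. u t x - inv_fourier (phi2 u0 u1 t) x"
    note m = main[OF h t1]
    \<comment> \<open>Membership comes with the constraints on \<open>r\<close>, and
      \<open>r = 0\<close> satisfies them trivially.\<close>
    have 1: "?d \<in> L2_space" by (rule m(1)[of 0]) (use l0 in auto)
    have 2: "L2_norm ?d \<le> C * I0 l u0 u1 * t powr (- (real CARD('n) / 4))" if "real CARD('n) / 2 - 3 \<le> l"
      by (rule m(2)) (use that in auto)
    have 3: "L2_norm ?d \<le> C * I0 l u0 u1 * t powr (- ((l + 3) / 2))" if "l \<le> real CARD('n) / 2 - 3"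
      by (rule m(2)) (use that in auto)
    show "((5 \<le> CARD('n) \<and> CARD('n) \<le> 8 \<and> 1 \<le> l \<and> l < real CARD('n) / 2 - 1) \<or>
       (CARD('n) > 8 \<and> real CARD('n) / 2 - 3 < l \<and> l < real CARD('n) / 2 - 1) \<longrightarrow>
        ?d \<in> L2_space \<and> L2_norm ?d \<le> C * I0 l u0 u1 * t powr (- (real CARD('n) / 4))) \<and>
      (CARD('n) > 8 \<and> 1 \<le> l \<and> l \<le> real CARD('n) / 2 - 3 \<longrightarrow>
        ?d \<in> L2_space \<and> L2_norm ?d \<le> C * I0 l u0 u1 * t powr (- ((l + 3) / 2)))"
    proof (intro conjI impI 1)
      assume "(5 \<le> CARD('n) \<and> CARD('n) \<le> 8 \<and> 1 \<le> l \<and> l < real CARD('n) / 2 - 1) \<or>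
       (CARD('n) > 8 \<and> real CARD('n) / 2 - 3 < l \<and> l < real CARD('n) / 2 - 1)"
      \<comment> \<open>In dimension at most 8 the number \<open>n / 2 - 3\<close> is at most 1,
        hence at most \<open>l\<close>; both alternatives of case (a) thus lie on the same side of
        the threshold.\<close>
      then have "real CARD('n) / 2 - 3 \<le> l" by auto
      then show "L2_norm ?d \<le> C * I0 l u0 u1 * t powr (- (real CARD('n) / 4))" by (rule 2)
    qed (use 3 in auto)
  qed simp
qed

end
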